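(* Let $F_4:=(6,\{01,02,04\})$. Then $\lambda_{F_4}=40/243$. Furthermore, the $F_4$-problem is perfectly $B$-stable with $B:=(3,\{12\})$, by satisfying the flag algebra criterion for perfect stability (version (ii), as described in the context) with $N=6$ and $\tau:=(2,\{01\})$. Also, the unique (up to automorphisms of $B$) maximiser of $p(F_4,B(\boldsymbol x))$ over $\boldsymbol x\in\mathbb S_3$ is $\boldsymbol x=(1/3,1/3,1/3)$.
   Context: **Basic notions.** All graphs are finite and simple. $[m]=\{0,\dots,m-1\}$, and $(m,E)$ denotes the graph or pattern with vertex set $[m]$ and edge set $E$; $ij$ abbreviates $\{i,j\}$ ($ii$ is a loop). For graphs $F,G$ with $\kappa\le n$ vertices, $P(F,G)$ is the number of $\kappa$-subsets of $V(G)$ inducing a subgraph isomorphic to $F$, and $p(F,G)=P(F,G)/\binom n\kappa$; $p(F,n)$ is the maximum of $p(F,G)$ over $n$-vertex graphs $G$; $\lambda_F=\lim_{n\to\infty}p(F,n)$ (the limit exists). **Patterns.** A pattern is a graph in which loops are allowed; its automorphisms are the bijections of the vertex set preserving edges, non-edges, loops and non-loops; $\Gamma_B(x)=\{y\in V(B):xy\in E(B)\}$. For a pattern $B$ on $[m]$ and disjoint (possibly empty) sets $V_0,\dots,V_{m-1}$, the blowup $B(V_0,\dots,V_{m-1})$ is the simple graph on $\bigcup V_i$ in which distinct $x\in V_i$, $y\in V_j$ are adjacent iff $\{i,j\}\in E(B)$; $B()$ is the family of all blowups. $\mathbb S_m=\{\boldsymbol x\in\mathbb R^m:x_i\ge0,\sum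 x_i=1\}$, and $p(F,B(\boldsymbol x))$ is the limit as $n\to\infty$ of $p(F,B(V_0,\dots,V_{m-1}))$ with $|V_i|=(x_i+o(1))n$. A homomorphism from a graph $H$ to a pattern $B$ is a (not necessarily injective) map $f:V(H)\to V(B)$ such that for all distinct $x,y\in V(H)$, $xy\in E(H)$ iff $f(x)f(y)\in E(B)$. **Perfect stability.** $\delta_{\mathrm{edit}}(G,B())$ is the minimum number of vertex pairs whose adjacency must be changed to turn $G$ into a graph isomorphic to a blowup of $B$ of the same order. The $F$-problem is perfectly $B$-stable if there is $C>0$ such that every graph $G$ with $n\ge C$ vertices satisfies $\delta_{\mathrm{edit}}(G,B())\le C\,(p(F,n)-p(F,G))\,n^2$. **Flag algebra certificates.** A type $\sigma$ is a graph on $[q]$ with all vertices labelled. A $\sigma$-flag is a graph with an embedding of $\sigma$ (an injection preserving edges and non-edges), whose image vertices are the roots; isomorphisms of flags preserve each root. $\mathcal F^\sigma_s$ is the set of $s$-vertex $\sigma$-flags up to isomorphism, and $\mathcal F^0_N$ is the set of $N$-vertex graphs up to isomorphism. For an embedding $f$ of $\sigma$ into $G$, $\boldsymbol V^{\sigma,s}_{(G,f)}$ is the column vector indexed by $\mathcal F^\sigma_s$ whose entry at a flag is the number of $(s-q)$-subsets $X\subseteq V(G)\setminus f([q])$ such that $G[X\cup f([q])]$ with roots $f$ is isomorphic to that flag. A certificate on $N$ vertices proving $\lambda_F\le u$ consists of a positive semi-definite matrix $X^\sigma$ indexed by $\mathcal F^\sigma_s$, $s=(N+q)/2$, for each type $\sigma$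 with $1\le q\le N-2$ vertices and $q\equiv N \pmod 2$, and of real slacks $c_H\ge0$ for $H\in\mathcal F^0_N$, such that for every graph $G$ of order $n\to\infty$ $$\sum_{H\in\mathcal F^0_N}(u-p(F,H))P(H,G)=\sum_{\substack{1\le q\le N-2\\ q\equiv N\,(2)}}\ \sum_{f}\bigl(\boldsymbol V^{\sigma,s}_{(G,f)}\bigr)^TX^\sigma\,\boldsymbol V^{\sigma,s}_{(G,f)}+\sum_{H\in\mathcal F^0_N}c_HP(H,G)+O(n^{N-1}),$$ where $f$ runs over injections $[q]\to V(G)$, and $\sigma$ is the graph on $[q]$ that $f$ embeds into $G$. **The criterion, version (ii).** For a graph $F$ with at least 2 vertices and a pattern $B$ on $[m]$, the criterion is satisfied with $N$ and a graph $\tau$ if, for some $\boldsymbol a\in\mathbb S_m$ with all entries positive, all of the following hold. (1) There is a certificate on $N$ vertices proving $\lambda_F\le p(F,B(\boldsymbol a))$. (2) $\tau$ has at most $N-2$ vertices and: (a) $\lim_{n\to\infty}\max\{p(F,G):v(G)=n,\ P(\tau,G)=0\}<\lambda_F$; (b) up to automorphisms of $B$, there is a unique homomorphism from $\tau$ to $B$; (c) for a homomorphism $f$ from $\tau$ to $B$, every two distinct $x,y\in V(B)$ satisfy $\Gamma_B(x)\cap f(V(\tau))\ne\Gamma_B(y)\cap f(V(\tau))$. (3) Every $H\in\mathcal F^0_N$ with $c_H=0$ in this certificate admits a homomorphism to $B$. (ii) The vertices of $B$ are either all loops or all non-loops, and the limiting maximum density of $F$ in growing graphs without any induced copy of $B^\circ$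 (obtained from $B$ by removing loops) is strictly less than $\lambda_F$. It is known that these conditions imply that the $F$-problem is perfectly $B$-stable. *)

theory Defs
  imports Complex_Main "HOL-Library.FuncSet" "HOL-Library.Disjoint_Sets"
begin

section \<open>Graphs and patterns\<close>

text \<open>
  A graph or pattern is a pair of a vertex set and an edge set. The edge \<open>xy\<close> is the set
  \<open>{x, y}\<close>, so a loop at \<open>x\<close> is the singleton \<open>{x}\<close>. Vertices are natural numbers; every finite
  graph is isomorphic to one of this kind.
\<close>

type_synonym pgraph = "nat set \<times> nat set set"

abbreviation verts :: "pgraph \<Rightarrow> nat set" where "verts \<equiv> fst"
abbreviation edges :: "pgraph \<Rightarrow> nat set set" where "edges \<equiv> snd"

abbreviation nverts :: "pgraph \<Rightarrow> nat" where "nverts G \<equiv> card (verts G)"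

definition on_first :: "nat \<Rightarrow> nat set set \<Rightarrow> pgraph" where
  "on_first m E = ({..<m}, E)"

definition pattern :: "pgraph \<Rightarrow> bool" where
  "pattern B \<longleftrightarrow> finite (verts B) \<and> (\<forall>e\<in>edges B. e \<subseteq> verts B \<and> (card e = 1 \<or> card e = 2))"

definition simple_graph :: "pgraph \<Rightarrow> bool" where
  "simple_graph G \<longleftrightarrow> finite (verts G) \<and> (\<forall>e\<in>edges G. e \<subseteq> verts G \<and> card e = 2)"

definition adj :: "pgraph \<Rightarrow> nat \<Rightarrow> nat \<Rightarrow> bool" where
  "adj G x y \<longleftrightarrow> {x, y} \<in> edges G"

definition nbhd :: "pgraph \<Rightarrow> nat \<Rightarrow> nat set" where
  "nbhd B x = {y \<in> verts B. adj B x y}"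

text \<open>Taking \<open>x = y\<close> below, isomorphisms also preserve loops and non-loops.\<close>

definition isomorphism :: "(nat \<Rightarrow> nat) \<Rightarrow> pgraph \<Rightarrow> pgraph \<Rightarrow> bool" where
  "isomorphism f G H \<longleftrightarrow> bij_betw f (verts G) (verts H) \<and>
     (\<forall>x\<in>verts G. \<forall>y\<in>verts G. adj G x y \<longleftrightarrow> adj H (f x) (f y))"

definition isomorphic :: "pgraph \<Rightarrow> pgraph \<Rightarrow> bool" where
  "isomorphic G H \<longleftrightarrow> (\<exists>f. isomorphism f G H)"

abbreviation automorphism :: "(nat \<Rightarrow> nat) \<Rightarrow> pgraph \<Rightarrow> bool" where
  "automorphism f B \<equiv> isomorphism f B B"

definition induced :: "pgraph \<Rightarrow> nat set \<Rightarrow> pgraph" where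
  "induced G X = (X, {e \<in> edges G. e \<subseteq> X})"

definition homs :: "pgraph \<Rightarrow> pgraph \<Rightarrow> (nat \<Rightarrow> nat) set" where
  "homs H B = {f \<in> verts H \<rightarrow>\<^sub>E verts B.
     \<forall>x\<in>verts H. \<forall>y\<in>verts H. x \<noteq> y \<longrightarrow> (adj H x y \<longleftrightarrow> adj B (f x) (f y))}"


section \<open>Induced densities\<close>

definition ind_count :: "pgraph \<Rightarrow> pgraph \<Rightarrow> nat" where
  "ind_count F G = card {X. X \<subseteq> verts G \<and> card X = nverts F \<and> isomorphic (induced G X) F}"

definition ind_density :: "pgraph \<Rightarrow> pgraph \<Rightarrow> real" where
  "ind_density F G = real (ind_count F G) / real (nverts G choose nverts F)"

text \<open>
  The maximum density of \<open>F\<close> in graphs of order \<open>n\<close> that contain no induced copy of any graph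
  in \<open>\<H>\<close>. The inserted \<open>0\<close> never changes the maximum of a nonempty set, as densities are
  nonnegative; it only fixes the value to be \<open>0\<close> if there is no such graph of order \<open>n\<close>.
\<close>

definition max_density_free :: "pgraph set \<Rightarrow> pgraph \<Rightarrow> nat \<Rightarrow> real" where
  "max_density_free \<H> F n =
     Max (insert 0 {ind_density F G | G.
       simple_graph G \<and> nverts G = n \<and> (\<forall>H\<in>\<H>. ind_count H G = 0)})"

abbreviation max_density :: "pgraph \<Rightarrow> nat \<Rightarrow> real" where
  "max_density \<equiv> max_density_free {}"

text \<open>These limits exist, by the usual averaging argument.\<close>

definition lambda_free :: "pgraph set \<Rightarrow> pgraph \<Rightarrow> real" where
  "lambda_free \<H> F = lim (max_density_free \<H> F)"

abbreviation lambda :: "pgraph \<Rightarrow> real" where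
  "lambda \<equiv> lambda_free {}"


section \<open>Blowups and perfect stability\<close>

definition parts_for :: "pgraph \<Rightarrow> (nat \<Rightarrow> nat set) \<Rightarrow> bool" where
  "parts_for B V \<longleftrightarrow> disjoint_family_on V (verts B) \<and> (\<forall>i\<in>verts B. finite (V i))"

definition blowup :: "pgraph \<Rightarrow> (nat \<Rightarrow> nat set) \<Rightarrow> pgraph" where
  "blowup B V =
     (\<Union>i\<in>verts B. V i,
      {{x, y} | x y. x \<noteq> y \<and>
         (\<exists>i\<in>verts B. \<exists>j\<in>verts B. x \<in> V i \<and> y \<in> V j \<and> {i, j} \<in> edges B)})"

definition blowups :: "pgraph \<Rightarrow> pgraph set" where
  "blowups B = {blowup B V | V. parts_for B V}"

definition prob_simplex :: "nat \<Rightarrow> (nat \<Rightarrow> real) set" where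
  "prob_simplex m = {x \<in> {..<m} \<rightarrow>\<^sub>E UNIV. (\<forall>i<m. 0 \<le> x i) \<and> (\<Sum>i<m. x i) = 1}"

text \<open>
  The limit of the density of \<open>F\<close> in blowups of \<open>B\<close> with parts of sizes \<open>(x\<^sub>i + o(1)) n\<close>,
  as the common limit along all such sequences of blowups.
\<close>

definition blowup_density :: "pgraph \<Rightarrow> pgraph \<Rightarrow> (nat \<Rightarrow> real) \<Rightarrow> real" where
  "blowup_density F B x =
     (THE L. \<forall>V :: nat \<Rightarrow> nat \<Rightarrow> nat set.
        (\<forall>n. parts_for B (V n)) \<and>
        (\<forall>i\<in>verts B. (\<lambda>n. real (card (V n i)) / real n) \<longlonglongrightarrow> x i)
        \<longrightarrow> (\<lambda>n. ind_density F (blowup B (V n))) \<longlonglongrightarrow> L)"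

definition unique_maximiser :: "pgraph \<Rightarrow> pgraph \<Rightarrow> (nat \<Rightarrow> real) \<Rightarrow> bool" where
  "unique_maximiser F B x \<longleftrightarrow>
     x \<in> prob_simplex (nverts B) \<and>
     (\<forall>y\<in>prob_simplex (nverts B). blowup_density F B y \<le> blowup_density F B x) \<and>
     (\<forall>y\<in>prob_simplex (nverts B). blowup_density F B y = blowup_density F B x \<longrightarrow>
        (\<exists>\<pi>. automorphism \<pi> B \<and> (\<forall>i\<in>verts B. y i = x (\<pi> i))))"

definition edit_dist :: "pgraph \<Rightarrow> pgraph \<Rightarrow> nat" where
  "edit_dist G B =
     (LEAST k. \<exists>G'. simple_graph G' \<and> verts G' = verts G \<and>
        (\<exists>H\<in>blowups B. isomorphic G' H) \<and>
        k = card ((edges G - edges G') \<union> (edges G' - edges G)))"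

definition perfectly_stable :: "pgraph \<Rightarrow> pgraph \<Rightarrow> bool" where
  "perfectly_stable F B \<longleftrightarrow>
     (\<exists>C>0. \<forall>G. simple_graph G \<and> C \<le> real (nverts G) \<longrightarrow>
        real (edit_dist G B)
          \<le> C * (max_density F (nverts G) - ind_density F G) * real (nverts G) ^ 2)"


section \<open>Flag algebra certificates\<close>

definition representatives :: "('a \<Rightarrow> 'a \<Rightarrow> bool) \<Rightarrow> 'a set \<Rightarrow> 'a set" where
  "representatives R A = (\<lambda>K. SOME x. x \<in> K) ` (A // {(x, y). x \<in> A \<and> y \<in> A \<and> R x y})"

definition graphs_upto_iso :: "nat \<Rightarrow> pgraph set" where
  "graphs_upto_iso N = representatives isomorphic {G. simple_graph G \<and> verts G = {..<N}}"

text \<open>A flag is a graph together with the embedding of the type that marks the roots.\<close>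

type_synonym flag = "pgraph \<times> (nat \<Rightarrow> nat)"

definition embedding :: "(nat \<Rightarrow> nat) \<Rightarrow> pgraph \<Rightarrow> pgraph \<Rightarrow> bool" where
  "embedding f \<sigma> G \<longleftrightarrow> f \<in> verts \<sigma> \<rightarrow>\<^sub>E verts G \<and> inj_on f (verts \<sigma>) \<and>
     (\<forall>i\<in>verts \<sigma>. \<forall>j\<in>verts \<sigma>. adj \<sigma> i j \<longleftrightarrow> adj G (f i) (f j))"

definition flag_iso :: "pgraph \<Rightarrow> flag \<Rightarrow> flag \<Rightarrow> bool" where
  "flag_iso \<sigma> \<Phi> \<Psi> \<longleftrightarrow>
     (\<exists>h. isomorphism h (fst \<Phi>) (fst \<Psi>) \<and> (\<forall>i\<in>verts \<sigma>. h (snd \<Phi> i) = snd \<Psi> i))"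

definition flags :: "pgraph \<Rightarrow> nat \<Rightarrow> flag set" where
  "flags \<sigma> s = representatives (flag_iso \<sigma>)
     {(M, \<theta>). simple_graph M \<and> verts M = {..<s} \<and> embedding \<theta> \<sigma> M}"

definition flag_count :: "pgraph \<Rightarrow> nat \<Rightarrow> pgraph \<Rightarrow> (nat \<Rightarrow> nat) \<Rightarrow> flag \<Rightarrow> nat" where
  "flag_count \<sigma> s G f \<Phi> =
     card {X. X \<subseteq> verts G - f ` verts \<sigma> \<and> card X = s - nverts \<sigma> \<and>
       flag_iso \<sigma> (induced G (X \<union> f ` verts \<sigma>), f) \<Phi>}"

definition pulled_back_type :: "nat \<Rightarrow> (nat \<Rightarrow> nat) \<Rightarrow> pgraph \<Rightarrow> pgraph" where
  "pulled_back_type q f G = on_first q {{i, j} | i j. i < q \<and> j < q \<and> adj G (f i) (f j)}"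

definition quad_form :: "'a set \<Rightarrow> ('a \<Rightarrow> 'a \<Rightarrow> real) \<Rightarrow> ('a \<Rightarrow> real) \<Rightarrow> real" where
  "quad_form I A v = (\<Sum>i\<in>I. \<Sum>j\<in>I. v i * A i j * v j)"

definition pos_semidef :: "'a set \<Rightarrow> ('a \<Rightarrow> 'a \<Rightarrow> real) \<Rightarrow> bool" where
  "pos_semidef I A \<longleftrightarrow> (\<forall>i\<in>I. \<forall>j\<in>I. A i j = A j i) \<and> (\<forall>v. 0 \<le> quad_form I A v)"

definition type_orders :: "nat \<Rightarrow> nat set" where
  "type_orders N = {q. 1 \<le> q \<and> q + 2 \<le> N \<and> q mod 2 = N mod 2}"

definition sos_part :: "nat \<Rightarrow> (pgraph \<Rightarrow> flag \<Rightarrow> flag \<Rightarrow> real) \<Rightarrow> pgraph \<Rightarrow> real" where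
  "sos_part N X G =
     (\<Sum>q\<in>type_orders N. \<Sum>f\<in>{f \<in> {..<q} \<rightarrow>\<^sub>E verts G. inj_on f {..<q}}.
        let \<sigma> = pulled_back_type q f G; s = (N + q) div 2
        in quad_form (flags \<sigma> s) (X \<sigma>) (\<lambda>\<Phi>. real (flag_count \<sigma> s G f \<Phi>)))"

text \<open>
  The condition \<open>nverts F \<le> N\<close> is implicit in the use of the densities of \<open>F\<close> in graphs of
  order \<open>N\<close>.
\<close>

definition certificate ::
  "pgraph \<Rightarrow> nat \<Rightarrow> real \<Rightarrow> (pgraph \<Rightarrow> flag \<Rightarrow> flag \<Rightarrow> real) \<Rightarrow> (pgraph \<Rightarrow> real) \<Rightarrow> bool" where
  "certificate F N u X c \<longleftrightarrow>
     nverts F \<le> N \<and>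
     (\<forall>q\<in>type_orders N. \<forall>\<sigma>. simple_graph \<sigma> \<and> verts \<sigma> = {..<q} \<longrightarrow>
        pos_semidef (flags \<sigma> ((N + q) div 2)) (X \<sigma>)) \<and>
     (\<forall>H\<in>graphs_upto_iso N. 0 \<le> c H) \<and>
     (\<exists>K n\<^sub>0. \<forall>G. simple_graph G \<and> n\<^sub>0 \<le> nverts G \<longrightarrow>
        \<bar>(\<Sum>H\<in>graphs_upto_iso N. (u - ind_density F H) * real (ind_count H G))
         - (sos_part N X G + (\<Sum>H\<in>graphs_upto_iso N. c H * real (ind_count H G)))\<bar>
        \<le> K * real (nverts G) ^ (N - 1))"


section \<open>The criterion for perfect stability, version (ii)\<close>

definition remove_loops :: "pgraph \<Rightarrow> pgraph" where
  "remove_loops B = (verts B, {e \<in> edges B. card e \<noteq> 1})"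

definition certified_at :: "pgraph \<Rightarrow> pgraph \<Rightarrow> nat \<Rightarrow> (nat \<Rightarrow> real) \<Rightarrow> bool" where
  "certified_at F B N a \<longleftrightarrow>
     (\<exists>X c. certificate F N (blowup_density F B a) X c \<and>
        (\<forall>H\<in>graphs_upto_iso N. c H = 0 \<longrightarrow> homs H B \<noteq> {}))"

definition tau_condition :: "pgraph \<Rightarrow> pgraph \<Rightarrow> nat \<Rightarrow> pgraph \<Rightarrow> bool" where
  "tau_condition F B N \<tau> \<longleftrightarrow>
     simple_graph \<tau> \<and> nverts \<tau> + 2 \<le> N \<and>
     lambda_free {\<tau>} F < lambda F \<and>
     (\<exists>f\<in>homs \<tau> B. \<forall>g\<in>homs \<tau> B. \<exists>\<pi>. automorphism \<pi> B \<and> (\<forall>v\<in>verts \<tau>. g v = \<pi> (f v))) \<and>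
     (\<forall>f\<in>homs \<tau> B. \<forall>x\<in>verts B. \<forall>y\<in>verts B. x \<noteq> y \<longrightarrow>
        nbhd B x \<inter> f ` verts \<tau> \<noteq> nbhd B y \<inter> f ` verts \<tau>)"

definition criterion_ii :: "pgraph \<Rightarrow> pgraph \<Rightarrow> nat \<Rightarrow> pgraph \<Rightarrow> bool" where
  "criterion_ii F B N \<tau> \<longleftrightarrow>
     simple_graph F \<and> 2 \<le> nverts F \<and> pattern B \<and> verts B = {..<nverts B} \<and>
     (\<exists>a\<in>prob_simplex (nverts B). (\<forall>i\<in>verts B. 0 < a i) \<and> certified_at F B N a) \<and>
     tau_condition F B N \<tau> \<and>
     ((\<forall>x\<in>verts B. adj B x x) \<or> (\<forall>x\<in>verts B. \<not> adj B x x)) \<and>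
     lambda_free {remove_loops B} F < lambda F"

end

theory Submission
  imports Defs
begin

text \<open>
  The graph \<open>F4\<close> is a star with three leaves together with two isolated vertices, and the pattern \<open>BB\<close> is an edge together
  with an isolated vertex. Choose six vertices of a graph independently with weights \<open>w\<close> of total \<open>1\<close>, and let the star mean be the
  probability that the first vertex is the centre of a star with leaves the next three and with the last two isolated. Everything
  follows from one inequality, \<open>star_mean_bound\<close>: the star mean is at most \<open>2 / 729\<close>, and it is smaller by a fixed multiple of
  the probability that the six vertices induce a graph with no homomorphism to the pattern.

  That inequality is an exact form of a flag algebra argument. Fix two roots (adjacent or not), or four roots inducing a cherry and an
  isolated vertex, and sample the other vertices independently; explicit linear forms in the resulting flags have nonnegative squares.
  Subtracting these squares and the stars from the constant leaves a slack that only depends on the isomorphism class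
  of the six-vertex graph. The slack is shown to be nonnegative, and positive on graphs without a homomorphism to the pattern, by
  checking a list that contains each isomorphism class (\<open>graphs_complete\<close>, \<open>slack_nonneg\<close>). Rewriting the same identity in terms
  of unlabelled counts gives the certificate, \<open>certificate_F4\<close>.

  In a blowup with part ratios \<open>x\<close> the star mean is the polynomial \<open>F4_poly x\<close>. The elementary inequality \<open>F4_poly_deficit\<close> shows that
  it is maximal exactly at the balanced ratios, which settles both the limit and the unique maximiser.

  Perfect stability uses the inequality twice. An edge of a graph determines a partition into three parts, and a pair of vertices
  at which the graph differs from the blowup of this partition spoils, together with the edge, every six-tuple containing
  them. Hence if no partition has fewer than \<open>m\<close> wrong pairs, the star mean drops by a multiple of \<open>m\<close> (\<open>star_mean_deficit\<close>). With
  uniform weights this makes a near-extremal graph close to a nearly balanced blowup. Then each vertex is weighted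
  inversely to the size of its part, so that this blowup has star mean exactly \<open>2 / 729\<close>, and the second use shows that the graph
  itself loses a number of stars proportional to \<open>m n\<^sup>4\<close> against the blowup (\<open>star_count_gain\<close>).
\<close>

section \<open>Sums of squares on six vertices\<close>

declare One_nat_def [simp del]

text \<open>
  Sample two labelled roots and two more vertices \<open>x\<close>, \<open>y\<close>. The five arguments tell whether \<open>x\<close> is adjacent to the first
  and to the second root, whether \<open>y\<close> is, and whether \<open>x\<close> and \<open>y\<close> are adjacent. The entries are the values at this flag of five
  linear forms; the positive semidefinite block of the type is the sum of the squares of these forms with the weights in
  \<open>pair_weights\<close>, so it needs no factorisation. The forms come from rounding a numerical optimum. Each form is
  even or odd under exchanging the roots, and has mean zero in the balanced blowup, as equality there forces.
\<close>

fun nonedge_flag :: "bool \<Rightarrow> bool \<Rightarrow> bool \<Rightarrow> bool \<Rightarrow> bool \<Rightarrow> int list" where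
  "nonedge_flag False False False False False = [8, 0, 0, 0, 0]"
| "nonedge_flag False False False False True = [-28, 0, 0, 0, 0]"
| "nonedge_flag False False True False False = [-6, 2, -2, 0, 0]"
| "nonedge_flag False False True False True = [-21, -1, 1, 0, 0]"
| "nonedge_flag False False False True False = [-6, 2, 2, 0, 0]"
| "nonedge_flag False False False True True = [-21, -1, -1, 0, 0]"
| "nonedge_flag False False True True False = [-32, 4, 0, 0, 0]"
| "nonedge_flag False False True True True = [-8, -2, 0, 0, 0]"
| "nonedge_flag True False False False False = [-6, 2, -2, 0, 0]"
| "nonedge_flag True False False False True = [-21, -1, 1, 0, 0]"
| "nonedge_flag True False True False False = [22, -2, 2, 0, 0]"
| "nonedge_flag True False True False True = [-11, 9, 1, 1, -2]"
| "nonedge_flag True False False True False = [10, -10, 0, 0, 0]"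
| "nonedge_flag True False False True True = [3, -13, 0, 0, 0]"
| "nonedge_flag True False True True False = [-5, 4, -1, 5, 16]"
| "nonedge_flag True False True True True = [0, -4, 0, -7, -1]"
| "nonedge_flag False True False False False = [-6, 2, 2, 0, 0]"
| "nonedge_flag False True False False True = [-21, -1, -1, 0, 0]"
| "nonedge_flag False True True False False = [10, -10, 0, 0, 0]"
| "nonedge_flag False True True False True = [3, -13, 0, 0, 0]"
| "nonedge_flag False True False True False = [22, -2, -2, 0, 0]"
| "nonedge_flag False True False True True = [-11, 9, -1, -1, 2]"
| "nonedge_flag False True True True False = [-5, 4, 1, -5, -16]"
| "nonedge_flag False True True True True = [0, -4, 0, 7, 1]"
| "nonedge_flag True True False False False = [-32, 4, 0, 0, 0]"
| "nonedge_flag True True False False True = [-8, -2, 0, 0, 0]"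
| "nonedge_flag True True True False False = [-5, 4, -1, 5, 16]"
| "nonedge_flag True True True False True = [0, -4, 0, -7, -1]"
| "nonedge_flag True True False True False = [-5, 4, 1, -5, -16]"
| "nonedge_flag True True False True True = [0, -4, 0, 7, 1]"
| "nonedge_flag True True True True False = [48, -4, 0, 0, 0]"
| "nonedge_flag True True True True True = [0, -3, 0, 0, 0]"

fun edge_flag :: "bool \<Rightarrow> bool \<Rightarrow> bool \<Rightarrow> bool \<Rightarrow> bool \<Rightarrow> int list" where
  "edge_flag False False False False False = [-42, 12, 0]"
| "edge_flag False False False False True = [28, -17, -8]"
| "edge_flag False False True False False = [12, 0, 0]"
| "edge_flag False False True False True = [-42, -3, -3]"
| "edge_flag False False False True False = [12, 0, 0]"
| "edge_flag False False False True True = [-42, -3, -3]"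
| "edge_flag False False True True False = [5, -1, 8]"
| "edge_flag False False True True True = [-9, -5, 2]"
| "edge_flag True False False False False = [12, 0, 0]"
| "edge_flag True False False False True = [-42, -3, -3]"
| "edge_flag True False True False False = [20, -4, -2]"
| "edge_flag True False True False True = [-28, -14, -2]"
| "edge_flag True False False True False = [8, 3, 13]"
| "edge_flag True False False True True = [-23, -2, 2]"
| "edge_flag True False True True False = [1, 0, -8]"
| "edge_flag True False True True True = [-2, 3, 2]"
| "edge_flag False True False False False = [12, 0, 0]"
| "edge_flag False True False False True = [-42, -3, -3]"
| "edge_flag False True True False False = [8, 3, 13]"
| "edge_flag False True True False True = [-23, -2, 2]"
| "edge_flag False True False True False = [20, -4, -2]"
| "edge_flag False True False True True = [-28, -14, -2]"
| "edge_flag False True True True False = [1, 0, -8]"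
| "edge_flag False True True True True = [-2, 3, 2]"
| "edge_flag True True False False False = [5, -1, 8]"
| "edge_flag True True False False True = [-9, -5, 2]"
| "edge_flag True True True False False = [1, 0, -8]"
| "edge_flag True True True False True = [-2, 3, 2]"
| "edge_flag True True False True False = [1, 0, -8]"
| "edge_flag True True False True True = [-2, 3, 2]"
| "edge_flag True True True True False = [18, 12, -14]"
| "edge_flag True True True True True = [0, 0, -3]"

text \<open>
  The forms for four roots that induce a cherry and an isolated vertex; the arguments are the adjacencies of one further vertex to
  the centre, the two leaves and the isolated root. The forms are even or odd under exchanging the leaves.
\<close>

fun cherry_flag :: "bool \<Rightarrow> bool \<Rightarrow> bool \<Rightarrow> bool \<Rightarrow> int list" where
  "cherry_flag False False False False = [8, 0, 0]"
| "cherry_flag True False False False = [-4, 0, 0]"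
| "cherry_flag False True False False = [-1, 10, -1]"
| "cherry_flag True True False False = [3, -3, 0]"
| "cherry_flag False False True False = [-1, 10, 1]"
| "cherry_flag True False True False = [3, -3, 0]"
| "cherry_flag False True True False = [-4, 0, 0]"
| "cherry_flag True True True False = [0, -3, 0]"
| "cherry_flag False False False True = [1, 0, 0]"
| "cherry_flag True False False True = [2, 2, 0]"
| "cherry_flag False True False True = [-6, 6, 17]"
| "cherry_flag True True False True = [0, -6, 19]"
| "cherry_flag False False True True = [-6, 6, -17]"
| "cherry_flag True False True True = [0, -6, -19]"
| "cherry_flag False True True True = [-2, -11, 0]"
| "cherry_flag True True True True = [-2, -8, 0]"

fun dot :: "int list \<Rightarrow> int list \<Rightarrow> int list \<Rightarrow> int" where
  "dot (d # ds) (u # us) (v # vs) = d * u * v + dot ds us vs"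
| "dot _ _ _ = 0"

definition pair_form :: "(nat \<Rightarrow> nat \<Rightarrow> bool) \<Rightarrow> nat \<Rightarrow> nat \<Rightarrow> nat \<Rightarrow> nat \<Rightarrow> int list" where
  "pair_form b i j x y =
     (if b i j then edge_flag (b i x) (b j x) (b i y) (b j y) (b x y)
      else nonedge_flag (b i x) (b j x) (b i y) (b j y) (b x y))"

definition pair_weights :: "bool \<Rightarrow> int list" where
  "pair_weights e = (if e then [4, 15, 20] else [6, 6, 540, 48, 48])"

definition cherry_form :: "(nat \<Rightarrow> nat \<Rightarrow> bool) \<Rightarrow> nat \<Rightarrow> nat \<Rightarrow> nat \<Rightarrow> nat \<Rightarrow> nat \<Rightarrow> int list" where
  "cherry_form b i j k l x = cherry_flag (b i x) (b j x) (b k x) (b l x)"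

definition cherry_weights :: "int list" where
  "cherry_weights = [171, 48, 48]"

definition pair_term :: "(nat \<Rightarrow> nat \<Rightarrow> bool) \<Rightarrow> nat \<Rightarrow> nat \<Rightarrow> nat \<Rightarrow> nat \<Rightarrow> nat \<Rightarrow> nat \<Rightarrow> int" where
  "pair_term b i j x y z w = dot (pair_weights (b i j)) (pair_form b i j x y) (pair_form b i j z w)"

definition cherry_type :: "(nat \<Rightarrow> nat \<Rightarrow> bool) \<Rightarrow> nat \<Rightarrow> nat \<Rightarrow> nat \<Rightarrow> nat \<Rightarrow> bool" where
  "cherry_type b i j k l \<longleftrightarrow> b i j \<and> b i k \<and> \<not> b j k \<and> \<not> b j l \<and> \<not> b k l \<and> \<not> b i l"

definition cherry_term :: "(nat \<Rightarrow> nat \<Rightarrow> bool) \<Rightarrow> nat \<Rightarrow> nat \<Rightarrow> nat \<Rightarrow> nat \<Rightarrow> nat \<Rightarrow> nat \<Rightarrow> int" where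
  "cherry_term b i j k l x y =
     (if cherry_type b i j k l
      then dot cherry_weights (cherry_form b i j k l x) (cherry_form b i j k l y) else 0)"

text \<open>
  Vertex \<open>i\<close> is adjacent to \<open>j\<close>, \<open>k\<close>, \<open>l\<close> and there is no other edge. The predicate only mentions each pair once, so it is the
  induced labelled star of the problem whenever \<open>b\<close> is symmetric.
\<close>

definition star :: "(nat \<Rightarrow> nat \<Rightarrow> bool) \<Rightarrow> nat \<Rightarrow> nat \<Rightarrow> nat \<Rightarrow> nat \<Rightarrow> nat \<Rightarrow> nat \<Rightarrow> bool" where
  "star b i j k l x y \<longleftrightarrow>
     b i j \<and> b i k \<and> \<not> b j k \<and> \<not> b j l \<and> \<not> b k l \<and> b i l \<and>
     \<not> b i x \<and> \<not> b i y \<and> \<not> b j x \<and> \<not> b j y \<and> \<not> b k x \<and> \<not> b k y \<and> \<not> b l x \<and> \<not> b l y \<and> \<not> b x y"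

definition squares :: "(nat \<Rightarrow> nat \<Rightarrow> bool) \<Rightarrow> int" where
  "squares b = pair_term b 0 1 2 3 4 5 + 4 * cherry_term b 0 1 2 3 4 5"

abbreviation (input) pull :: "(nat \<Rightarrow> nat) \<Rightarrow> (nat \<Rightarrow> nat \<Rightarrow> bool) \<Rightarrow> nat \<Rightarrow> nat \<Rightarrow> bool" where
  "pull \<pi> b \<equiv> (\<lambda>i j. b (\<pi> i) (\<pi> j))"

definition perms6 :: "(nat \<Rightarrow> nat) set" where
  "perms6 = {\<pi> \<in> {..<6} \<rightarrow>\<^sub>E {..<6}. inj_on \<pi> {..<6}}"

definition stars :: "(nat \<Rightarrow> nat \<Rightarrow> bool) \<Rightarrow> int" where
  "stars b = (\<Sum>\<pi>\<in>perms6. of_bool (star (pull \<pi> b) 0 1 2 3 4 5))"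

text \<open>
  The slack of a labelled six-vertex graph is what remains of the constant bound after subtracting the stars and the squares, all
  averaged over the orderings of the vertices. It is proportional to the coefficient of the isomorphism class in the certificate;
  the scaling makes it an integer.
\<close>

definition slack :: "(nat \<Rightarrow> nat \<Rightarrow> bool) \<Rightarrow> int" where
  "slack b = 276480 - 139968 * stars b - (\<Sum>\<pi>\<in>perms6. squares (pull \<pi> b))"

lemma finite_perms6: "finite perms6"
  unfolding perms6_def by (rule finite_subset[of _ "{..<6} \<rightarrow>\<^sub>E {..<6}"]) (auto intro: finite_PiE)

lemma perms6_bij: "\<pi> \<in> perms6 \<Longrightarrow> bij_betw \<pi> {..<6} {..<6}"
  unfolding perms6_def bij_betw_def
  by (auto simp: endo_inj_surj PiE_def Pi_def image_subset_iff)

lemma perms6_less: "\<pi> \<in> perms6 \<Longrightarrow> i < 6 \<Longrightarrow> \<pi> i < 6"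
  unfolding perms6_def by auto

lemma perms6_eq: "\<pi> \<in> perms6 \<Longrightarrow> i < 6 \<Longrightarrow> j < 6 \<Longrightarrow> \<pi> i = \<pi> j \<longleftrightarrow> i = j"
  unfolding perms6_def by (auto simp: inj_on_def)

lemma perms6I:
  assumes "\<And>i. i < 6 \<Longrightarrow> f i < 6" "\<And>i j. i < 6 \<Longrightarrow> j < 6 \<Longrightarrow> f i = f j \<Longrightarrow> i = j"
  shows "(\<lambda>i\<in>{..<6}. f i) \<in> perms6"
  unfolding perms6_def using assms by (auto simp: inj_on_def)

lemma perms6_compose:
  assumes "\<pi> \<in> perms6" "\<rho> \<in> perms6"
  shows "(\<lambda>i\<in>{..<6}. \<rho> (\<pi> i)) \<in> perms6"
  by (rule perms6I) (use perms6_less[OF assms(1)] perms6_less[OF assms(2)]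
    perms6_eq[OF assms(1)] perms6_eq[OF assms(2)] in auto)

lemma perms6_ext: "\<pi> \<in> perms6 \<Longrightarrow> \<pi>' \<in> perms6 \<Longrightarrow> (\<And>i. i < 6 \<Longrightarrow> \<pi> i = \<pi>' i) \<Longrightarrow> \<pi> = \<pi>'"
  unfolding perms6_def by (rule PiE_ext[of _ "{..<6}" "\<lambda>_. {..<6}"]) auto

lemma perms6_compose_bij:
  assumes "\<rho> \<in> perms6"
  shows "bij_betw (\<lambda>\<pi>. \<lambda>i\<in>{..<6}. \<rho> (\<pi> i)) perms6 perms6"
proof -
  have "inj_on (\<lambda>\<pi>. \<lambda>i\<in>{..<6}. \<rho> (\<pi> i)) perms6"
  proof (rule inj_onI)
    fix \<pi> \<pi>' assume *: "\<pi> \<in> perms6" "\<pi>' \<in> perms6" "(\<lambda>i\<in>{..<6}. \<rho> (\<pi> i)) = (\<lambda>i\<in>{..<6}. \<rho> (\<pi>' i))"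
    show "\<pi> = \<pi>'"
    proof (rule perms6_ext[OF *(1,2)])
      fix i :: nat assume i: "i < 6"
      then have "\<rho> (\<pi> i) = \<rho> (\<pi>' i)" using fun_cong[OF *(3), of i] by simp
      then show "\<pi> i = \<pi>' i"
        using perms6_eq[OF assms] perms6_less[OF *(1) i] perms6_less[OF *(2) i] by auto
    qed
  qed
  moreover have "(\<lambda>\<pi>. \<lambda>i\<in>{..<6}. \<rho> (\<pi> i)) ` perms6 \<subseteq> perms6"
    using perms6_compose assms by blast
  ultimately show ?thesis
    using finite_perms6 by (simp add: bij_betw_def endo_inj_surj)
qed

lemma squares_cong:
  assumes "\<And>i j. i < 6 \<Longrightarrow> j < 6 \<Longrightarrow> b i j = b' i j"
  shows "squares b = squares b'"
proof -
  have b: "b i j = b' i j" if "i \<in> {0,1,2,3,4,5}" "j \<in> {0,1,2,3,4,5}" for i j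
    using that by (intro assms) auto
  show ?thesis
    unfolding squares_def pair_term_def cherry_term_def cherry_type_def pair_form_def cherry_form_def
    by (simp add: b)
qed

lemma star_cong:
  assumes "\<And>i j. i < 6 \<Longrightarrow> j < 6 \<Longrightarrow> b i j = b' i j"
  shows "star b 0 1 2 3 4 5 = star b' 0 1 2 3 4 5"
proof -
  have b: "b i j = b' i j" if "i \<in> {0,1,2,3,4,5}" "j \<in> {0,1,2,3,4,5}" for i j
    using that by (intro assms) auto
  show ?thesis unfolding star_def by (simp add: b)
qed

lemma sum_perms6_pull:
  assumes "\<rho> \<in> perms6"
    and cong: "\<And>b b'. (\<And>i j. i < 6 \<Longrightarrow> j < 6 \<Longrightarrow> b i j = b' i j) \<Longrightarrow> g b = g b'"
  shows "(\<Sum>\<pi>\<in>perms6. g (pull \<pi> (pull \<rho> b))) = (\<Sum>\<pi>\<in>perms6. g (pull \<pi> b))"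
proof -
  have "(\<Sum>\<pi>\<in>perms6. g (pull \<pi> b)) = (\<Sum>\<pi>\<in>perms6. g (pull (\<lambda>i\<in>{..<6}. \<rho> (\<pi> i)) b))"
    using sum.reindex_bij_betw[OF perms6_compose_bij[OF assms(1)], of "\<lambda>\<pi>. g (pull \<pi> b)"] by simp
  also have "\<dots> = (\<Sum>\<pi>\<in>perms6. g (pull \<pi> (pull \<rho> b)))"
    by (intro sum.cong cong) auto
  finally show ?thesis by simp
qed

lemma stars_pull:
  assumes "\<rho> \<in> perms6"
  shows "stars (pull \<rho> b) = stars b"
  unfolding stars_def
  by (rule sum_perms6_pull[OF assms, where g = "\<lambda>b. of_bool (star b 0 1 2 3 4 5)"])
     (rule arg_cong[where f = of_bool], rule star_cong)

lemma slack_pull: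
  assumes "\<rho> \<in> perms6"
  shows "slack (pull \<rho> b) = slack b"
  unfolding slack_def
  by (subst stars_pull[OF assms], subst sum_perms6_pull[OF assms, where g = squares])
     (rule squares_cong, simp, rule refl)

lemma stars_cong:
  assumes "\<And>i j. i < 6 \<Longrightarrow> j < 6 \<Longrightarrow> b i j = b' i j"
  shows "stars b = stars b'"
  unfolding stars_def
  by (intro sum.cong refl arg_cong[where f = of_bool] star_cong) (auto simp: assms perms6_less)

lemma slack_cong:
  assumes "\<And>i j. i < 6 \<Longrightarrow> j < 6 \<Longrightarrow> b i j = b' i j"
  shows "slack b = slack b'"
proof -
  have "(\<Sum>\<pi>\<in>perms6. squares (pull \<pi> b)) = (\<Sum>\<pi>\<in>perms6. squares (pull \<pi> b'))"
    by (intro sum.cong refl squares_cong) (auto simp: assms perms6_less)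
  then show ?thesis unfolding slack_def using stars_cong[OF assms] by simp
qed

text \<open>
  A permutation-invariant sum can be halved whenever swapping two positions preserves the summand. Applying this repeatedly turns
  the 720 orderings into few enough representatives to evaluate.
\<close>

lemma sum_halve:
  fixes f :: "'a \<Rightarrow> int"
  assumes "finite P" "\<And>x. x \<in> P \<Longrightarrow> h x \<in> P" "\<And>x. x \<in> P \<Longrightarrow> h (h x) = x"
    "\<And>x. x \<in> P \<Longrightarrow> Q (h x) \<longleftrightarrow> \<not> Q x" "\<And>x. x \<in> P \<Longrightarrow> f (h x) = f x"
  shows "sum f P = 2 * sum f {x \<in> P. Q x}"
proof -
  have "sum f P = sum f {x \<in> P. Q x} + sum f {x \<in> P. \<not> Q x}"
    using assms(1) by (subst sum.union_disjoint[symmetric]) (auto intro!: sum.cong)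
  also have "sum f {x \<in> P. \<not> Q x} = sum f {x \<in> P. Q x}"
    by (rule sum.reindex_bij_witness[of _ h h]) (use assms in auto)
  finally show ?thesis by simp
qed

definition swap :: "nat \<Rightarrow> nat \<Rightarrow> nat \<Rightarrow> nat" where
  "swap i j x = (if x = i then j else if x = j then i else x)"

definition swapped :: "nat \<Rightarrow> nat \<Rightarrow> (nat \<Rightarrow> nat) \<Rightarrow> nat \<Rightarrow> nat" where
  "swapped i j \<pi> = (\<lambda>x\<in>{..<6}. \<pi> (swap i j x))"

lemma swapped_apply: "k < 6 \<Longrightarrow> swapped i j \<pi> k = \<pi> (swap i j k)"
  by (simp add: swapped_def)

lemma swap_swap[simp]: "swap i j (swap i j x) = x"
  by (auto simp: swap_def)

lemma swap_less: "i < n \<Longrightarrow> j < n \<Longrightarrow> x < n \<Longrightarrow> swap i j x < n"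
  by (auto simp: swap_def)

lemma swapped_perms6:
  assumes "i < 6" "j < 6" "\<pi> \<in> perms6"
  shows "swapped i j \<pi> \<in> perms6"
  unfolding swapped_def by (rule perms6I) (use assms perms6_less[OF assms(3)] perms6_eq[OF assms(3)] in
    \<open>auto simp: swap_less dest: arg_cong[where f = "swap i j"]\<close>)

lemma swapped_swapped:
  assumes "i < 6" "j < 6" "\<pi> \<in> perms6"
  shows "swapped i j (swapped i j \<pi>) = \<pi>"
  by (rule perms6_ext[OF swapped_perms6[OF assms(1,2) swapped_perms6[OF assms]] assms(3)])
     (use assms in \<open>simp add: swap_less swapped_apply\<close>)

lemma swap_values:
  "swap 0 1 0 = 1" "swap 0 1 1 = 0" "swap 1 2 1 = 2" "swap 1 2 2 = 1" "swap 2 3 2 = 3" "swap 2 3 3 = 2"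
  "swap 4 5 4 = 5" "swap 4 5 5 = 4" "x \<noteq> i \<Longrightarrow> x \<noteq> j \<Longrightarrow> swap i j x = x"
  by (auto simp: swap_def)

lemma sum_perms6_symmetric_pairs:
  fixes t :: "nat \<Rightarrow> nat \<Rightarrow> nat \<Rightarrow> nat \<Rightarrow> nat \<Rightarrow> nat \<Rightarrow> int"
  assumes s1: "\<And>x y p q r s. t y x p q r s = t x y p q r s"
    and s2: "\<And>x y p q r s. t x y q p r s = t x y p q r s"
    and s3: "\<And>x y p q r s. t x y r s p q = t x y p q r s"
  shows "(\<Sum>\<pi>\<in>perms6. t (\<pi> 0) (\<pi> 1) (\<pi> 2) (\<pi> 3) (\<pi> 4) (\<pi> 5)) =
    16 * (\<Sum>\<pi>\<in>{\<pi> \<in> perms6. \<pi> 0 < \<pi> 1 \<and> \<pi> 2 < \<pi> 3 \<and> \<pi> 4 < \<pi> 5 \<and> \<pi> 2 < \<pi> 4}.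
            t (\<pi> 0) (\<pi> 1) (\<pi> 2) (\<pi> 3) (\<pi> 4) (\<pi> 5))" (is "sum ?f _ = _")
proof -
  have s4: "t x y p q s r = t x y p q r s" for x y p q r s
    using s3[of x y p q s r] s2[of x y r s p q] s3[of x y r s p q] by metis
  have ne: "\<pi> 0 \<noteq> \<pi> 1" "\<pi> 2 \<noteq> \<pi> 3" "\<pi> 4 \<noteq> \<pi> 5" "\<pi> 2 \<noteq> \<pi> 4" if "\<pi> \<in> perms6" for \<pi>
    using perms6_eq[OF that] by simp_all
  have lt: "\<pi> 1 < \<pi> 0 \<longleftrightarrow> \<not> \<pi> 0 < \<pi> 1" "\<pi> 3 < \<pi> 2 \<longleftrightarrow> \<not> \<pi> 2 < \<pi> 3" "\<pi> 5 < \<pi> 4 \<longleftrightarrow> \<not> \<pi> 4 < \<pi> 5"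
    if "\<pi> \<in> perms6" for \<pi>
    using ne[OF that] by linarith+
  let ?P1 = "{\<pi> \<in> perms6. \<pi> 0 < \<pi> 1}"
  let ?P2 = "{\<pi> \<in> ?P1. \<pi> 2 < \<pi> 3}"
  let ?P3 = "{\<pi> \<in> ?P2. \<pi> 4 < \<pi> 5}"
  have sw: "swapped 0 1 \<pi> \<in> perms6" "swapped 2 3 \<pi> \<in> perms6" "swapped 4 5 \<pi> \<in> perms6"
    "swapped 0 1 (swapped 0 1 \<pi>) = \<pi>" "swapped 2 3 (swapped 2 3 \<pi>) = \<pi>" "swapped 4 5 (swapped 4 5 \<pi>) = \<pi>"
    if "\<pi> \<in> perms6" for \<pi>
    by (rule swapped_perms6 swapped_swapped; use that in simp)+
  have "sum ?f perms6 = 2 * sum ?f ?P1"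
    by (rule sum_halve[where h = "swapped 0 1"])
       (simp_all add: finite_perms6 sw lt s1 swap_values swapped_apply)
  also have "sum ?f ?P1 = 2 * sum ?f ?P2"
    by (rule sum_halve[where h = "swapped 2 3"])
       (simp_all add: finite_perms6 sw lt s2 swap_values swapped_apply)
  also have "sum ?f ?P2 = 2 * sum ?f ?P3"
    by (rule sum_halve[where h = "swapped 4 5"])
       (simp_all add: finite_perms6 sw lt s4 swap_values swapped_apply)
  also have "sum ?f ?P3 = 2 * sum ?f {\<pi> \<in> ?P3. \<pi> 2 < \<pi> 4}"
  proof (rule sum_halve[where h = "\<lambda>\<pi>. swapped 2 4 (swapped 3 5 \<pi>)"])
    fix \<pi> assume \<pi>: "\<pi> \<in> ?P3"
    then have p: "\<pi> \<in> perms6" by simp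
    have v: "swapped 2 4 (swapped 3 5 \<pi>) 0 = \<pi> 0" "swapped 2 4 (swapped 3 5 \<pi>) 1 = \<pi> 1"
      "swapped 2 4 (swapped 3 5 \<pi>) 2 = \<pi> 4" "swapped 2 4 (swapped 3 5 \<pi>) 3 = \<pi> 5"
      "swapped 2 4 (swapped 3 5 \<pi>) 4 = \<pi> 2" "swapped 2 4 (swapped 3 5 \<pi>) 5 = \<pi> 3"
      by (simp_all add: swap_def swapped_apply)
    have q: "swapped 2 4 (swapped 3 5 \<pi>) \<in> perms6" if "\<pi> \<in> perms6" for \<pi>
      by (rule swapped_perms6; (rule swapped_perms6)?; use that in simp)
    show "swapped 2 4 (swapped 3 5 \<pi>) \<in> ?P3" using \<pi> q[OF p] v by simp
    show "swapped 2 4 (swapped 3 5 (swapped 2 4 (swapped 3 5 \<pi>))) = \<pi>"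
      by (rule perms6_ext[OF q[OF q[OF p]] p]) (auto simp: swap_def swapped_apply)
    show "(swapped 2 4 (swapped 3 5 \<pi>) 2 < swapped 2 4 (swapped 3 5 \<pi>) 4) \<longleftrightarrow> \<not> \<pi> 2 < \<pi> 4"
      unfolding v using ne[OF p] by linarith
    show "?f (swapped 2 4 (swapped 3 5 \<pi>)) = ?f \<pi>" unfolding v by (rule s3)
  qed (simp add: finite_perms6)
  finally show ?thesis by (simp add: conj_ac)
qed

lemma sum_perms6_symmetric_cherry:
  fixes t :: "nat \<Rightarrow> nat \<Rightarrow> nat \<Rightarrow> nat \<Rightarrow> nat \<Rightarrow> nat \<Rightarrow> int"
  assumes s1: "\<And>i j k l x y. t i k j l x y = t i j k l x y"
    and s2: "\<And>i j k l x y. t i j k l y x = t i j k l x y"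
  shows "(\<Sum>\<pi>\<in>perms6. t (\<pi> 0) (\<pi> 1) (\<pi> 2) (\<pi> 3) (\<pi> 4) (\<pi> 5)) =
    4 * (\<Sum>\<pi>\<in>{\<pi> \<in> perms6. \<pi> 1 < \<pi> 2 \<and> \<pi> 4 < \<pi> 5}.
            t (\<pi> 0) (\<pi> 1) (\<pi> 2) (\<pi> 3) (\<pi> 4) (\<pi> 5))" (is "sum ?f _ = _")
proof -
  have ne: "\<pi> 1 \<noteq> \<pi> 2" "\<pi> 4 \<noteq> \<pi> 5" if "\<pi> \<in> perms6" for \<pi>
    using perms6_eq[OF that] by simp_all
  have lt: "\<pi> 2 < \<pi> 1 \<longleftrightarrow> \<not> \<pi> 1 < \<pi> 2" "\<pi> 5 < \<pi> 4 \<longleftrightarrow> \<not> \<pi> 4 < \<pi> 5"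
    if "\<pi> \<in> perms6" for \<pi>
    using ne[OF that] by linarith+
  let ?P1 = "{\<pi> \<in> perms6. \<pi> 1 < \<pi> 2}"
  have sw: "swapped 1 2 \<pi> \<in> perms6" "swapped 4 5 \<pi> \<in> perms6"
    "swapped 1 2 (swapped 1 2 \<pi>) = \<pi>" "swapped 4 5 (swapped 4 5 \<pi>) = \<pi>"
    if "\<pi> \<in> perms6" for \<pi>
    by (rule swapped_perms6 swapped_swapped; use that in simp)+
  have "sum ?f perms6 = 2 * sum ?f ?P1"
    by (rule sum_halve[where h = "swapped 1 2"])
       (simp_all add: finite_perms6 sw lt s1 swap_values swapped_apply)
  also have "sum ?f ?P1 = 2 * sum ?f {\<pi> \<in> ?P1. \<pi> 4 < \<pi> 5}"
    by (rule sum_halve[where h = "swapped 4 5"])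
       (simp_all add: finite_perms6 sw lt s2 swap_values swapped_apply)
  finally show ?thesis by (simp add: conj_ac)
qed

lemma sum_perms6_tuples:
  fixes t :: "nat \<Rightarrow> nat \<Rightarrow> nat \<Rightarrow> nat \<Rightarrow> nat \<Rightarrow> nat \<Rightarrow> int"
  shows "(\<Sum>\<pi>\<in>{\<pi> \<in> perms6. Q (\<pi> 0) (\<pi> 1) (\<pi> 2) (\<pi> 3) (\<pi> 4) (\<pi> 5)}.
            t (\<pi> 0) (\<pi> 1) (\<pi> 2) (\<pi> 3) (\<pi> 4) (\<pi> 5)) =
    (\<Sum>(a, b, c, d, e, f)\<in>{(a, b, c, d, e, f). set [a, b, c, d, e, f] \<subseteq> {..<6} \<and>
       distinct [a, b, c, d, e, f] \<and> Q a b c d e f}. t a b c d e f)"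
proof (rule sum.reindex_bij_witness[where
      i = "\<lambda>(a, b, c, d, e, f). \<lambda>k\<in>{..<6}. [a, b, c, d, e, f] ! k" and
      j = "\<lambda>\<pi>. (\<pi> 0, \<pi> 1, \<pi> 2, \<pi> 3, \<pi> 4, \<pi> 5)"], goal_cases)
  case (1 \<pi>)
  then have p: "\<pi> \<in> perms6" by simp
  have "(\<lambda>k\<in>{..<6}. [\<pi> 0, \<pi> 1, \<pi> 2, \<pi> 3, \<pi> 4, \<pi> 5] ! k) x = \<pi> x" for x
  proof (cases "x < 6")
    case True
    then consider "x = 0" | "x = 1" | "x = 2" | "x = 3" | "x = 4" | "x = 5" by linarith
    then show ?thesis by cases simp_all
  next
    case False
    then show ?thesis using p unfolding perms6_def by (simp add: PiE_def extensional_def)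
  qed
  then show ?case by (simp add: fun_eq_iff)
next
  case (2 \<pi>)
  then have p: "\<pi> \<in> perms6" by simp
  show ?case using 2 by (simp add: perms6_less[OF p] perms6_eq[OF p])
next
  case (3 x)
  obtain a b c d e f where x: "x = (a, b, c, d, e, f)" by (cases x)
  show ?case unfolding x by simp
next
  case (4 x)
  obtain a b c d e f where x: "x = (a, b, c, d, e, f)" by (cases x)
  have d: "distinct [a, b, c, d, e, f]" "set [a, b, c, d, e, f] \<subseteq> {..<6}" using 4 unfolding x by simp_all
  have "(\<lambda>k\<in>{..<6}. [a, b, c, d, e, f] ! k) \<in> perms6"
  proof (rule perms6I)
    fix i j :: nat assume "i < 6" "j < 6" "[a, b, c, d, e, f] ! i = [a, b, c, d, e, f] ! j"
    then show "i = j" using nth_eq_iff_index_eq[OF d(1), of i j] by simp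
  next
    fix i :: nat assume "i < 6"
    then show "[a, b, c, d, e, f] ! i < 6" using subsetD[OF d(2) nth_mem[of i]] by simp
  qed
  then show ?case using 4 unfolding x by simp
next
  case (5 \<pi>)
  then show ?case by simp
qed

definition splits :: "(nat \<times> nat \<times> nat \<times> nat \<times> nat \<times> nat) list" where
  "splits = [(0,1,2,3,4,5), (0,2,1,3,4,5), (0,3,1,2,4,5), (0,4,1,2,3,5), (0,5,1,2,3,4),
     (1,2,0,3,4,5), (1,3,0,2,4,5), (1,4,0,2,3,5), (1,5,0,2,3,4), (2,3,0,1,4,5),
     (2,4,0,1,3,5), (2,5,0,1,3,4), (3,4,0,1,2,5), (3,5,0,1,2,4), (4,5,0,1,2,3)]"

lemma pair_tuples:
  "{(a, b, c, d, e, f). set [a, b, c, d, e, f] \<subseteq> {..<6} \<and> distinct [a, b, c, d, e, f] \<and>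
      a < b \<and> c < d \<and> e < f \<and> c < e} =
   set (concat (map (\<lambda>(x, y, p, q, r, s). [(x, y, p, q, r, s), (x, y, p, r, q, s), (x, y, p, s, q, r)]) splits))"
  (is "?D = set ?L")
proof -
  have "?D = set (concat (map (\<lambda>a. concat (map (\<lambda>b. if a < b then
      concat (map (\<lambda>c. if c \<noteq> a \<and> c \<noteq> b then concat (map (\<lambda>d. if c < d \<and> d \<noteq> a \<and> d \<noteq> b then
      concat (map (\<lambda>e. if c < e \<and> e \<noteq> a \<and> e \<noteq> b \<and> e \<noteq> d then concat (map (\<lambda>f. if e < f \<and> f \<noteq> a \<and> f \<noteq> b \<and> f \<noteq> d
        then [(a, b, c, d, e, f)] else []) [0..<6]) else []) [0..<6]) else []) [0..<6]) else [])
      [0..<6]) else []) [0..<6])) [0..<6]))" (is "_ = set ?E")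
    by (auto split: if_splits)
  also have "?E = ?L" by code_simp
  finally show ?thesis .
qed

lemma cherry_tuples:
  "{(i, j, k, l, x, y). set [i, j, k, l, x, y] \<subseteq> {..<6} \<and> distinct [i, j, k, l, x, y] \<and> j < k \<and> x < y} =
   set (concat (map (\<lambda>(x, y, p, q, r, s).
     [(p, q, r, s, x, y), (p, q, s, r, x, y), (p, r, s, q, x, y),
      (q, p, r, s, x, y), (q, p, s, r, x, y), (q, r, s, p, x, y),
      (r, p, q, s, x, y), (r, p, s, q, x, y), (r, q, s, p, x, y),
      (s, p, q, r, x, y), (s, p, r, q, x, y), (s, q, r, p, x, y)]) splits))"
  (is "?D = set ?L")
proof -
  have "?D = set (concat (map (\<lambda>x. concat (map (\<lambda>y. if x < y then
      concat (map (\<lambda>i. if i \<noteq> x \<and> i \<noteq> y then concat (map (\<lambda>j. if j \<noteq> i \<and> j \<noteq> x \<and> j \<noteq> y then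
      concat (map (\<lambda>k. if j < k \<and> k \<noteq> i \<and> k \<noteq> x \<and> k \<noteq> y then concat (map (\<lambda>l. if l \<noteq> i \<and> l \<noteq> j \<and> l \<noteq> k \<and> l \<noteq> x \<and> l \<noteq> y
        then [(i, j, k, l, x, y)] else []) [0..<6]) else []) [0..<6]) else []) [0..<6]) else [])
      [0..<6]) else []) [0..<6])) [0..<6]))" (is "_ = set ?E")
    by (auto split: if_splits)
  also have "?E = ?L" by code_simp
  finally show ?thesis .
qed

lemma distinct_splits:
  "distinct (concat (map (\<lambda>(x, y, p, q, r, s). [(x, y, p, q, r, s), (x, y, p, r, q, s), (x, y, p, s, q, r)]) splits))"
  "distinct (concat (map (\<lambda>(x, y, p, q, r, s).
     [(p, q, r, s, x, y), (p, q, s, r, x, y), (p, r, s, q, x, y),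
      (q, p, r, s, x, y), (q, p, s, r, x, y), (q, r, s, p, x, y),
      (r, p, q, s, x, y), (r, p, s, q, x, y), (r, q, s, p, x, y),
      (s, p, q, r, x, y), (s, p, r, q, x, y), (s, q, r, p, x, y)]) splits))"
  by code_simp+

lemma card_perms6: "card perms6 = 720"
proof -
  have "int (card perms6) = (\<Sum>\<pi>\<in>perms6. 1)" by simp
  also have "\<dots> = 16 * (\<Sum>\<pi>\<in>{\<pi> \<in> perms6. \<pi> 0 < \<pi> 1 \<and> \<pi> 2 < \<pi> 3 \<and> \<pi> 4 < \<pi> 5 \<and> \<pi> 2 < \<pi> 4}. 1)"
    by (rule sum_perms6_symmetric_pairs[of "\<lambda>_ _ _ _ _ _. 1"]) auto
  also have "\<dots> = 720"
    unfolding sum_perms6_tuples[where Q = "\<lambda>a b c d e f. a < b \<and> c < d \<and> e < f \<and> c < e" and t = "\<lambda>_ _ _ _ _ _. 1"] pair_tuples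
    by (subst sum.distinct_set_conv_list[OF distinct_splits(1)]) (simp add: splits_def)
  finally show ?thesis by simp
qed

definition star_term :: "(nat \<Rightarrow> nat \<Rightarrow> bool) \<Rightarrow> nat \<Rightarrow> nat \<Rightarrow> nat \<Rightarrow> nat \<Rightarrow> nat \<Rightarrow> nat \<Rightarrow> int" where
  "star_term b i j k l x y =
     (if b i j \<and> b i k \<and> \<not> b j k \<and> \<not> b j l \<and> \<not> b k l then
        if b i l then
          if b i x \<or> b i y \<or> b j x \<or> b j y \<or> b k x \<or> b k y \<or> b l x \<or> b l y \<or> b x y then 0 else 139968
        else 4 * dot cherry_weights (cherry_form b i j k l x) (cherry_form b i j k l y)
      else 0)"

lemma star_term: "star_term b i j k l x y = 139968 * of_bool (star b i j k l x y) + 4 * cherry_term b i j k l x y"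
  unfolding star_term_def star_def cherry_term_def cherry_type_def by simp

fun split_value :: "(nat \<Rightarrow> nat \<Rightarrow> bool) \<Rightarrow> nat \<times> nat \<times> nat \<times> nat \<times> nat \<times> nat \<Rightarrow> int" where
  "split_value b (x, y, p, q, r, s) =
     4 * (pair_term b x y p q r s + pair_term b x y p r q s + pair_term b x y p s q r) +
     (star_term b p q r s x y + star_term b p q s r x y + star_term b p r s q x y +
      star_term b q p r s x y + star_term b q p s r x y + star_term b q r s p x y +
      star_term b r p q s x y + star_term b r p s q x y + star_term b r q s p x y +
      star_term b s p q r x y + star_term b s p r q x y + star_term b s q r p x y)"

definition quarter_slack :: "(nat \<Rightarrow> nat \<Rightarrow> bool) \<Rightarrow> int" where
  "quarter_slack b = 69120 - sum_list (map (split_value b) splits)"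

lemma dot_commute: "dot ds us vs = dot ds vs us"
  by (induction ds us vs rule: dot.induct) auto

lemma flag_swap_unlabelled:
  "edge_flag c d a b e = edge_flag a b c d e" "nonedge_flag c d a b e = nonedge_flag a b c d e"
  by (cases a; cases b; cases c; cases d; cases e; simp)+

lemma edge_flag_swap_roots: "edge_flag b a d c e = edge_flag a b c d e"
  by (cases a; cases b; cases c; cases d; cases e; simp)

lemma nonedge_flag_swap_roots:
  "nonedge_flag b a d c e = map2 (*) [1, 1, -1, -1, -1] (nonedge_flag a b c d e)"
  by (cases a; cases b; cases c; cases d; cases e; simp)

lemma cherry_flag_swap_leaves: "cherry_flag a c b d = map2 (*) [1, 1, -1] (cherry_flag a b c d)"
  by (cases a; cases b; cases c; cases d; simp)

lemma length_flags:
  "length (edge_flag a b c d e) = 3" "length (nonedge_flag a b c d e) = 5" "length (cherry_flag a b c d) = 3"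
  by (cases a; cases b; cases c; cases d; cases e; simp)
     (cases a; cases b; cases c; cases d; cases e; simp)+

lemma dot_signs:
  assumes "length us = length ss" "length vs = length ss" "\<And>s. s \<in> set ss \<Longrightarrow> s * s = 1"
  shows "dot ds (map2 (*) ss us) (map2 (*) ss vs) = dot ds us vs"
  using assms
proof (induction ss arbitrary: ds us vs)
  case (Cons s ss)
  obtain u us' v vs' where uv: "us = u # us'" "vs = v # vs'"
    using Cons.prems by (cases us; cases vs) auto
  have "d * (s * u) * (s * v) = d * u * v" for d
  proof -
    have "d * (s * u) * (s * v) = (s * s) * (d * u * v)" by (simp add: algebra_simps)
    then show ?thesis using Cons.prems(3)[of s] by simp
  qed
  then show ?case using Cons uv by (cases ds) auto
qed simp

lemma sum_list_concat_map:
  "sum_list (map f (concat (map g xs))) = (\<Sum>x\<leftarrow>xs. sum_list (map f (g x)))"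
  by (induction xs) simp_all

lemma sum_list_split_value:
  "sum_list (map (split_value b) xs) =
    4 * (\<Sum>(x, y, p, q, r, s)\<leftarrow>xs.
      pair_term b x y p q r s + pair_term b x y p r q s + pair_term b x y p s q r) +
    (\<Sum>(x, y, p, q, r, s)\<leftarrow>xs.
      star_term b p q r s x y + star_term b p q s r x y + star_term b p r s q x y +
      star_term b q p r s x y + star_term b q p s r x y + star_term b q r s p x y +
      star_term b r p q s x y + star_term b r p s q x y + star_term b r q s p x y +
      star_term b s p q r x y + star_term b s p r q x y + star_term b s q r p x y)"
  by (induction xs) auto

text \<open>
  The sum over the orderings collapses: a pair of roots leaves three splits of the other four vertices, and for the cherries
  only twelve arrangements count for each unordered pair of last vertices. This form is cheap to evaluate on a concrete graph.
\<close>

lemma slack_eq: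
  assumes sym: "\<And>i j. b i j = b j i"
  shows "slack b = 4 * quarter_slack b"
proof -
  have p1: "pair_term b j i x y z w = pair_term b i j x y z w" for i j x y z w
    unfolding pair_term_def pair_form_def sym[of j i]
      edge_flag_swap_roots[of "b j x"] nonedge_flag_swap_roots[of "b j x"]
      edge_flag_swap_roots[of "b j z"] nonedge_flag_swap_roots[of "b j z"]
    by (cases "b i j") (simp_all only: if_True if_False, rule dot_signs, auto simp: length_flags)
  have p2: "pair_term b i j y x z w = pair_term b i j x y z w" for i j x y z w
    unfolding pair_term_def pair_form_def sym[of y x] by (simp only: flag_swap_unlabelled[of "b i y"])
  have p3: "pair_term b i j z w x y = pair_term b i j x y z w" for i j x y z w
    unfolding pair_term_def by (rule dot_commute)
  have s1: "star_term b i k j l x y = star_term b i j k l x y" for i j k l x y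
  proof -
    have "cherry_term b i k j l x y = cherry_term b i j k l x y"
      unfolding cherry_term_def cherry_type_def cherry_form_def sym[of k j] cherry_weights_def
        cherry_flag_swap_leaves[of "b i x" "b k x"] cherry_flag_swap_leaves[of "b i y" "b k y"]
      by (subst dot_signs) (auto simp: length_flags)
    moreover have "star b i k j l x y = star b i j k l x y"
      unfolding star_def sym[of k j] by auto
    ultimately show ?thesis unfolding star_term by simp
  qed
  have s2: "star_term b i j k l y x = star_term b i j k l x y" for i j k l x y
  proof -
    have "cherry_term b i j k l y x = cherry_term b i j k l x y"
      unfolding cherry_term_def by (simp add: dot_commute)
    moreover have "star b i j k l y x = star b i j k l x y"
      unfolding star_def sym[of y x] by auto
    ultimately show ?thesis unfolding star_term by simp
  qed
  have A: "(\<Sum>\<pi>\<in>perms6. pair_term b (\<pi> 0) (\<pi> 1) (\<pi> 2) (\<pi> 3) (\<pi> 4) (\<pi> 5)) = 16 * (\<Sum>(x, y, p, q, r, s)\<leftarrow>splits.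
      pair_term b x y p q r s + pair_term b x y p r q s + pair_term b x y p s q r)"
    unfolding sum_perms6_symmetric_pairs[of "pair_term b", OF p1 p2 p3]
      sum_perms6_tuples[where Q = "\<lambda>a b c d e f. a < b \<and> c < d \<and> e < f \<and> c < e" and t = "pair_term b"] pair_tuples
    by (subst sum.distinct_set_conv_list[OF distinct_splits(1)], subst sum_list_concat_map)
       (auto intro!: arg_cong[where f = sum_list] map_cong simp: add.assoc)
  have B: "(\<Sum>\<pi>\<in>perms6. star_term b (\<pi> 0) (\<pi> 1) (\<pi> 2) (\<pi> 3) (\<pi> 4) (\<pi> 5)) = 4 * (\<Sum>(x, y, p, q, r, s)\<leftarrow>splits.
      star_term b p q r s x y + star_term b p q s r x y + star_term b p r s q x y +
      star_term b q p r s x y + star_term b q p s r x y + star_term b q r s p x y +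
      star_term b r p q s x y + star_term b r p s q x y + star_term b r q s p x y +
      star_term b s p q r x y + star_term b s p r q x y + star_term b s q r p x y)"
    unfolding sum_perms6_symmetric_cherry[of "star_term b", OF s1 s2]
      sum_perms6_tuples[where Q = "\<lambda>a b c d e f. b < c \<and> e < f" and t = "star_term b"] cherry_tuples
    by (subst sum.distinct_set_conv_list[OF distinct_splits(2)], subst sum_list_concat_map)
       (auto intro!: arg_cong[where f = sum_list] map_cong simp: add.assoc)
  have pull: "pair_term (pull \<pi> b) 0 1 2 3 4 5 = pair_term b (\<pi> 0) (\<pi> 1) (\<pi> 2) (\<pi> 3) (\<pi> 4) (\<pi> 5)"
    "star_term (pull \<pi> b) 0 1 2 3 4 5 = star_term b (\<pi> 0) (\<pi> 1) (\<pi> 2) (\<pi> 3) (\<pi> 4) (\<pi> 5)" for \<pi>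
    by (simp_all add: pair_term_def star_term_def pair_form_def cherry_form_def)
  have "139968 * stars b + (\<Sum>\<pi>\<in>perms6. squares (pull \<pi> b)) =
      (\<Sum>\<pi>\<in>perms6. star_term (pull \<pi> b) 0 1 2 3 4 5) + (\<Sum>\<pi>\<in>perms6. pair_term (pull \<pi> b) 0 1 2 3 4 5)"
    unfolding star_term stars_def squares_def sum_distrib_left sum.distrib[symmetric]
    by (intro sum.cong) auto
  then have "slack b = 276480 - (\<Sum>\<pi>\<in>perms6. star_term (pull \<pi> b) 0 1 2 3 4 5) -
      (\<Sum>\<pi>\<in>perms6. pair_term (pull \<pi> b) 0 1 2 3 4 5)"
    unfolding slack_def by linarith
  also have "\<dots> = 4 * quarter_slack b"
    unfolding pull A B quarter_slack_def sum_list_split_value by simp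
  finally show ?thesis .
qed

definition adjm :: "bool list list \<Rightarrow> nat \<Rightarrow> nat \<Rightarrow> bool" where
  "adjm m i j = m ! i ! j"

primrec bool_vectors :: "nat \<Rightarrow> bool list list" where
  "bool_vectors 0 = [[]]"
| "bool_vectors (Suc n) = concat (map (\<lambda>v. [v @ [False], v @ [True]]) (bool_vectors n))"

definition add_vertex :: "bool list list \<Rightarrow> bool list \<Rightarrow> bool list list" where
  "add_vertex m v = map2 (\<lambda>r e. r @ [e]) m v @ [v @ [False]]"

primrec lex_le :: "(bool \<times> bool) list \<Rightarrow> bool" where
  "lex_le [] = True"
| "lex_le (p # ps) = (if fst p = snd p then lex_le ps else snd p)"

definition cells :: "nat \<Rightarrow> (nat \<times> nat) list" where
  "cells n = concat (map (\<lambda>j. map (\<lambda>i. (i, j)) [0..<j]) [0..<n])"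

text \<open>
  A graph is stored as the list of its rows below the diagonal. Keeping only graphs whose code does not decrease under a
  transposition of two vertices still retains a representative of each isomorphism class, namely the least code, and is far
  cheaper to test than full minimality.
\<close>

definition swap_minimal :: "nat \<Rightarrow> bool list list \<Rightarrow> bool" where
  "swap_minimal n m = list_all (\<lambda>(k, l).
     lex_le (map (\<lambda>(i, j). (adjm m i j, adjm m (swap k l i) (swap k l j))) (cells n))) (cells n)"

primrec graphs :: "nat \<Rightarrow> bool list list list" where
  "graphs 0 = [[]]"
| "graphs (Suc n) =
     filter (swap_minimal (Suc n)) (concat (map (\<lambda>m. map (add_vertex m) (bool_vectors n)) (graphs n)))"

definition colour :: "(nat \<Rightarrow> nat \<Rightarrow> bool) \<Rightarrow> nat \<Rightarrow> nat" where
  "colour b x = (if b 5 x then 1 else if list_ex (b x) [0, 1, 2, 3, 4, 5] then 2 else 0)"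

definition coloured :: "(nat \<Rightarrow> nat \<Rightarrow> bool) \<Rightarrow> bool" where
  "coloured b = list_all (\<lambda>(i, j). b i j \<longleftrightarrow> colour b i = 1 \<and> colour b j = 2 \<or> colour b i = 2 \<and> colour b j = 1) (cells 6)"

definition admissible :: "bool list list \<Rightarrow> bool" where
  "admissible m = (let q = quarter_slack (adjm m) in if 0 < q then True else q = 0 \<and> coloured (adjm m))"

text \<open>
  Every surviving six-vertex graph has nonnegative slack, and slack at least one unless the graph is coloured by the pattern. The
  finitely many candidates are checked by rewriting.
\<close>

lemma extensions_admissible1:
  "list_all (\<lambda>m. list_all (\<lambda>v. if swap_minimal 6 (add_vertex m v) then admissible (add_vertex m v) else True)
     (bool_vectors 5)) (take 14 (graphs 5))"
  by code_simp

lemma extensions_admissible2: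
  "list_all (\<lambda>m. list_all (\<lambda>v. if swap_minimal 6 (add_vertex m v) then admissible (add_vertex m v) else True)
     (bool_vectors 5)) (drop 14 (graphs 5))"
  by code_simp

lemma graphs_admissible: "list_all admissible (graphs 6)"
proof -
  have "list_all (\<lambda>m. list_all (\<lambda>v. if swap_minimal 6 (add_vertex m v) then admissible (add_vertex m v) else True)
     (bool_vectors 5)) (take 14 (graphs 5) @ drop 14 (graphs 5))"
    unfolding list_all_append using extensions_admissible1 extensions_admissible2 by blast
  moreover have "graphs 6 = filter (swap_minimal 6) (concat (map (\<lambda>m. map (add_vertex m) (bool_vectors 5)) (graphs 5)))"
    using graphs.simps(2)[of 5] by simp
  ultimately show ?thesis by (auto simp: list_all_iff split: if_splits)
qed

definition code :: "nat \<Rightarrow> (nat \<Rightarrow> nat \<Rightarrow> bool) \<Rightarrow> bool list" where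
  "code n b = map (\<lambda>(i, j). b i j) (cells n)"

primrec binary :: "bool list \<Rightarrow> nat" where
  "binary [] = 0"
| "binary (x # xs) = of_bool x * 2 ^ length xs + binary xs"

lemma binary_less: "binary xs < 2 ^ length xs"
  by (induction xs) auto

lemma lex_le_if_binary_le: "length xs = length ys \<Longrightarrow> binary xs \<le> binary ys \<Longrightarrow> lex_le (zip xs ys)"
proof (induction xs ys rule: list_induct2)
  case (Cons x xs y ys)
  show ?case
  proof (cases "x = y")
    case True
    then show ?thesis using Cons by simp
  next
    case False
    show ?thesis
    proof (rule ccontr)
      assume "\<not> lex_le (zip (x # xs) (y # ys))"
      then have "x" "\<not> y" using False by auto
      then show False using Cons(1,3) binary_less[of ys] by simp
    qed
  qed
qed simp

lemma lex_le_append: "lex_le (xs @ ys) \<Longrightarrow> lex_le xs"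
  by (induction xs) (auto split: if_splits)

lemma set_cells: "set (cells n) = {(i, j). i < j \<and> j < n}"
  unfolding cells_def by auto

lemma cells_prefix: "k \<le> n \<Longrightarrow> \<exists>ps. cells n = cells k @ ps"
  unfolding cells_def using le_add_diff_inverse[of k n] upt_add_eq_append[of 0 k "n - k"] by auto

lemma set_bool_vectors: "set (bool_vectors n) = {v. length v = n}"
proof (induction n)
  case (Suc n)
  have "v \<in> set (bool_vectors (Suc n)) \<longleftrightarrow> length v = Suc n" for v
  proof
    assume "length v = Suc n"
    then obtain u e where "v = u @ [e]" "length u = n"
      by (metis length_Suc_conv_rev)
    then show "v \<in> set (bool_vectors (Suc n))" using Suc by (cases e) auto
  qed (use Suc in auto)
  then show ?case by blast
qed simp

text \<open>
  The relabelling with the least code survives all tests: a prefix of the cells of a graph on \<open>n\<close> vertices lists the cells of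
  its first vertices, so minimality passes to the smaller graphs from which it is built.
\<close>

lemma graphs_complete:
  assumes sym: "\<And>i j. b i j = b j i" and irrefl: "\<And>i. \<not> b i i"
  obtains \<pi> m where "\<pi> \<in> perms6" "m \<in> set (graphs 6)" "\<And>i j. i < 6 \<Longrightarrow> j < 6 \<Longrightarrow> adjm m i j = b (\<pi> i) (\<pi> j)"
proof -
  have "(\<lambda>i\<in>{..<6}. i) \<in> perms6" by (rule perms6I) auto
  then have "perms6 \<noteq> {}" by blast
  define \<pi> where "\<pi> = arg_min_on (\<lambda>\<rho>. binary (code 6 (pull \<rho> b))) perms6"
  have \<pi>: "\<pi> \<in> perms6"
    unfolding \<pi>_def using arg_min_if_finite(1)[OF finite_perms6 \<open>perms6 \<noteq> {}\<close>] .
  have min: "binary (code 6 (pull \<pi> b)) \<le> binary (code 6 (pull \<rho> b))" if "\<rho> \<in> perms6" for \<rho>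
    unfolding \<pi>_def using arg_min_least[OF finite_perms6 \<open>perms6 \<noteq> {}\<close> that, of "\<lambda>\<rho>. binary (code 6 (pull \<rho> b))"] .
  define c where "c = pull \<pi> b"
  have le: "lex_le (map (\<lambda>(i, j). (c i j, c (swap k l i) (swap k l j))) (cells 6))" if "k < 6" "l < 6" for k l
  proof -
    have p: "swapped k l \<pi> \<in> perms6" using swapped_perms6[OF that \<pi>] .
    have E: "code 6 (pull (swapped k l \<pi>) b) = map (\<lambda>(i, j). c (swap k l i) (swap k l j)) (cells 6)"
      unfolding code_def c_def by (intro map_cong) (auto simp: set_cells swapped_apply)
    have "lex_le (zip (code 6 c) (map (\<lambda>(i, j). c (swap k l i) (swap k l j)) (cells 6)))"
    proof (rule lex_le_if_binary_le)
      show "binary (code 6 c) \<le> binary (map (\<lambda>(i, j). c (swap k l i) (swap k l j)) (cells 6))"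
        using min[OF p] unfolding E c_def .
    qed (simp add: code_def)
    moreover have "zip (code 6 c) (map (\<lambda>(i, j). c (swap k l i) (swap k l j)) (cells 6)) =
        map (\<lambda>(i, j). (c i j, c (swap k l i) (swap k l j))) (cells 6)"
      unfolding code_def by (simp add: zip_map_map zip_same_conv_map case_prod_beta)
    ultimately show ?thesis by simp
  qed
  define M where "M k = map (\<lambda>i. map (c i) [0..<k]) [0..<k]" for k
  have M: "adjm (M k) i j = c i j" if "i < k" "j < k" for i j k
    using that by (simp add: M_def adjm_def)
  have "M k \<in> set (graphs k)" if "k \<le> 6" for k
    using that
  proof (induction k)
    case 0
    then show ?case by (simp add: M_def)
  next
    case (Suc k)
    have "M (Suc k) = add_vertex (M k) (map (\<lambda>i. c i k) [0..<k])"
    proof (rule nth_equalityI)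
      fix i assume "i < length (M (Suc k))"
      then have "i < k \<or> i = k" by (auto simp: M_def)
      then show "M (Suc k) ! i = add_vertex (M k) (map (\<lambda>i. c i k) [0..<k]) ! i"
      proof
        assume "i < k"
        then show ?thesis by (simp add: M_def add_vertex_def nth_append)
      next
        assume i: "i = k"
        have "map (c k) [0..<k] = map (\<lambda>i. c i k) [0..<k]"
          by (rule map_cong[OF refl]) (simp only: c_def, rule sym)
        moreover have "\<not> c k k" using irrefl by (simp add: c_def)
        ultimately show ?thesis unfolding i by (simp add: M_def add_vertex_def nth_append)
      qed
    qed (simp add: M_def add_vertex_def)
    moreover have "swap_minimal (Suc k) (M (Suc k))"
      unfolding swap_minimal_def list_all_iff
    proof (clarsimp simp: set_cells simp del: upt_Suc)
      fix i j assume ij: "i < j" "j < Suc k"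
      obtain ps where ps: "cells 6 = cells (Suc k) @ ps" using cells_prefix[OF Suc.prems] by blast
      have "lex_le (map (\<lambda>(p, q). (c p q, c (swap i j p) (swap i j q))) (cells (Suc k)))"
        using le[of i j] ij Suc.prems lex_le_append unfolding ps by auto
      moreover have "map (\<lambda>(p, q). (c p q, c (swap i j p) (swap i j q))) (cells (Suc k)) =
          map (\<lambda>(p, q). (adjm (M (Suc k)) p q, adjm (M (Suc k)) (swap i j p) (swap i j q))) (cells (Suc k))"
        using ij by (intro map_cong) (auto simp: set_cells M swap_less)
      ultimately show "lex_le (map (\<lambda>(p, q). (adjm (M (Suc k)) p q, adjm (M (Suc k)) (swap i j p) (swap i j q))) (cells (Suc k)))"
        by simp
    qed
    moreover have "add_vertex (M k) (map (\<lambda>i. c i k) [0..<k]) \<in>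
        set (concat (map (\<lambda>m. map (add_vertex m) (bool_vectors k)) (graphs k)))"
    proof -
      have "M k \<in> set (graphs k)" using Suc by simp
      moreover have "map (\<lambda>i. c i k) [0..<k] \<in> set (bool_vectors k)" by (simp add: set_bool_vectors)
      ultimately show ?thesis
        unfolding set_concat set_map image_image by (intro UN_I[of "M k"] imageI)
    qed
    ultimately show ?case by simp
  qed
  then have "M 6 \<in> set (graphs 6)" by blast
  then show ?thesis using that[OF \<pi>] M[of _ 6] unfolding c_def by blast
qed

text \<open>
  A map to the pattern with vertex set \<open>{0, 1, 2}\<close> and the single edge \<open>12\<close> that preserves edges and non-edges between distinct
  vertices.
\<close>

definition colourable :: "(nat \<Rightarrow> nat \<Rightarrow> bool) \<Rightarrow> bool" where
  "colourable b \<longleftrightarrow> (\<exists>g. \<forall>i<6. \<forall>j<6. i \<noteq> j \<longrightarrow> g i < 3 \<and> (b i j \<longleftrightarrow> {g i, g j} = {1, 2::nat}))"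

lemma quarter_slack_cong:
  assumes "\<And>i j. i < 6 \<Longrightarrow> j < 6 \<Longrightarrow> b i j = b' i j"
  shows "quarter_slack b = quarter_slack b'"
proof -
  have p: "pair_term b x y p q r s = pair_term b' x y p q r s"
    and t: "star_term b x y p q r s = star_term b' x y p q r s"
    if "x < 6" "y < 6" "p < 6" "q < 6" "r < 6" "s < 6" for x y p q r s
    using that by (simp_all only: pair_term_def pair_form_def star_term_def cherry_form_def assms)
  have "split_value b (x, y, p, q, r, s) = split_value b' (x, y, p, q, r, s)"
    if "(x, y, p, q, r, s) \<in> set splits" for x y p q r s
  proof -
    have A: "list_all (\<lambda>(x, y, p, q, r, s). x < 6 \<and> y < 6 \<and> p < 6 \<and> q < 6 \<and> r < 6 \<and> s < 6) splits"
      by (simp add: splits_def)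
    have "x < 6 \<and> y < 6 \<and> p < 6 \<and> q < 6 \<and> r < 6 \<and> s < 6"
      using bspec[OF A[unfolded list_all_iff] that] by simp
    then show ?thesis by (simp only: split_value.simps p t)
  qed
  then show ?thesis unfolding quarter_slack_def by (intro arg_cong[where f = "\<lambda>x. 69120 - sum_list x"] map_cong) auto
qed

text \<open>
  The only computational input of the development. Slack is invariant under relabelling, so it suffices to look at the enumerated
  graphs.
\<close>

lemma slack_nonneg:
  assumes sym: "\<And>i j. b i j = b j i" and irrefl: "\<And>i. \<not> b i i"
  shows "0 \<le> slack b" "\<not> colourable b \<Longrightarrow> 1 \<le> slack b"
proof -
  obtain \<pi> m where \<pi>: "\<pi> \<in> perms6" and m: "m \<in> set (graphs 6)"
    and adj: "\<And>i j. i < 6 \<Longrightarrow> j < 6 \<Longrightarrow> adjm m i j = b (\<pi> i) (\<pi> j)"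
    using graphs_complete[of b, OF sym irrefl] by metis
  define c where "c = (\<lambda>i j. i < 6 \<and> j < 6 \<and> b (\<pi> i) (\<pi> j))"
  have "quarter_slack (adjm m) = quarter_slack c"
    by (rule quarter_slack_cong) (simp add: adj c_def)
  moreover have "slack c = 4 * quarter_slack c"
  proof (rule slack_eq)
    fix i j show "c i j = c j i" unfolding c_def using sym[of "\<pi> i" "\<pi> j"] by blast
  qed
  ultimately have "4 * quarter_slack (adjm m) = slack c" by simp
  also have "slack c = slack (pull \<pi> b)" by (rule slack_cong) (auto simp: c_def)
  finally have eq: "slack b = 4 * quarter_slack (adjm m)" using slack_pull[OF \<pi>, of b] by simp
  have ad: "admissible m" using graphs_admissible m unfolding list_all_iff by blast
  then show "0 \<le> slack b" unfolding eq admissible_def Let_def by (auto split: if_splits)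
  show "1 \<le> slack b" if nc: "\<not> colourable b"
  proof (rule ccontr)
    assume "\<not> 1 \<le> slack b"
    then have "coloured (adjm m)" using ad unfolding eq admissible_def Let_def by (auto split: if_splits)
    then have *: "adjm m i j \<longleftrightarrow> colour (adjm m) i = 1 \<and> colour (adjm m) j = 2 \<or> colour (adjm m) i = 2 \<and> colour (adjm m) j = 1"
      if "i < j" "j < 6" for i j
      using that unfolding coloured_def list_all_iff set_cells by auto
    let ?g = "\<lambda>x. colour (adjm m) (inv_into {..<6} \<pi> x)"
    have inv: "inv_into {..<6} \<pi> x < 6" "\<pi> (inv_into {..<6} \<pi> x) = x" if "x < 6" for x
      using perms6_bij[OF \<pi>] that bij_betw_inv_into_right[of \<pi> "{..<6}" "{..<6}" x]
        inv_into_into[of x \<pi> "{..<6}"] by (auto simp: bij_betw_def)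
    have "\<forall>i<6. \<forall>j<6. i \<noteq> j \<longrightarrow> ?g i < 3 \<and> (b i j \<longleftrightarrow> {?g i, ?g j} = {1, 2})"
    proof (intro allI impI conjI)
      fix i j :: nat assume ij: "i < 6" "j < 6" "i \<noteq> j"
      show "?g i < 3" by (simp add: colour_def)
      let ?i = "inv_into {..<6} \<pi> i" let ?j = "inv_into {..<6} \<pi> j"
      have ne: "?i \<noteq> ?j" using inv(2)[OF ij(1)] inv(2)[OF ij(2)] ij(3) by metis
      have "b i j = adjm m ?i ?j" "b i j = adjm m ?j ?i"
        using adj inv[OF ij(1)] inv[OF ij(2)] sym by metis+
      then show "b i j \<longleftrightarrow> {?g i, ?g j} = {1, 2}"
        using *[of ?i ?j] *[of ?j ?i] ne inv(1)[OF ij(1)] inv(1)[OF ij(2)]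
        by (cases "?i < ?j") (auto simp: doubleton_eq_iff)
    qed
    then have "colourable b" unfolding colourable_def by (rule exI[of _ ?g])
    then show False using nc by simp
  qed
qed

section \<open>Weighted sums over six vertices\<close>

abbreviation tuples :: "nat set \<Rightarrow> (nat \<Rightarrow> nat) set" where
  "tuples V \<equiv> {..<6} \<rightarrow>\<^sub>E V"

definition weight :: "(nat \<Rightarrow> real) \<Rightarrow> (nat \<Rightarrow> nat) \<Rightarrow> real" where
  "weight w \<phi> = (\<Prod>i<6. w (\<phi> i))"

lemma finite_tuples: "finite V \<Longrightarrow> finite (tuples V)"
  by (simp add: finite_PiE)

lemma prod_lessThan6: "(\<Prod>i<6::nat. f i :: real) = f 0 * f 1 * f 2 * f 3 * f 4 * f 5"
  by (simp add: eval_nat_numeral One_nat_def)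

lemma sum_tuples:
  "(\<Sum>\<phi>\<in>tuples V. h \<phi>) = (\<Sum>a\<in>V. \<Sum>b\<in>V. \<Sum>c\<in>V. \<Sum>d\<in>V. \<Sum>e\<in>V. \<Sum>f\<in>V. h (\<lambda>k\<in>{..<6}. [a, b, c, d, e, f] ! k))"
proof -
  have "(\<Sum>\<phi>\<in>tuples V. h \<phi>) =
      (\<Sum>(a, b, c, d, e, f)\<in>V \<times> V \<times> V \<times> V \<times> V \<times> V. h (\<lambda>k\<in>{..<6}. [a, b, c, d, e, f] ! k))"
  proof (rule sum.reindex_bij_witness[where
      i = "\<lambda>(a, b, c, d, e, f). \<lambda>k\<in>{..<6}. [a, b, c, d, e, f] ! k" and
      j = "\<lambda>\<pi>. (\<pi> 0, \<pi> 1, \<pi> 2, \<pi> 3, \<pi> 4, \<pi> 5)"], goal_cases)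
    case (1 \<pi>)
    have "(\<lambda>k\<in>{..<6}. [\<pi> 0, \<pi> 1, \<pi> 2, \<pi> 3, \<pi> 4, \<pi> 5] ! k) x = \<pi> x" for x
    proof (cases "x < 6")
      case True
      then consider "x = 0" | "x = 1" | "x = 2" | "x = 3" | "x = 4" | "x = 5" by linarith
      then show ?thesis by cases simp_all
    next
      case False
      then show ?thesis using 1 by (simp add: PiE_def extensional_def)
    qed
    then show ?case by (simp add: fun_eq_iff)
  next
    case (2 \<pi>)
    have "\<pi> k \<in> V" if "k < 6" for k using 2 that by auto
    then show ?case by simp
  next
    case (3 x)
    obtain a b c d e f where x: "x = (a, b, c, d, e, f)" by (cases x)
    show ?case unfolding x by simp
  next
    case (4 x)
    obtain a b c d e f where x: "x = (a, b, c, d, e, f)" by (cases x)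
    have S: "set [a, b, c, d, e, f] \<subseteq> V" using 4 unfolding x by simp
    have "[a, b, c, d, e, f] ! k \<in> V" if "k < 6" for k
      by (rule subsetD[OF S nth_mem]) (use that in simp)
    then show ?case unfolding x by simp
  next
    case (5 \<pi>)
    have "(\<lambda>k\<in>{..<6}. [\<pi> 0, \<pi> 1, \<pi> 2, \<pi> 3, \<pi> 4, \<pi> 5] ! k) x = \<pi> x" for x
    proof (cases "x < 6")
      case True
      then consider "x = 0" | "x = 1" | "x = 2" | "x = 3" | "x = 4" | "x = 5" by linarith
      then show ?thesis by cases simp_all
    next
      case False
      then show ?thesis using 5 by (simp add: PiE_def extensional_def)
    qed
    then have "(\<lambda>k\<in>{..<6}. [\<pi> 0, \<pi> 1, \<pi> 2, \<pi> 3, \<pi> 4, \<pi> 5] ! k) = \<pi>" by (simp add: fun_eq_iff)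
    then show ?case by simp
  qed
  then show ?thesis by (simp add: sum.cartesian_product)
qed

lemma weight_tuple: "weight w (\<lambda>k\<in>{..<6}. [a, b, c, d, e, f] ! k) = w a * w b * w c * w d * w e * w f"
  unfolding weight_def prod_lessThan6 by simp

lemma weight_nonneg: "(\<And>x. x \<in> V \<Longrightarrow> 0 \<le> w x) \<Longrightarrow> \<phi> \<in> tuples V \<Longrightarrow> 0 \<le> weight w \<phi>"
  unfolding weight_def by (intro prod_nonneg) auto

lemma sum_weight: "(\<Sum>\<phi>\<in>tuples V. weight w \<phi>) = (\<Sum>x\<in>V. w x) ^ 6"
proof -
  have "(\<Sum>\<phi>\<in>tuples V. weight w \<phi>) = (\<Sum>a\<in>V. \<Sum>b\<in>V. \<Sum>c\<in>V. \<Sum>d\<in>V. \<Sum>e\<in>V. \<Sum>f\<in>V. w a * w b * w c * w d * w e * w f)"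
    by (simp add: sum_tuples weight_tuple)
  also have "\<dots> = (\<Sum>x\<in>V. w x) ^ 6"
    by (simp add: sum_distrib_left[symmetric] sum_distrib_right[symmetric] eval_nat_numeral One_nat_def mult.assoc)
  finally show ?thesis .
qed

lemma sum_tuples_permute:
  fixes g :: "(nat \<Rightarrow> nat \<Rightarrow> bool) \<Rightarrow> real"
  assumes "finite V" "\<pi> \<in> perms6"
    and cong: "\<And>b b'. (\<And>i j. i < 6 \<Longrightarrow> j < 6 \<Longrightarrow> b i j = b' i j) \<Longrightarrow> g b = g b'"
  shows "(\<Sum>\<phi>\<in>tuples V. weight w \<phi> * g (pull \<pi> (pull \<phi> A))) = (\<Sum>\<phi>\<in>tuples V. weight w \<phi> * g (pull \<phi> A))"
proof -
  define h where "h \<phi> = (\<lambda>i\<in>{..<6}. \<phi> (\<pi> i))" for \<phi> :: "nat \<Rightarrow> nat"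
  have surj: "\<exists>i<6. j = \<pi> i" if "j < 6" for j
    using perms6_bij[OF assms(2)] that by (auto simp: bij_betw_def image_iff set_eq_iff)
  have "inj_on h (tuples V)"
  proof (rule inj_onI)
    fix \<phi> \<psi> assume *: "\<phi> \<in> tuples V" "\<psi> \<in> tuples V" "h \<phi> = h \<psi>"
    show "\<phi> = \<psi>"
    proof (rule PiE_ext[OF *(1,2)])
      fix j :: nat assume "j \<in> {..<6}"
      then obtain i where "i < 6" "j = \<pi> i" using surj by auto
      then show "\<phi> j = \<psi> j" using fun_cong[OF *(3), of i] by (simp add: h_def)
    qed
  qed
  moreover have "h ` tuples V \<subseteq> tuples V"
    using perms6_less[OF assms(2)] by (auto simp: h_def)
  ultimately have "bij_betw h (tuples V) (tuples V)"
    using finite_tuples[OF assms(1)] by (simp add: bij_betw_def endo_inj_surj)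
  then have "(\<Sum>\<phi>\<in>tuples V. weight w \<phi> * g (pull \<phi> A)) = (\<Sum>\<phi>\<in>tuples V. weight w (h \<phi>) * g (pull (h \<phi>) A))"
    using sum.reindex_bij_betw[of h "tuples V" "tuples V" "\<lambda>\<phi>. weight w \<phi> * g (pull \<phi> A)"] by simp
  also have "\<dots> = (\<Sum>\<phi>\<in>tuples V. weight w \<phi> * g (pull \<pi> (pull \<phi> A)))"
  proof (rule sum.cong[OF refl])
    fix \<phi> assume "\<phi> \<in> tuples V"
    have "weight w (h \<phi>) = (\<Prod>i<6. w (\<phi> (\<pi> i)))"
      unfolding weight_def by (intro prod.cong) (auto simp: h_def)
    also have "\<dots> = weight w \<phi>"
      unfolding weight_def using prod.reindex_bij_betw[OF perms6_bij[OF assms(2)], of "\<lambda>i. w (\<phi> i)"] .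
    moreover have "g (pull (h \<phi>) A) = g (pull \<pi> (pull \<phi> A))"
      by (rule cong) (simp add: h_def)
    ultimately show "weight w (h \<phi>) * g (pull (h \<phi>) A) = weight w \<phi> * g (pull \<pi> (pull \<phi> A))" by simp
  qed
  finally show ?thesis by simp
qed

lemma dot_eq_sum:
  "length us = length ds \<Longrightarrow> length vs = length ds \<Longrightarrow> dot ds us vs = (\<Sum>k<length ds. ds ! k * us ! k * vs ! k)"
proof (induction ds arbitrary: us vs)
  case (Cons d ds)
  then obtain u us' v vs' where "us = u # us'" "vs = v # vs'"
    by (cases us; cases vs) auto
  then show ?case using Cons by (simp add: sum.lessThan_Suc_shift del: sum.lessThan_Suc)
qed simp

lemma sum_dot_squares:
  assumes "\<And>p. p \<in> P \<Longrightarrow> length (u p) = length ds"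
  shows "(\<Sum>p\<in>P. \<Sum>q\<in>P. c p * c q * real_of_int (dot ds (u p) (u q))) =
    (\<Sum>k<length ds. real_of_int (ds ! k) * (\<Sum>p\<in>P. c p * real_of_int (u p ! k))\<^sup>2)"
proof -
  have "(\<Sum>p\<in>P. \<Sum>q\<in>P. c p * c q * real_of_int (dot ds (u p) (u q))) =
      (\<Sum>p\<in>P. \<Sum>q\<in>P. \<Sum>k<length ds. real_of_int (ds ! k) * ((c p * real_of_int (u p ! k)) * (c q * real_of_int (u q ! k))))"
    by (intro sum.cong refl) (simp add: dot_eq_sum assms sum_distrib_left mult_ac)
  also have "\<dots> = (\<Sum>p\<in>P. \<Sum>k<length ds. \<Sum>q\<in>P. real_of_int (ds ! k) * ((c p * real_of_int (u p ! k)) * (c q * real_of_int (u q ! k))))"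
    by (intro sum.cong refl sum.swap)
  also have "\<dots> = (\<Sum>k<length ds. \<Sum>p\<in>P. \<Sum>q\<in>P. real_of_int (ds ! k) * ((c p * real_of_int (u p ! k)) * (c q * real_of_int (u q ! k))))"
    by (rule sum.swap)
  also have "\<dots> = (\<Sum>k<length ds. real_of_int (ds ! k) * (\<Sum>p\<in>P. c p * real_of_int (u p ! k))\<^sup>2)"
    unfolding power2_eq_square sum_product by (simp only: sum_distrib_left)
  finally show ?thesis .
qed

lemma weights_nonneg: "d \<in> set (pair_weights e) \<Longrightarrow> 0 \<le> d" "d \<in> set cherry_weights \<Longrightarrow> 0 \<le> d"
  by (auto simp: pair_weights_def cherry_weights_def split: if_splits)

lemma sum_dot_nonneg:
  assumes "\<And>p. p \<in> P \<Longrightarrow> length (u p) = length ds" "\<And>d. d \<in> set ds \<Longrightarrow> 0 \<le> d"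
  shows "0 \<le> (\<Sum>p\<in>P. \<Sum>q\<in>P. c p * c q * real_of_int (dot ds (u p) (u q)))"
proof -
  have "0 \<le> (\<Sum>k<length ds. real_of_int (ds ! k) * (\<Sum>p\<in>P. c p * real_of_int (u p ! k))\<^sup>2)"
    by (intro sum_nonneg mult_nonneg_nonneg) (auto intro: assms(2))
  then show ?thesis using sum_dot_squares[of P u ds c, OF assms(1)] by simp
qed

lemma length_pair_form: "length (pair_form b i j x y) = length (pair_weights (b i j))"
  by (simp add: pair_form_def pair_weights_def length_flags)

lemma length_cherry_form: "length (cherry_form b i j k l x) = length cherry_weights"
  by (simp add: cherry_form_def cherry_weights_def length_flags)

text \<open>
  After fixing the roots, the two groups of further vertices are sampled independently and identically. Their joint mean is
  therefore a weighted sum of squares of means, with nonnegative weights.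
\<close>

lemma sum_squares_nonneg:
  assumes w: "\<And>x. x \<in> V \<Longrightarrow> 0 \<le> w x"
  shows "0 \<le> (\<Sum>\<phi>\<in>tuples V. weight w \<phi> * real_of_int (squares (pull \<phi> A)))"
proof -
  let ?t = "\<lambda>a b c d e f. (\<lambda>k\<in>{..<6}. [a, b, c, d, e, f] ! k)"
  have p: "pair_term (pull (?t a b c d e f) A) 0 1 2 3 4 5 = pair_term A a b c d e f" for a b c d e f
    by (simp add: pair_term_def pair_form_def)
  have ch: "cherry_term (pull (?t a b c d e f) A) 0 1 2 3 4 5 = cherry_term A a b c d e f" for a b c d e f
    by (simp add: cherry_term_def cherry_type_def cherry_form_def)
  have A: "0 \<le> (\<Sum>c\<in>V. \<Sum>d\<in>V. \<Sum>e\<in>V. \<Sum>f\<in>V. w a * w b * w c * w d * w e * w f * real_of_int (pair_term A a b c d e f))"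
    if "a \<in> V" "b \<in> V" for a b
  proof -
    have "(\<Sum>c\<in>V. \<Sum>d\<in>V. \<Sum>e\<in>V. \<Sum>f\<in>V. w a * w b * w c * w d * w e * w f * real_of_int (pair_term A a b c d e f)) =
      w a * w b * (\<Sum>p\<in>V \<times> V. \<Sum>q\<in>V \<times> V. (w (fst p) * w (snd p)) * (w (fst q) * w (snd q)) *
        real_of_int (dot (pair_weights (A a b)) (pair_form A a b (fst p) (snd p)) (pair_form A a b (fst q) (snd q))))"
      by (simp add: sum.cartesian_product' pair_term_def sum_distrib_left mult_ac)
    also have "\<dots> \<ge> 0"
      by (intro mult_nonneg_nonneg w that sum_dot_nonneg[where u = "\<lambda>p. pair_form A a b (fst p) (snd p)" and c = "\<lambda>p. w (fst p) * w (snd p)"])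
         (auto simp: length_pair_form weights_nonneg)
    finally show ?thesis .
  qed
  have B: "0 \<le> (\<Sum>e\<in>V. \<Sum>f\<in>V. w a * w b * w c * w d * w e * w f * real_of_int (cherry_term A a b c d e f))"
    if "a \<in> V" "b \<in> V" "c \<in> V" "d \<in> V" for a b c d
  proof (cases "cherry_type A a b c d")
    case True
    then have "(\<Sum>e\<in>V. \<Sum>f\<in>V. w a * w b * w c * w d * w e * w f * real_of_int (cherry_term A a b c d e f)) =
      (w a * w b * w c * w d) * (\<Sum>e\<in>V. \<Sum>f\<in>V. w e * w f *
        real_of_int (dot cherry_weights (cherry_form A a b c d e) (cherry_form A a b c d f)))"
      by (simp add: cherry_term_def sum_distrib_left mult_ac)
    also have "\<dots> \<ge> 0"
      by (intro mult_nonneg_nonneg w that sum_dot_nonneg[where u = "cherry_form A a b c d" and c = w])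
         (auto simp: length_cherry_form weights_nonneg)
    finally show ?thesis .
  qed (simp add: cherry_term_def)
  have "(\<Sum>\<phi>\<in>tuples V. weight w \<phi> * real_of_int (squares (pull \<phi> A))) =
    (\<Sum>\<phi>\<in>tuples V. weight w \<phi> * real_of_int (pair_term (pull \<phi> A) 0 1 2 3 4 5)) +
    4 * (\<Sum>\<phi>\<in>tuples V. weight w \<phi> * real_of_int (cherry_term (pull \<phi> A) 0 1 2 3 4 5))"
    unfolding squares_def sum_distrib_left sum.distrib[symmetric]
    by (intro sum.cong refl) (simp only: of_int_add of_int_mult of_int_numeral algebra_simps)
  also have "\<dots> \<ge> 0"
    unfolding sum_tuples weight_tuple p ch
    by (intro add_nonneg_nonneg mult_nonneg_nonneg sum_nonneg A B) auto
  finally show ?thesis .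
qed

definition star_mean :: "nat set \<Rightarrow> (nat \<Rightarrow> nat \<Rightarrow> bool) \<Rightarrow> (nat \<Rightarrow> real) \<Rightarrow> real" where
  "star_mean V A w = (\<Sum>\<phi>\<in>tuples V. weight w \<phi> * of_bool (star (pull \<phi> A) 0 1 2 3 4 5))"

lemma sum_slack:
  assumes "finite V"
  shows "(\<Sum>\<phi>\<in>tuples V. weight w \<phi> * real_of_int (slack (pull \<phi> A))) =
    276480 * (\<Sum>x\<in>V. w x) ^ 6 - 100776960 * star_mean V A w -
    720 * (\<Sum>\<phi>\<in>tuples V. weight w \<phi> * real_of_int (squares (pull \<phi> A)))"
proof -
  have perm: "(\<Sum>\<phi>\<in>tuples V. weight w \<phi> * (\<Sum>\<pi>\<in>perms6. g (pull \<pi> (pull \<phi> A)))) =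
      720 * (\<Sum>\<phi>\<in>tuples V. weight w \<phi> * g (pull \<phi> A))"
    if "\<And>b b'. (\<And>i j. i < 6 \<Longrightarrow> j < 6 \<Longrightarrow> b i j = b' i j) \<Longrightarrow> g b = g b'"
    for g :: "(nat \<Rightarrow> nat \<Rightarrow> bool) \<Rightarrow> real"
  proof -
    have "(\<Sum>\<phi>\<in>tuples V. weight w \<phi> * (\<Sum>\<pi>\<in>perms6. g (pull \<pi> (pull \<phi> A)))) =
        (\<Sum>\<pi>\<in>perms6. \<Sum>\<phi>\<in>tuples V. weight w \<phi> * g (pull \<pi> (pull \<phi> A)))"
      unfolding sum_distrib_left by (rule sum.swap)
    also have "\<dots> = (\<Sum>\<pi>\<in>perms6. \<Sum>\<phi>\<in>tuples V. weight w \<phi> * g (pull \<phi> A))"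
      by (intro sum.cong refl sum_tuples_permute[OF assms _ that])
    also have "\<dots> = 720 * (\<Sum>\<phi>\<in>tuples V. weight w \<phi> * g (pull \<phi> A))"
      by (simp add: card_perms6)
    finally show ?thesis .
  qed
  have "(\<Sum>\<phi>\<in>tuples V. weight w \<phi> * real_of_int (slack (pull \<phi> A))) =
    276480 * (\<Sum>\<phi>\<in>tuples V. weight w \<phi>) -
    139968 * (\<Sum>\<phi>\<in>tuples V. weight w \<phi> * (\<Sum>\<pi>\<in>perms6. of_bool (star (pull \<pi> (pull \<phi> A)) 0 1 2 3 4 5))) -
    (\<Sum>\<phi>\<in>tuples V. weight w \<phi> * (\<Sum>\<pi>\<in>perms6. real_of_int (squares (pull \<pi> (pull \<phi> A)))))"
    unfolding slack_def stars_def sum_distrib_left[of "276480::real"] sum_distrib_left[of "139968::real"] sum_subtractf[symmetric]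
    by (intro sum.cong refl) (simp add: algebra_simps)
  also have "(\<Sum>\<phi>\<in>tuples V. weight w \<phi> * (\<Sum>\<pi>\<in>perms6. of_bool (star (pull \<pi> (pull \<phi> A)) 0 1 2 3 4 5))) =
      720 * star_mean V A w"
    unfolding star_mean_def
    by (rule perm[where g = "\<lambda>b. of_bool (star b 0 1 2 3 4 5)"]) (rule arg_cong[where f = of_bool], rule star_cong)
  also have "(\<Sum>\<phi>\<in>tuples V. weight w \<phi> * (\<Sum>\<pi>\<in>perms6. real_of_int (squares (pull \<pi> (pull \<phi> A))))) =
      720 * (\<Sum>\<phi>\<in>tuples V. weight w \<phi> * real_of_int (squares (pull \<phi> A)))"
    by (rule perm[where g = "\<lambda>b. real_of_int (squares b)"]) (rule arg_cong[where f = real_of_int], rule squares_cong)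
  finally show ?thesis by (simp add: sum_weight)
qed

definition bad_mean :: "nat set \<Rightarrow> (nat \<Rightarrow> nat \<Rightarrow> bool) \<Rightarrow> (nat \<Rightarrow> real) \<Rightarrow> real" where
  "bad_mean V A w = (\<Sum>\<phi>\<in>tuples V. weight w \<phi> * of_bool (\<not> colourable (pull \<phi> A)))"

text \<open>
  The inequality that carries everything. Sampling with repetition makes the flag algebra identity exact, with no error term, and
  lets it hold for any weights on the vertices. The freedom in the weights is what yields the sharp stability below: weighting a
  nearly balanced graph makes the comparison blowup exactly extremal.
\<close>

theorem star_mean_bound:
  assumes "finite V" and w: "\<And>x. x \<in> V \<Longrightarrow> 0 \<le> w x" and "(\<Sum>x\<in>V. w x) = 1"
    and sym: "\<And>x y. A x y = A y x" and irrefl: "\<And>x. \<not> A x x"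
  shows "100776960 * star_mean V A w + bad_mean V A w \<le> 276480"
proof -
  have "bad_mean V A w \<le> (\<Sum>\<phi>\<in>tuples V. weight w \<phi> * real_of_int (slack (pull \<phi> A)))"
    unfolding bad_mean_def
  proof (intro sum_mono mult_left_mono weight_nonneg[where V = V] w)
    fix \<phi>
    have s: "pull \<phi> A i j = pull \<phi> A j i" and r: "\<not> pull \<phi> A i i" for i j using sym irrefl by auto
    show "of_bool (\<not> colourable (pull \<phi> A)) \<le> real_of_int (slack (pull \<phi> A))"
      using slack_nonneg(1)[of "pull \<phi> A", OF s r] slack_nonneg(2)[of "pull \<phi> A", OF s r]
      by (cases "colourable (pull \<phi> A)") auto
  qed auto
  moreover have "0 \<le> (\<Sum>\<phi>\<in>tuples V. weight w \<phi> * real_of_int (squares (pull \<phi> A)))"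
    using w by (rule sum_squares_nonneg)
  ultimately show ?thesis using sum_slack[OF assms(1), of w A] assms(3) by simp
qed

section \<open>Counting induced subgraphs by labelled copies\<close>

lemma adj_commute: "adj G x y = adj G y x"
  by (simp add: adj_def insert_commute)

lemma adj_irrefl: "simple_graph G \<Longrightarrow> \<not> adj G x x"
  by (auto simp: simple_graph_def adj_def)

lemma adj_induced: "x \<in> X \<Longrightarrow> y \<in> X \<Longrightarrow> adj (induced G X) x y = adj G x y"
  by (simp add: adj_def induced_def)

lemma verts_induced [simp]: "verts (induced G X) = X"
  by (simp add: induced_def)

lemma isomorphism_inverse:
  assumes "isomorphism f G H"
  shows "isomorphism (inv_into (verts G) f) H G"
proof -
  have b: "bij_betw f (verts G) (verts H)"
    and a: "\<And>x y. x \<in> verts G \<Longrightarrow> y \<in> verts G \<Longrightarrow> adj G x y = adj H (f x) (f y)"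
    using assms unfolding isomorphism_def by auto
  have i: "inv_into (verts G) f x \<in> verts G" "f (inv_into (verts G) f x) = x" if "x \<in> verts H" for x
    using bij_betw_apply[OF bij_betw_inv_into[OF b] that] bij_betw_inv_into_right[OF b that] by auto
  show ?thesis
    unfolding isomorphism_def using bij_betw_inv_into[OF b] a i by simp
qed

lemma isomorphism_compose:
  assumes "isomorphism f G H" "isomorphism g H K"
  shows "isomorphism (g \<circ> f) G K"
proof -
  have b: "bij_betw f (verts G) (verts H)" "bij_betw g (verts H) (verts K)"
    using assms unfolding isomorphism_def by auto
  then show ?thesis
    using assms bij_betw_apply[OF b(1)] bij_betw_trans[OF b] unfolding isomorphism_def by simp
qed

lemma isomorphic_sym: "isomorphic G H \<Longrightarrow> isomorphic H G"
  unfolding isomorphic_def using isomorphism_inverse by blast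

lemma isomorphic_trans: "isomorphic G H \<Longrightarrow> isomorphic H K \<Longrightarrow> isomorphic G K"
  unfolding isomorphic_def using isomorphism_compose by blast

lemma isomorphic_refl: "isomorphic G G"
  unfolding isomorphic_def isomorphism_def by (intro exI[of _ id]) auto

lemma isomorphic_pull:
  assumes e: "bij_betw e {..<6} X" and H: "verts H = {..<6}"
  shows "isomorphic (induced G X) H \<longleftrightarrow>
    (\<exists>\<pi>\<in>perms6. \<forall>i<6. \<forall>j<6. adj H i j = adj G (e (\<pi> i)) (e (\<pi> j)))"
proof
  assume "isomorphic (induced G X) H"
  then obtain g where "isomorphism g H (induced G X)"
    unfolding isomorphic_def using isomorphism_inverse by blast
  then have g: "bij_betw g {..<6} X" and adj: "\<And>i j. i < 6 \<Longrightarrow> j < 6 \<Longrightarrow> adj H i j = adj (induced G X) (g i) (g j)"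
    unfolding isomorphism_def H by auto
  let ?p = "\<lambda>i. inv_into {..<6} e (g i)"
  have gX: "g i \<in> X" if "i < 6" for i using g that by (auto dest: bij_betw_apply)
  have b: "bij_betw ?p {..<6} {..<6}"
    using bij_betw_trans[OF g bij_betw_inv_into[OF e]] by (simp add: comp_def)
  have "(\<lambda>i\<in>{..<6}. ?p i) \<in> perms6"
    by (rule perms6I) (use b in \<open>auto simp: bij_betw_def inj_on_def\<close>)
  moreover have "e (?p i) = g i" if "i < 6" for i
    using bij_betw_inv_into_right[OF e gX[OF that]] .
  ultimately show "\<exists>\<pi>\<in>perms6. \<forall>i<6. \<forall>j<6. adj H i j = adj G (e (\<pi> i)) (e (\<pi> j))"
    using adj gX by (intro bexI[of _ "\<lambda>i\<in>{..<6}. ?p i"]) (auto simp: adj_induced)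
next
  assume "\<exists>\<pi>\<in>perms6. \<forall>i<6. \<forall>j<6. adj H i j = adj G (e (\<pi> i)) (e (\<pi> j))"
  then obtain \<pi> where \<pi>: "\<pi> \<in> perms6" and adj: "\<And>i j. i < 6 \<Longrightarrow> j < 6 \<Longrightarrow> adj H i j = adj G (e (\<pi> i)) (e (\<pi> j))"
    by blast
  have b: "bij_betw (e \<circ> \<pi>) {..<6} X" using bij_betw_trans[OF perms6_bij[OF \<pi>] e] .
  have "isomorphism (e \<circ> \<pi>) H (induced G X)"
    unfolding isomorphism_def H using b adj bij_betw_apply[OF b] by (auto simp: adj_induced)
  then show "isomorphic (induced G X) H"
    using isomorphic_sym unfolding isomorphic_def by blast
qed

abbreviation F4 :: pgraph where
  "F4 \<equiv> on_first 6 {{0,1}, {0,2}, {0,4}}"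

lemma nat_less6: "(\<forall>i<6::nat. P i) \<longleftrightarrow> P 0 \<and> P 1 \<and> P 2 \<and> P 3 \<and> P 4 \<and> P 5"
proof
  assume "P 0 \<and> P 1 \<and> P 2 \<and> P 3 \<and> P 4 \<and> P 5"
  moreover have "i = 0 \<or> i = 1 \<or> i = 2 \<or> i = 3 \<or> i = 4 \<or> i = 5" if "i < 6" for i :: nat using that by linarith
  ultimately show "\<forall>i<6. P i" by metis
qed simp

definition F4_adj :: "nat \<Rightarrow> nat \<Rightarrow> bool" where
  "F4_adj i j \<longleftrightarrow> i = 0 \<and> (j = 1 \<or> j = 2 \<or> j = 4) \<or> j = 0 \<and> (i = 1 \<or> i = 2 \<or> i = 4)"

lemma adj_F4: "adj F4 = F4_adj"
  by (intro ext) (auto simp: adj_def on_first_def F4_adj_def doubleton_eq_iff)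

lemma star_iff:
  assumes sym: "\<And>i j. b i j = b j i" and irrefl: "\<And>i. \<not> b i i"
  shows "star b 0 1 2 3 4 5 \<longleftrightarrow> (\<forall>i<6. \<forall>j<6. b i j = adj F4 (swap 3 4 i) (swap 3 4 j))"
proof -
  have s: "b 1 0 = b 0 1" "b 2 0 = b 0 2" "b 3 0 = b 0 3" "b 4 0 = b 0 4" "b 5 0 = b 0 5"
    "b 2 1 = b 1 2" "b 3 1 = b 1 3" "b 4 1 = b 1 4" "b 5 1 = b 1 5" "b 3 2 = b 2 3" "b 4 2 = b 2 4"
    "b 5 2 = b 2 5" "b 4 3 = b 3 4" "b 5 3 = b 3 5" "b 5 4 = b 4 5"
    by (rule sym)+
  show ?thesis
    unfolding nat_less6 adj_F4 star_def by (simp add: F4_adj_def swap_def s irrefl) blast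
qed

text \<open>
  Twelve orderings of the vertices of the graph produce a star with the prescribed labelling: six of the leaves times two of the
  isolated vertices.
\<close>

lemma stars_F4: "stars (adj F4) = 12"
proof -
  have s: "F4_adj i j = F4_adj j i" for i j by (auto simp: F4_adj_def)
  have 1: "(of_bool (star F4_adj i k j l x y) :: int) = of_bool (star F4_adj i j k l x y)"
    "(of_bool (star F4_adj i j k l y x) :: int) = of_bool (star F4_adj i j k l x y)" for i j k l x y
    unfolding star_def s[of k j] s[of y x] by (rule arg_cong[where f = of_bool], blast)+
  have "stars (adj F4) = (\<Sum>\<pi>\<in>perms6. of_bool (star F4_adj (\<pi> 0) (\<pi> 1) (\<pi> 2) (\<pi> 3) (\<pi> 4) (\<pi> 5)))"
    unfolding stars_def adj_F4 by (simp add: star_def)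
  also have "\<dots> = 4 * (\<Sum>x\<leftarrow>concat (map (\<lambda>(x, y, p, q, r, s).
     [(p, q, r, s, x, y), (p, q, s, r, x, y), (p, r, s, q, x, y),
      (q, p, r, s, x, y), (q, p, s, r, x, y), (q, r, s, p, x, y),
      (r, p, q, s, x, y), (r, p, s, q, x, y), (r, q, s, p, x, y),
      (s, p, q, r, x, y), (s, p, r, q, x, y), (s, q, r, p, x, y)]) splits).
      (case x of (a, b, c, d, e, f) \<Rightarrow> of_bool (star F4_adj a b c d e f)))"
    unfolding sum_perms6_symmetric_cherry[of "\<lambda>i j k l x y. of_bool (star F4_adj i j k l x y)", OF 1]
      sum_perms6_tuples[where Q = "\<lambda>a b c d e f. b < c \<and> e < f" and t = "\<lambda>i j k l x y. of_bool (star F4_adj i j k l x y)"] cherry_tuples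
    by (subst sum.distinct_set_conv_list[OF distinct_splits(2)]) simp
  also have "\<dots> = 12" by code_simp
  finally show ?thesis .
qed

lemma stars_eq:
  assumes sym: "\<And>i j. b i j = b j i" and irrefl: "\<And>i. \<not> b i i"
  shows "stars b = 12 * of_bool (\<exists>\<pi>\<in>perms6. \<forall>i<6. \<forall>j<6. adj F4 i j = b (\<pi> i) (\<pi> j))"
proof (cases "\<exists>\<pi>\<in>perms6. \<forall>i<6. \<forall>j<6. adj F4 i j = b (\<pi> i) (\<pi> j)")
  case True
  then obtain \<pi> where \<pi>: "\<pi> \<in> perms6" "\<forall>i<6. \<forall>j<6. adj F4 i j = b (\<pi> i) (\<pi> j)" by blast
  have "stars b = stars (pull \<pi> b)" by (rule stars_pull[OF \<pi>(1), symmetric])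
  also have "\<dots> = stars (adj F4)" by (rule stars_cong) (use \<pi>(2) in simp)
  finally show ?thesis using True by (simp add: stars_F4)
next
  case False
  have "\<not> star (pull \<pi> b) 0 1 2 3 4 5" if \<pi>: "\<pi> \<in> perms6" for \<pi>
  proof
    assume "star (pull \<pi> b) 0 1 2 3 4 5"
    moreover have "pull \<pi> b i j = pull \<pi> b j i" "\<not> pull \<pi> b i i" for i j using sym irrefl by auto
    ultimately have *: "b (\<pi> i) (\<pi> j) = adj F4 (swap 3 4 i) (swap 3 4 j)" if "i < 6" "j < 6" for i j
      using star_iff[of "pull \<pi> b"] that by auto
    have "adj F4 i j = b (swapped 3 4 \<pi> i) (swapped 3 4 \<pi> j)" if "i < 6" "j < 6" for i j
      using *[of "swap 3 4 i" "swap 3 4 j"] that by (simp add: swapped_apply swap_less)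
    moreover have "swapped 3 4 \<pi> \<in> perms6" by (rule swapped_perms6) (use \<pi> in auto)
    ultimately show False using False by blast
  qed
  then show ?thesis using False unfolding stars_def by simp
qed

definition enum6 :: "nat set \<Rightarrow> nat \<Rightarrow> nat" where
  "enum6 X = (SOME e. bij_betw e {..<6} X)"

lemma enum6:
  assumes "card X = 6"
  shows "bij_betw (enum6 X) {..<6} X"
proof -
  have "finite X" using assms by (intro card_ge_0_finite) simp
  then obtain e where "bij_betw e {0..<card X} X" using ex_bij_betw_nat_finite by blast
  then have "bij_betw e {..<6} X" unfolding assms lessThan_atLeast0 .
  then show ?thesis unfolding enum6_def by (rule someI[of "\<lambda>e. bij_betw e {..<6} X"])
qed

definition inj_tuples :: "nat set \<Rightarrow> (nat \<Rightarrow> nat) set" where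
  "inj_tuples V = {\<phi> \<in> tuples V. inj_on \<phi> {..<6}}"

lemma finite_inj_tuples: "finite V \<Longrightarrow> finite (inj_tuples V)"
  unfolding inj_tuples_def using finite_tuples by simp

lemma sum_inj_tuples:
  fixes g :: "(nat \<Rightarrow> nat \<Rightarrow> bool) \<Rightarrow> real"
  assumes "finite V"
    and cong: "\<And>b b'. (\<And>i j. i < 6 \<Longrightarrow> j < 6 \<Longrightarrow> b i j = b' i j) \<Longrightarrow> g b = g b'"
  shows "(\<Sum>\<phi>\<in>inj_tuples V. g (pull \<phi> A)) =
    (\<Sum>X\<in>{X. X \<subseteq> V \<and> card X = 6}. \<Sum>\<pi>\<in>perms6. g (pull \<pi> (pull (enum6 X) A)))"
proof -
  have group: "(\<Sum>X\<in>{X. X \<subseteq> V \<and> card X = 6}. \<Sum>\<phi>\<in>{\<phi> \<in> inj_tuples V. \<phi> ` {..<6} = X}. g (pull \<phi> A)) =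
      (\<Sum>\<phi>\<in>inj_tuples V. g (pull \<phi> A))"
    by (rule sum.group) (use assms(1) finite_inj_tuples in \<open>auto simp: inj_tuples_def card_image\<close>)
  have part: "(\<Sum>\<phi>\<in>{\<phi> \<in> inj_tuples V. \<phi> ` {..<6} = X}. g (pull \<phi> A)) =
      (\<Sum>\<pi>\<in>perms6. g (pull \<pi> (pull (enum6 X) A)))" if X: "X \<subseteq> V" "card X = 6" for X
  proof (rule sum.reindex_bij_witness[where j = "\<lambda>\<phi>. \<lambda>i\<in>{..<6}. inv_into {..<6} (enum6 X) (\<phi> i)"
        and i = "\<lambda>\<pi>. \<lambda>i\<in>{..<6}. enum6 X (\<pi> i)"])
    have e: "bij_betw (enum6 X) {..<6} X" using enum6 X by blast
    have ei: "enum6 X (inv_into {..<6} (enum6 X) x) = x" "inv_into {..<6} (enum6 X) x < 6" if "x \<in> X" for x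
      using bij_betw_inv_into_right[OF e that] bij_betw_apply[OF bij_betw_inv_into[OF e] that] by auto
    have ie: "inv_into {..<6} (enum6 X) (enum6 X i) = i" "enum6 X i \<in> X" if "i < 6" for i
      using bij_betw_inv_into_left[OF e, of i] bij_betw_apply[OF e, of i] that by auto
    fix \<phi> assume \<phi>: "\<phi> \<in> {\<phi> \<in> inj_tuples V. \<phi> ` {..<6} = X}"
    then have mem: "\<phi> i \<in> X" if "i < 6" for i using that by auto
    have inj: "inj_on \<phi> {..<6}" and ext: "\<phi> \<in> extensional {..<6}"
      using \<phi> by (auto simp: inj_tuples_def PiE_def)
    let ?j = "\<lambda>i\<in>{..<6}. inv_into {..<6} (enum6 X) (\<phi> i)"
    show "(\<lambda>i\<in>{..<6}. enum6 X (?j i)) = \<phi>"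
      using ext by (intro extensionalityI[of _ "{..<6}"]) (auto simp: ei mem)
    show "?j \<in> perms6"
    proof (rule perms6I)
      fix i k :: nat assume *: "i < 6" "k < 6" "inv_into {..<6} (enum6 X) (\<phi> i) = inv_into {..<6} (enum6 X) (\<phi> k)"
      then have "\<phi> i = \<phi> k" using ei(1) mem by metis
      then show "i = k" using inj * by (auto simp: inj_on_def)
    qed (use ei mem in blast)
    show "g (pull ?j (pull (enum6 X) A)) = g (pull \<phi> A)"
      by (rule cong) (simp add: ei mem)
  next
    have e: "bij_betw (enum6 X) {..<6} X" using enum6 X by blast
    have ie: "inv_into {..<6} (enum6 X) (enum6 X i) = i" "enum6 X i \<in> X" if "i < 6" for i
      using bij_betw_inv_into_left[OF e, of i] bij_betw_apply[OF e, of i] that by auto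
    fix \<pi> assume \<pi>: "\<pi> \<in> perms6"
    let ?i = "\<lambda>i\<in>{..<6}. enum6 X (\<pi> i)"
    show "(\<lambda>i\<in>{..<6}. inv_into {..<6} (enum6 X) (?i i)) = \<pi>"
      using \<pi> perms6_less[OF \<pi>]
      by (intro extensionalityI[of _ "{..<6}"]) (auto simp: ie perms6_def PiE_def)
    have b: "bij_betw (enum6 X \<circ> \<pi>) {..<6} X" using bij_betw_trans[OF perms6_bij[OF \<pi>] e] .
    have "?i ` {..<6} = X" using b by (auto simp: bij_betw_def image_comp)
    moreover have "inj_on ?i {..<6}" using b by (auto simp: bij_betw_def inj_on_def)
    moreover have "?i \<in> tuples V" using ie perms6_less[OF \<pi>] X by auto
    ultimately show "?i \<in> {\<phi> \<in> inj_tuples V. \<phi> ` {..<6} = X}" by (simp add: inj_tuples_def)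
  qed
  show ?thesis
    unfolding group[symmetric] by (rule sum.cong[OF refl]) (rule part, auto)
qed

lemma sum_of_bool_card: "finite S \<Longrightarrow> (\<Sum>x\<in>S. of_bool (P x) :: real) = real (card {x \<in> S. P x})"
  by (simp add: of_bool_def sum.If_cases Int_def)

lemma finite_sixes: "finite V \<Longrightarrow> finite {X. X \<subseteq> V \<and> card X = 6}"
  by simp

lemma ind_count_F4:
  assumes "simple_graph G"
  shows "12 * real (ind_count F4 G) = (\<Sum>\<phi>\<in>inj_tuples (verts G). of_bool (star (pull \<phi> (adj G)) 0 1 2 3 4 5))"
proof -
  have fin: "finite (verts G)" using assms by (simp add: simple_graph_def)
  have "(\<Sum>\<phi>\<in>inj_tuples (verts G). of_bool (star (pull \<phi> (adj G)) 0 1 2 3 4 5)) =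
      (\<Sum>X\<in>{X. X \<subseteq> verts G \<and> card X = 6}. \<Sum>\<pi>\<in>perms6. of_bool (star (pull \<pi> (pull (enum6 X) (adj G))) 0 1 2 3 4 5) :: real)"
    by (rule sum_inj_tuples[OF fin, where g = "\<lambda>b. of_bool (star b 0 1 2 3 4 5)"])
       (rule arg_cong[where f = of_bool], rule star_cong)
  also have "\<dots> = (\<Sum>X\<in>{X. X \<subseteq> verts G \<and> card X = 6}. 12 * of_bool (isomorphic (induced G X) F4))"
  proof (rule sum.cong[OF refl])
    fix X assume "X \<in> {X. X \<subseteq> verts G \<and> card X = 6}"
    then have e: "bij_betw (enum6 X) {..<6} X" using enum6 by blast
    have "pull (enum6 X) (adj G) i j = pull (enum6 X) (adj G) j i" "\<not> pull (enum6 X) (adj G) i i" for i j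
      using adj_commute adj_irrefl[OF assms] by auto
    then have "stars (pull (enum6 X) (adj G)) = 12 * of_bool (isomorphic (induced G X) F4)"
      using stars_eq[of "pull (enum6 X) (adj G)"] isomorphic_pull[OF e, of F4 G] by (simp add: on_first_def)
    then have "real_of_int (stars (pull (enum6 X) (adj G))) = 12 * of_bool (isomorphic (induced G X) F4)" by simp
    then show "(\<Sum>\<pi>\<in>perms6. of_bool (star (pull \<pi> (pull (enum6 X) (adj G))) 0 1 2 3 4 5)) = (12 * of_bool (isomorphic (induced G X) F4) :: real)"
      unfolding stars_def by simp
  qed
  also have "\<dots> = 12 * real (card {X \<in> {X. X \<subseteq> verts G \<and> card X = 6}. isomorphic (induced G X) F4})"
    unfolding sum_distrib_left[symmetric] sum_of_bool_card[OF finite_sixes[OF fin]] by (rule refl)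
  also have "{X \<in> {X. X \<subseteq> verts G \<and> card X = 6}. isomorphic (induced G X) F4} =
      {X. X \<subseteq> verts G \<and> card X = nverts F4 \<and> isomorphic (induced G X) F4}"
    by (auto simp: on_first_def)
  finally show ?thesis unfolding ind_count_def by (rule sym)
qed

section \<open>The flag algebra certificate\<close>

text \<open>
  Counting objects by isomorphism class and then summing over the classes visits each object once, as it is isomorphic to exactly
  one representative.
\<close>

lemma sum_representatives:
  fixes h :: "'a \<Rightarrow> real"
  assumes A: "finite A" "A \<subseteq> U"
    and refl: "\<And>x. x \<in> A \<Longrightarrow> R x x"
    and sym: "\<And>x y. x \<in> U \<Longrightarrow> y \<in> U \<Longrightarrow> R x y \<Longrightarrow> R y x"
    and trans: "\<And>x y z. x \<in> U \<Longrightarrow> y \<in> U \<Longrightarrow> z \<in> U \<Longrightarrow> R x y \<Longrightarrow> R y z \<Longrightarrow> R x z"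
    and X: "finite \<X>" "\<And>X. X \<in> \<X> \<Longrightarrow> obj X \<in> U" "\<And>X. X \<in> \<X> \<Longrightarrow> \<exists>a\<in>A. R (obj X) a"
    and h: "\<And>x y. x \<in> U \<Longrightarrow> y \<in> U \<Longrightarrow> R x y \<Longrightarrow> h x = h y"
  shows "(\<Sum>r\<in>representatives R A. real (card {X \<in> \<X>. R (obj X) r}) * h r) = (\<Sum>X\<in>\<X>. h (obj X))"
proof -
  define E where "E = {(x, y). x \<in> A \<and> y \<in> A \<and> R x y}"
  have E: "equiv A E"
  proof (rule equivI)
    show "refl_on A E" "sym E" "trans E" "E \<subseteq> A \<times> A"
      using refl sym trans A(2) unfolding E_def refl_on_def sym_def trans_def by blast+
  qed
  have rep_in: "(SOME x. x \<in> K) \<in> K" if K: "K \<in> A // E" for K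
    using in_quotient_imp_non_empty[OF E K] by (intro some_in_eq[THEN iffD2])
  have reps: "representatives R A \<subseteq> A"
    unfolding representatives_def E_def[symmetric]
    using rep_in in_quotient_imp_subset[OF E] by blast
  have fin: "finite (representatives R A)" using finite_subset[OF reps A(1)] .
  have unique: "r = r'" if r: "r \<in> representatives R A" "r' \<in> representatives R A" "R r r'" for r r'
  proof -
    obtain K K' where K: "K \<in> A // E" "r = (SOME x. x \<in> K)" "K' \<in> A // E" "r' = (SOME x. x \<in> K')"
      using r(1,2) unfolding representatives_def E_def[symmetric] by blast
    have "r \<in> K" "r' \<in> K'" using rep_in K by simp_all
    moreover have "(r, r') \<in> E" using r reps unfolding E_def by blast
    ultimately have "K = K'" using quotient_eqI[OF E K(1,3)] by blast
    then show ?thesis using K by simp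
  qed
  have ex: "\<exists>r\<in>representatives R A. R (obj X) r" if X': "X \<in> \<X>" for X
  proof -
    obtain a where a: "a \<in> A" "R (obj X) a" using X(3)[OF X'] by blast
    have K: "E `` {a} \<in> A // E" using quotientI[OF a(1)] .
    let ?r = "SOME x. x \<in> E `` {a}"
    have r: "?r \<in> E `` {a}" using rep_in[OF K] .
    have "?r \<in> representatives R A"
      unfolding representatives_def E_def[symmetric] using K by (rule imageI)
    moreover have "R (obj X) ?r"
    proof (rule trans[OF X(2)[OF X'] _ _ a(2)])
      show "a \<in> U" "?r \<in> U" "R a ?r" using r a(1) A(2) unfolding E_def by blast+
    qed
    ultimately show ?thesis by blast
  qed
  have one: "(\<Sum>r\<in>representatives R A. of_bool (R (obj X) r) * h r) = h (obj X)" if X': "X \<in> \<X>" for X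
  proof -
    obtain r where r: "r \<in> representatives R A" "R (obj X) r" using ex[OF X'] by blast
    have rU: "r \<in> U" using r(1) reps A(2) by blast
    have "of_bool (R (obj X) s) * h s = (if s = r then h r else 0)" if s: "s \<in> representatives R A" for s
    proof (cases "R (obj X) s")
      case True
      have sU: "s \<in> U" using s reps A(2) by blast
      have "R r s" using trans[OF rU X(2)[OF X'] sU sym[OF X(2)[OF X'] rU r(2)] True] .
      then show ?thesis using unique[OF r(1) s] True by simp
    next
      case False
      then show ?thesis using r(2) by auto
    qed
    then have "(\<Sum>s\<in>representatives R A. of_bool (R (obj X) s) * h s) = (\<Sum>s\<in>representatives R A. if s = r then h r else 0)"
      by (rule sum.cong[OF HOL.refl])
    also have "\<dots> = h r" using fin r(1) by simp
    also have "\<dots> = h (obj X)" using h[OF X(2)[OF X'] rU r(2)] by simp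
    finally show ?thesis .
  qed
  have "(\<Sum>r\<in>representatives R A. real (card {X \<in> \<X>. R (obj X) r}) * h r) =
      (\<Sum>r\<in>representatives R A. \<Sum>X\<in>\<X>. of_bool (R (obj X) r) * h r)"
  proof (rule sum.cong[OF HOL.refl])
    fix r
    have "real (card {X \<in> \<X>. R (obj X) r}) = (\<Sum>X\<in>\<X>. of_bool (R (obj X) r))"
      using X(1) by (simp add: of_bool_def sum.If_cases Int_def)
    then show "real (card {X \<in> \<X>. R (obj X) r}) * h r = (\<Sum>X\<in>\<X>. of_bool (R (obj X) r) * h r)"
      by (simp add: sum_distrib_right)
  qed
  also have "\<dots> = (\<Sum>X\<in>\<X>. \<Sum>r\<in>representatives R A. of_bool (R (obj X) r) * h r)" by (rule sum.swap)
  also have "\<dots> = (\<Sum>X\<in>\<X>. h (obj X))" by (rule sum.cong[OF HOL.refl]) (rule one)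
  finally show ?thesis .
qed

lemma representatives_subset:
  assumes "\<And>x. x \<in> A \<Longrightarrow> R x x"
  shows "representatives R A \<subseteq> A"
proof
  fix r assume "r \<in> representatives R A"
  then obtain K where K: "K \<in> A // {(x, y). x \<in> A \<and> y \<in> A \<and> R x y}" "r = (SOME x. x \<in> K)"
    unfolding representatives_def by blast
  obtain a where a: "a \<in> A" "K = {(x, y). x \<in> A \<and> y \<in> A \<and> R x y} `` {a}" using K(1) by (rule quotientE)
  have "a \<in> K" using a assms by simp
  then have "r \<in> K" unfolding K(2) by (rule someI)
  then show "r \<in> A" unfolding a(2) by simp
qed

definition transport :: "(nat \<Rightarrow> nat) \<Rightarrow> nat \<Rightarrow> pgraph \<Rightarrow> nat set \<Rightarrow> pgraph" where
  "transport h s G Y = ({..<s}, {{h x, h y} | x y. x \<in> Y \<and> y \<in> Y \<and> adj G x y})"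

lemma transport:
  assumes G: "simple_graph G" and h: "bij_betw h Y {..<s}"
  shows "simple_graph (transport h s G Y)" "isomorphism h (induced G Y) (transport h s G Y)"
    "x \<in> Y \<Longrightarrow> y \<in> Y \<Longrightarrow> adj (transport h s G Y) (h x) (h y) = adj G x y"
proof -
  have hY: "h x < s" if "x \<in> Y" for x using bij_betw_apply[OF h that] by simp
  have inj: "h x = h y \<longleftrightarrow> x = y" if "x \<in> Y" "y \<in> Y" for x y
    using h that by (auto simp: bij_betw_def inj_on_def)
  show adj: "adj (transport h s G Y) (h x) (h y) = adj G x y" if "x \<in> Y" "y \<in> Y" for x y
  proof
    assume "adj (transport h s G Y) (h x) (h y)"
    then obtain u v where uv: "u \<in> Y" "v \<in> Y" "adj G u v" "{h x, h y} = {h u, h v}"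
      unfolding adj_def transport_def by auto
    then have "x = u \<and> y = v \<or> x = v \<and> y = u" using inj that by (auto simp: doubleton_eq_iff)
    then show "adj G x y" using uv(3) adj_commute[of G] by auto
  next
    assume "adj G x y"
    then show "adj (transport h s G Y) (h x) (h y)" using that unfolding adj_def transport_def by auto
  qed
  show "isomorphism h (induced G Y) (transport h s G Y)"
    unfolding isomorphism_def using h adj by (simp add: transport_def adj_induced)
  show "simple_graph (transport h s G Y)"
    unfolding simple_graph_def
  proof (intro conjI ballI)
    fix e assume "e \<in> edges (transport h s G Y)"
    then obtain x y where xy: "x \<in> Y" "y \<in> Y" "adj G x y" "e = {h x, h y}" unfolding transport_def by auto
    have "x \<noteq> y" using xy(3) adj_irrefl[OF G] by auto
    then show "e \<subseteq> verts (transport h s G Y)" "card e = 2"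
      using xy hY inj by (auto simp: transport_def)
  qed (simp add: transport_def)
qed

lemma finite_graphs_on: "finite {G. simple_graph G \<and> verts G = {..<n}}"
proof (rule finite_subset)
  show "{G. simple_graph G \<and> verts G = {..<n}} \<subseteq> {{..<n}} \<times> Pow (Pow {..<n})"
    unfolding simple_graph_def by force
qed simp

lemma graphs_upto_iso_subset: "graphs_upto_iso n \<subseteq> {G. simple_graph G \<and> verts G = {..<n}}"
  unfolding graphs_upto_iso_def by (rule representatives_subset) (rule isomorphic_refl)

lemma card_to_bij: "finite Y \<Longrightarrow> card Y = s \<Longrightarrow> \<exists>h. bij_betw h Y {..<s}"
  using ex_bij_betw_finite_nat[of Y] by (auto simp: lessThan_atLeast0)

lemma sum_graphs_upto_iso:
  assumes G: "simple_graph G"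
    and h: "\<And>H H'. isomorphic H H' \<Longrightarrow> nverts H = n \<Longrightarrow> nverts H' = n \<Longrightarrow> h H = h H'"
  shows "(\<Sum>H\<in>graphs_upto_iso n. h H * real (ind_count H G)) = (\<Sum>X\<in>{X. X \<subseteq> verts G \<and> card X = n}. h (induced G X))"
proof -
  have fin: "finite (verts G)" using G by (simp add: simple_graph_def)
  let ?\<X> = "{X. X \<subseteq> verts G \<and> card X = n}"
  have "(\<Sum>H\<in>graphs_upto_iso n. h H * real (ind_count H G)) =
      (\<Sum>H\<in>graphs_upto_iso n. real (card {X \<in> ?\<X>. isomorphic (induced G X) H}) * h H)"
  proof (rule sum.cong[OF refl])
    fix H assume "H \<in> graphs_upto_iso n"
    then have N: "nverts H = n" using graphs_upto_iso_subset by fastforce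
    have "ind_count H G = card {X \<in> ?\<X>. isomorphic (induced G X) H}"
      unfolding ind_count_def N by (rule arg_cong[where f = card]) auto
    then show "h H * real (ind_count H G) = real (card {X \<in> ?\<X>. isomorphic (induced G X) H}) * h H" by simp
  qed
  also have "\<dots> = (\<Sum>X\<in>?\<X>. h (induced G X))"
    unfolding graphs_upto_iso_def
  proof (rule sum_representatives[where U = "{H. nverts H = n}"])
    show "finite {G. simple_graph G \<and> verts G = {..<n}}" by (rule finite_graphs_on)
    show "{G. simple_graph G \<and> verts G = {..<n}} \<subseteq> {H. nverts H = n}" by force
    show "finite ?\<X>" using fin by simp
    show "isomorphic H H" for H by (rule isomorphic_refl)
    show "isomorphic H' H" if "isomorphic H H'" for H H' using that by (rule isomorphic_sym)
    show "isomorphic H K" if "isomorphic H H'" "isomorphic H' K" for H H' K using that by (rule isomorphic_trans)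
    show "h H = h H'" if "H \<in> {H. nverts H = n}" "H' \<in> {H. nverts H = n}" "isomorphic H H'" for H H'
      using h[OF that(3)] that(1,2) by simp
    fix X assume X: "X \<in> ?\<X>"
    then show "induced G X \<in> {H. nverts H = n}" by simp
    have "finite X" using X fin finite_subset by blast
    then obtain k where k: "bij_betw k X {..<n}" using card_to_bij X by blast
    have "transport k n G X \<in> {G. simple_graph G \<and> verts G = {..<n}}"
      using transport(1)[OF G k] by (simp add: transport_def)
    moreover have "isomorphic (induced G X) (transport k n G X)"
      unfolding isomorphic_def using transport(2)[OF G k] by blast
    ultimately show "\<exists>a\<in>{G. simple_graph G \<and> verts G = {..<n}}. isomorphic (induced G X) a" by (rule bexI[rotated])
  qed
  finally show ?thesis .
qed

lemma adj_pulled_back_type: "i < q \<Longrightarrow> j < q \<Longrightarrow> adj (pulled_back_type q f G) i j = adj G (f i) (f j)"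
  unfolding pulled_back_type_def on_first_def adj_def by (auto simp: doubleton_eq_iff insert_commute)

lemma verts_pulled_back_type [simp]: "verts (pulled_back_type q f G) = {..<q}"
  by (simp add: pulled_back_type_def on_first_def)

definition proper_flag :: "pgraph \<Rightarrow> flag \<Rightarrow> bool" where
  "proper_flag \<sigma> \<Phi> \<longleftrightarrow> (\<forall>i\<in>verts \<sigma>. snd \<Phi> i \<in> verts (fst \<Phi>))"

lemma flag_iso_refl: "flag_iso \<sigma> \<Phi> \<Phi>"
  unfolding flag_iso_def isomorphism_def by (intro exI[of _ id]) auto

lemma flag_iso_sym:
  assumes "proper_flag \<sigma> \<Phi>" "flag_iso \<sigma> \<Phi> \<Psi>"
  shows "flag_iso \<sigma> \<Psi> \<Phi>"
proof -
  obtain h where h: "isomorphism h (fst \<Phi>) (fst \<Psi>)" "\<And>i. i \<in> verts \<sigma> \<Longrightarrow> h (snd \<Phi> i) = snd \<Psi> i"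
    using assms(2) unfolding flag_iso_def by blast
  have inj: "inj_on h (verts (fst \<Phi>))" using h(1) by (auto simp: isomorphism_def bij_betw_def)
  have "inv_into (verts (fst \<Phi>)) h (snd \<Psi> i) = snd \<Phi> i" if "i \<in> verts \<sigma>" for i
    using assms(1) that inj unfolding h(2)[OF that, symmetric] proper_flag_def by (auto intro: inv_into_f_f)
  then show ?thesis unfolding flag_iso_def using isomorphism_inverse[OF h(1)] by blast
qed

lemma flag_iso_trans: "flag_iso \<sigma> \<Phi> \<Psi> \<Longrightarrow> flag_iso \<sigma> \<Psi> \<Omega> \<Longrightarrow> flag_iso \<sigma> \<Phi> \<Omega>"
  unfolding flag_iso_def using isomorphism_compose by fastforce

lemma finite_flags_on: "finite {(M, \<theta>). simple_graph M \<and> verts M = {..<s} \<and> embedding \<theta> (pulled_back_type q f G) M}"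
proof (rule finite_subset)
  show "{(M, \<theta>). simple_graph M \<and> verts M = {..<s} \<and> embedding \<theta> (pulled_back_type q f G) M} \<subseteq>
      {M. simple_graph M \<and> verts M = {..<s}} \<times> ({..<q} \<rightarrow>\<^sub>E {..<s})"
    by (auto simp: embedding_def)
  show "finite ({M. simple_graph M \<and> verts M = {..<s}} \<times> ({..<q} \<rightarrow>\<^sub>E {..<s}))"
    using finite_graphs_on by (simp add: finite_PiE)
qed

lemma sum_flags:
  fixes u :: "flag \<Rightarrow> real"
  assumes G: "simple_graph G" and f: "f \<in> {..<q} \<rightarrow>\<^sub>E verts G" "inj_on f {..<q}" and s: "q \<le> s"
    and u: "\<And>\<Phi> \<Psi>. proper_flag (pulled_back_type q f G) \<Phi> \<Longrightarrow> proper_flag (pulled_back_type q f G) \<Psi> \<Longrightarrow>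
       flag_iso (pulled_back_type q f G) \<Phi> \<Psi> \<Longrightarrow> u \<Phi> = u \<Psi>"
  shows "(\<Sum>\<Phi>\<in>flags (pulled_back_type q f G) s. real (flag_count (pulled_back_type q f G) s G f \<Phi>) * u \<Phi>) =
    (\<Sum>X\<in>{X. X \<subseteq> verts G - f ` {..<q} \<and> card X = s - q}. u (induced G (X \<union> f ` {..<q}), f))"
proof -
  let ?\<sigma> = "pulled_back_type q f G" and ?\<X> = "{X. X \<subseteq> verts G - f ` {..<q} \<and> card X = s - q}"
  let ?obj = "\<lambda>X. (induced G (X \<union> f ` {..<q}), f)"
  have fin: "finite (verts G)" using G by (simp add: simple_graph_def)
  have "flag_count ?\<sigma> s G f \<Phi> = card {X \<in> ?\<X>. flag_iso ?\<sigma> (?obj X) \<Phi>}" for \<Phi>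
    unfolding flag_count_def by (intro arg_cong[where f = card]) auto
  then have "(\<Sum>\<Phi>\<in>flags ?\<sigma> s. real (flag_count ?\<sigma> s G f \<Phi>) * u \<Phi>) =
      (\<Sum>\<Phi>\<in>flags ?\<sigma> s. real (card {X \<in> ?\<X>. flag_iso ?\<sigma> (?obj X) \<Phi>}) * u \<Phi>)" by simp
  also have "\<dots> = (\<Sum>X\<in>?\<X>. u (?obj X))"
    unfolding flags_def
  proof (rule sum_representatives[where U = "Collect (proper_flag ?\<sigma>)"])
    fix X assume X: "X \<in> ?\<X>"
    let ?Y = "X \<union> f ` {..<q}"
    have finX: "finite X" using X fin by (auto intro: finite_subset)
    have "card ?Y = s"
      using X s f(2) finX by (subst card_Un_disjoint) (auto simp: card_image)
    then obtain k where k: "bij_betw k ?Y {..<s}" using card_to_bij[of ?Y s] finX by auto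
    let ?M = "transport k s G ?Y" and ?\<theta> = "\<lambda>i\<in>{..<q}. k (f i)"
    have "embedding ?\<theta> ?\<sigma> ?M"
      unfolding embedding_def
    proof (intro conjI ballI)
      show "?\<theta> \<in> verts ?\<sigma> \<rightarrow>\<^sub>E verts ?M" using bij_betw_apply[OF k] by (auto simp: transport_def)
      show "inj_on ?\<theta> (verts ?\<sigma>)"
        using k f(2) by (auto simp: bij_betw_def inj_on_def)
      fix i j assume "i \<in> verts ?\<sigma>" "j \<in> verts ?\<sigma>"
      then show "adj ?\<sigma> i j = adj ?M (?\<theta> i) (?\<theta> j)"
        using transport(3)[OF G k, of "f i" "f j"] by (simp add: adj_pulled_back_type)
    qed
    moreover have "flag_iso ?\<sigma> (?obj X) (?M, ?\<theta>)"
      unfolding flag_iso_def using transport(2)[OF G k] by auto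
    ultimately have "(?M, ?\<theta>) \<in> {(M, \<theta>). simple_graph M \<and> verts M = {..<s} \<and> embedding \<theta> ?\<sigma> M}"
      and "flag_iso ?\<sigma> (?obj X) (?M, ?\<theta>)"
      using transport(1)[OF G k] by (simp_all add: transport_def)
    then show "\<exists>a\<in>{(M, \<theta>). simple_graph M \<and> verts M = {..<s} \<and> embedding \<theta> ?\<sigma> M}. flag_iso ?\<sigma> (?obj X) a"
      by (rule bexI[rotated])
    show "?obj X \<in> Collect (proper_flag ?\<sigma>)" by (simp add: proper_flag_def)
  next
    show "finite {(M, \<theta>). simple_graph M \<and> verts M = {..<s} \<and> embedding \<theta> ?\<sigma> M}" by (rule finite_flags_on)
    show "flag_iso ?\<sigma> \<Phi> \<Phi>" for \<Phi> by (rule flag_iso_refl)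
    show "flag_iso ?\<sigma> \<Psi> \<Phi>" if "\<Phi> \<in> Collect (proper_flag ?\<sigma>)" "flag_iso ?\<sigma> \<Phi> \<Psi>" for \<Phi> \<Psi>
      using flag_iso_sym that by simp
    show "flag_iso ?\<sigma> \<Phi> \<Omega>" if "flag_iso ?\<sigma> \<Phi> \<Psi>" "flag_iso ?\<sigma> \<Psi> \<Omega>" for \<Phi> \<Psi> \<Omega>
      using that by (rule flag_iso_trans)
    show "u \<Phi> = u \<Psi>" if "\<Phi> \<in> Collect (proper_flag ?\<sigma>)" "\<Psi> \<in> Collect (proper_flag ?\<sigma>)" "flag_iso ?\<sigma> \<Phi> \<Psi>" for \<Phi> \<Psi>
      using u that by simp
    show "{(M, \<theta>). simple_graph M \<and> verts M = {..<s} \<and> embedding \<theta> ?\<sigma> M} \<subseteq> Collect (proper_flag ?\<sigma>)"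
      by (auto simp: embedding_def proper_flag_def)
    show "finite ?\<X>" using fin by simp
  qed
  finally show ?thesis .
qed

lemma sum_pairs:
  fixes p :: "nat \<Rightarrow> nat \<Rightarrow> real"
  assumes "finite W"
  shows "(\<Sum>X\<in>{X. X \<subseteq> W \<and> card X = 2}. \<Sum>x\<in>X. \<Sum>y\<in>X - {x}. p x y) = (\<Sum>x\<in>W. \<Sum>y\<in>W - {x}. p x y)"
proof -
  have "(\<Sum>x\<in>W. \<Sum>y\<in>W - {x}. p x y) = (\<Sum>z\<in>(SIGMA x:W. W - {x}). p (fst z) (snd z))"
    using assms by (subst sum.Sigma) (auto simp: case_prod_beta)
  also have "\<dots> = (\<Sum>X\<in>{X. X \<subseteq> W \<and> card X = 2}. \<Sum>z\<in>{z \<in> (SIGMA x:W. W - {x}). {fst z, snd z} = X}. p (fst z) (snd z))"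
    by (rule sum.group[symmetric]) (use assms in auto)
  also have "\<dots> = (\<Sum>X\<in>{X. X \<subseteq> W \<and> card X = 2}. \<Sum>z\<in>(SIGMA x:X. X - {x}). p (fst z) (snd z))"
  proof (rule sum.cong[OF refl])
    fix X assume X: "X \<in> {X. X \<subseteq> W \<and> card X = 2}"
    then obtain a b where ab: "X = {a, b}" "a \<noteq> b" by (auto simp: card_2_iff)
    have "{z \<in> (SIGMA x:W. W - {x}). {fst z, snd z} = X} = (SIGMA x:X. X - {x})"
      using X ab by (auto simp: doubleton_eq_iff)
    then show "(\<Sum>z\<in>{z \<in> (SIGMA x:W. W - {x}). {fst z, snd z} = X}. p (fst z) (snd z)) = (\<Sum>z\<in>(SIGMA x:X. X - {x}). p (fst z) (snd z))" by simp
  qed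
  also have "\<dots> = (\<Sum>X\<in>{X. X \<subseteq> W \<and> card X = 2}. \<Sum>x\<in>X. \<Sum>y\<in>X - {x}. p x y)"
  proof (rule sum.cong[OF refl])
    fix X assume "X \<in> {X. X \<subseteq> W \<and> card X = 2}"
    then have "finite X" using assms by (auto intro: finite_subset)
    then show "(\<Sum>z\<in>(SIGMA x:X. X - {x}). p (fst z) (snd z)) = (\<Sum>x\<in>X. \<Sum>y\<in>X - {x}. p x y)"
      by (subst sum.Sigma) (auto simp: case_prod_beta)
  qed
  finally show ?thesis by simp
qed

lemma sum_singletons:
  fixes p :: "nat \<Rightarrow> real"
  shows "(\<Sum>X\<in>{X. X \<subseteq> W \<and> card X = 1}. \<Sum>x\<in>X. p x) = (\<Sum>x\<in>W. p x)"
  by (rule sum.reindex_bij_witness[where i = "\<lambda>x. {x}" and j = the_elem]) (auto simp: card_1_singleton_iff One_nat_def)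

lemma bounded_finite_range:
  fixes g :: "'a::finite \<Rightarrow> int"
  shows "\<exists>M\<ge>0. \<forall>x. \<bar>g x\<bar> \<le> M"
proof (intro exI conjI allI)
  show "0 \<le> (\<Sum>x\<in>UNIV. \<bar>g x\<bar>)" by (intro sum_nonneg) simp
  show "\<bar>g x\<bar> \<le> (\<Sum>x\<in>UNIV. \<bar>g x\<bar>)" for x by (rule member_le_sum) simp_all
qed

lemma pair_term_bounded: "\<exists>M\<ge>0. \<forall>b i j x y z w. \<bar>pair_term b i j x y z w\<bar> \<le> M"
proof -
  define g :: "bool \<times> bool \<times> bool \<times> bool \<times> bool \<times> bool \<times> bool \<times> bool \<times> bool \<times> bool \<times> bool \<Rightarrow> int"
    where "g = (\<lambda>(e, p, q, r, s, t, p', q', r', s', t').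
      dot (pair_weights e) (if e then edge_flag p q r s t else nonedge_flag p q r s t)
        (if e then edge_flag p' q' r' s' t' else nonedge_flag p' q' r' s' t'))"
  obtain M where M: "M \<ge> 0" "\<And>x. \<bar>g x\<bar> \<le> M" using bounded_finite_range[of g] by blast
  have "pair_term b i j x y z w = g (b i j, b i x, b j x, b i y, b j y, b x y, b i z, b j z, b i w, b j w, b z w)"
    for b i j x y z w
    by (simp add: pair_term_def pair_form_def g_def)
  then show ?thesis using M by metis
qed

lemma cherry_term_bounded: "\<exists>M\<ge>0. \<forall>b i j k l x y. \<bar>cherry_term b i j k l x y\<bar> \<le> M"
proof -
  define g :: "bool \<times> bool \<times> bool \<times> bool \<times> bool \<times> bool \<times> bool \<times> bool \<times> bool \<Rightarrow> int"
    where "g = (\<lambda>(e, p, q, r, s, p', q', r', s').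
      if e then dot cherry_weights (cherry_flag p q r s) (cherry_flag p' q' r' s') else 0)"
  obtain M where M: "M \<ge> 0" "\<And>x. \<bar>g x\<bar> \<le> M" using bounded_finite_range[of g] by blast
  have "cherry_term b i j k l x y = g (cherry_type b i j k l, b i x, b j x, b k x, b l x, b i y, b j y, b k y, b l y)"
    for b i j k l x y
    by (simp add: cherry_term_def cherry_form_def g_def)
  then show ?thesis using M by metis
qed

lemma card_coincident:
  assumes "finite V" "i < 6" "j < 6" "i \<noteq> j"
  shows "card {\<phi> \<in> tuples V. \<phi> i = \<phi> j} \<le> card V ^ 5"
proof -
  let ?r = "\<lambda>\<phi>. restrict \<phi> ({..<6} - {j})"
  have "card {\<phi> \<in> tuples V. \<phi> i = \<phi> j} \<le> card (({..<6} - {j}) \<rightarrow>\<^sub>E V)"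
  proof (rule card_inj_on_le[of ?r])
    show "inj_on ?r {\<phi> \<in> tuples V. \<phi> i = \<phi> j}"
    proof (rule inj_onI)
      fix \<phi> \<psi> assume *: "\<phi> \<in> {\<phi> \<in> tuples V. \<phi> i = \<phi> j}" "\<psi> \<in> {\<phi> \<in> tuples V. \<phi> i = \<phi> j}" "?r \<phi> = ?r \<psi>"
      have eq: "\<phi> k = \<psi> k" if "k < 6" "k \<noteq> j" for k using fun_cong[OF *(3), of k] that by simp
      have "\<phi> j = \<psi> j" using eq[of i] assms * by auto
      then show "\<phi> = \<psi>" using * eq by (intro PiE_ext[of \<phi> "{..<6}" "\<lambda>_. V" \<psi>]) auto
    qed
    show "?r ` {\<phi> \<in> tuples V. \<phi> i = \<phi> j} \<subseteq> ({..<6} - {j}) \<rightarrow>\<^sub>E V"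
    proof (rule image_subsetI)
      fix \<phi> assume "\<phi> \<in> {\<phi> \<in> tuples V. \<phi> i = \<phi> j}"
      then have "\<phi> k \<in> V" if "k \<in> {..<6}" for k using that by (simp add: PiE_iff)
      then show "?r \<phi> \<in> ({..<6} - {j}) \<rightarrow>\<^sub>E V" by (simp add: restrict_PiE_iff)
    qed
    show "finite (({..<6} - {j}) \<rightarrow>\<^sub>E V)" using assms by (intro finite_PiE) auto
  qed
  also have "\<dots> = card V ^ 5" using assms by (simp add: card_PiE)
  finally show ?thesis .
qed

lemma card_noninjective:
  assumes "finite V"
  shows "card (tuples V - inj_tuples V) \<le> 36 * card V ^ 5"
proof -
  let ?I = "{(i, j). i < 6 \<and> j < (6::nat) \<and> i \<noteq> j}"
  have fin: "finite ?I" by (rule finite_subset[of _ "{..<6} \<times> {..<6}"]) auto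
  have cI: "card ?I \<le> 36"
    using card_mono[of "{..<6} \<times> {..<6::nat}" ?I] by auto
  have "tuples V - inj_tuples V \<subseteq> (\<Union>p\<in>?I. {\<phi> \<in> tuples V. \<phi> (fst p) = \<phi> (snd p)})"
    unfolding inj_tuples_def inj_on_def by auto
  then have "card (tuples V - inj_tuples V) \<le> card (\<Union>p\<in>?I. {\<phi> \<in> tuples V. \<phi> (fst p) = \<phi> (snd p)})"
    using assms fin finite_tuples by (intro card_mono) auto
  also have "\<dots> \<le> (\<Sum>p\<in>?I. card {\<phi> \<in> tuples V. \<phi> (fst p) = \<phi> (snd p)})"
    by (rule card_UN_le[OF fin])
  also have "\<dots> \<le> (\<Sum>p\<in>?I. card V ^ 5)"
    by (intro sum_mono) (use card_coincident[OF assms] in auto)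
  also have "\<dots> \<le> 36 * card V ^ 5" using cI by simp
  finally show ?thesis .
qed

text \<open>
  Sums over any set of tuples between the injective ones and all of them agree up to an error of lower order. This lets the
  flags with disjoint and with overlapping extensions be compared.
\<close>

lemma sum_between_tuples:
  fixes Z :: "(nat \<Rightarrow> nat) \<Rightarrow> real"
  assumes V: "finite V" and D: "inj_tuples V \<subseteq> D" "D \<subseteq> tuples V" and M: "\<And>\<phi>. \<bar>Z \<phi>\<bar> \<le> M"
  shows "\<bar>(\<Sum>\<phi>\<in>D. Z \<phi>) - (\<Sum>\<phi>\<in>inj_tuples V. Z \<phi>)\<bar> \<le> 36 * M * real (card V) ^ 5"
proof -
  have fin: "finite D" "finite (tuples V)" using finite_tuples[OF V] D(2) finite_subset by auto
  have M0: "0 \<le> M" using M[of undefined] by linarith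
  have "(\<Sum>\<phi>\<in>D. Z \<phi>) - (\<Sum>\<phi>\<in>inj_tuples V. Z \<phi>) = (\<Sum>\<phi>\<in>D - inj_tuples V. Z \<phi>)"
    using sum_diff[OF fin(1) D(1), of Z] by simp
  also have "\<bar>\<dots>\<bar> \<le> (\<Sum>\<phi>\<in>D - inj_tuples V. \<bar>Z \<phi>\<bar>)" by (rule sum_abs)
  also have "\<dots> \<le> real (card (D - inj_tuples V)) * M" by (rule sum_bounded_above) (rule M)
  also have "\<dots> \<le> real (36 * card V ^ 5) * M"
  proof (intro mult_right_mono M0 of_nat_mono)
    have "card (D - inj_tuples V) \<le> card (tuples V - inj_tuples V)" using fin D by (intro card_mono) auto
    then show "card (D - inj_tuples V) \<le> 36 * card V ^ 5" using card_noninjective[OF V] by linarith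
  qed
  finally show ?thesis by (simp add: mult_ac)
qed

text \<open>
  The value of a form on the flag with two further vertices in no particular order: the average over both orders.
\<close>

definition pair_flag_value :: "nat \<Rightarrow> flag \<Rightarrow> real" where
  "pair_flag_value k \<Phi> = (\<Sum>x\<in>verts (fst \<Phi>) - snd \<Phi> ` {..<2}. \<Sum>y\<in>verts (fst \<Phi>) - snd \<Phi> ` {..<2} - {x}.
     real_of_int (pair_form (adj (fst \<Phi>)) (snd \<Phi> 0) (snd \<Phi> 1) x y ! k)) / 2"

definition cherry_flag_value :: "nat \<Rightarrow> flag \<Rightarrow> real" where
  "cherry_flag_value k \<Phi> = (\<Sum>x\<in>verts (fst \<Phi>) - snd \<Phi> ` {..<4}.
     real_of_int (cherry_form (adj (fst \<Phi>)) (snd \<Phi> 0) (snd \<Phi> 1) (snd \<Phi> 2) (snd \<Phi> 3) x ! k))"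

text \<open>
  The Gram matrices of the forms. The denominators undo the scaling of the integer forms; the types not used by the certificate
  get the zero matrix.
\<close>

definition F4_matrix :: "pgraph \<Rightarrow> flag \<Rightarrow> flag \<Rightarrow> real" where
  "F4_matrix \<sigma> \<Phi> \<Psi> =
     (if verts \<sigma> = {..<2} then
        \<Sum>k<length (pair_weights (adj \<sigma> 0 1)). real_of_int (pair_weights (adj \<sigma> 0 1) ! k) / 419904 *
          pair_flag_value k \<Phi> * pair_flag_value k \<Psi>
      else if cherry_type (adj \<sigma>) 0 1 2 3 then
        \<Sum>k<length cherry_weights. real_of_int (cherry_weights ! k) / 419904 *
          cherry_flag_value k \<Phi> * cherry_flag_value k \<Psi>
      else 0)"

definition F4_slack :: "pgraph \<Rightarrow> real" where
  "F4_slack H = real_of_int (slack (adj H)) / 1679616"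

lemma quad_form_squares:
  "quad_form I (\<lambda>i j. \<Sum>k\<in>K. d k * u k i * u k j) v = (\<Sum>k\<in>K. d k * (\<Sum>i\<in>I. v i * u k i)\<^sup>2)"
proof -
  have "quad_form I (\<lambda>i j. \<Sum>k\<in>K. d k * u k i * u k j) v =
      (\<Sum>i\<in>I. \<Sum>j\<in>I. \<Sum>k\<in>K. d k * ((v i * u k i) * (v j * u k j)))"
    unfolding quad_form_def by (intro sum.cong refl) (simp add: sum_distrib_left sum_distrib_right mult_ac)
  also have "\<dots> = (\<Sum>i\<in>I. \<Sum>k\<in>K. \<Sum>j\<in>I. d k * ((v i * u k i) * (v j * u k j)))"
    by (intro sum.cong refl sum.swap)
  also have "\<dots> = (\<Sum>k\<in>K. \<Sum>i\<in>I. \<Sum>j\<in>I. d k * ((v i * u k i) * (v j * u k j)))"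
    by (rule sum.swap)
  also have "\<dots> = (\<Sum>k\<in>K. d k * (\<Sum>i\<in>I. v i * u k i)\<^sup>2)"
    unfolding power2_eq_square sum_product by (simp only: sum_distrib_left)
  finally show ?thesis .
qed

lemma F4_matrix_psd: "pos_semidef I (F4_matrix \<sigma>)"
proof -
  have w: "0 \<le> pair_weights e ! k" if "k < length (pair_weights e)" for e k
    using weights_nonneg(1)[OF nth_mem[OF that]] .
  have c: "0 \<le> cherry_weights ! k" if "k < length cherry_weights" for k
    using weights_nonneg(2)[OF nth_mem[OF that]] .
  have "F4_matrix \<sigma> \<Phi> \<Psi> = F4_matrix \<sigma> \<Psi> \<Phi>" for \<Phi> \<Psi>
    unfolding F4_matrix_def by (simp add: mult_ac)
  moreover have "0 \<le> quad_form I (F4_matrix \<sigma>) v" for v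
  proof -
    consider "verts \<sigma> = {..<2}" | "verts \<sigma> \<noteq> {..<2}" "cherry_type (adj \<sigma>) 0 1 2 3" | "verts \<sigma> \<noteq> {..<2}" "\<not> cherry_type (adj \<sigma>) 0 1 2 3"
      by blast
    then show ?thesis
    proof cases
      case 1
      then have "F4_matrix \<sigma> = (\<lambda>\<Phi> \<Psi>. \<Sum>k<length (pair_weights (adj \<sigma> 0 1)). real_of_int (pair_weights (adj \<sigma> 0 1) ! k) / 419904 *
          pair_flag_value k \<Phi> * pair_flag_value k \<Psi>)"
        unfolding F4_matrix_def by simp
      then show ?thesis
        by (simp only: quad_form_squares) (intro sum_nonneg mult_nonneg_nonneg; simp add: w)
    next
      case 2
      then have "F4_matrix \<sigma> = (\<lambda>\<Phi> \<Psi>. \<Sum>k<length cherry_weights. real_of_int (cherry_weights ! k) / 419904 *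
          cherry_flag_value k \<Phi> * cherry_flag_value k \<Psi>)"
        unfolding F4_matrix_def by simp
      then show ?thesis
        by (simp only: quad_form_squares) (intro sum_nonneg mult_nonneg_nonneg; simp add: c)
    next
      case 3
      then have "F4_matrix \<sigma> = (\<lambda>\<Phi> \<Psi>. 0)"
        unfolding F4_matrix_def by simp
      then show ?thesis by (simp add: quad_form_def)
    qed
  qed
  ultimately show ?thesis unfolding pos_semidef_def by blast
qed

lemma pair_flag_value_iso:
  assumes "{..<2} \<subseteq> verts \<sigma>" "proper_flag \<sigma> \<Phi>" "flag_iso \<sigma> \<Phi> \<Psi>"
  shows "pair_flag_value k \<Phi> = pair_flag_value k \<Psi>"
proof -
  obtain h where h: "isomorphism h (fst \<Phi>) (fst \<Psi>)" "\<And>i. i \<in> verts \<sigma> \<Longrightarrow> h (snd \<Phi> i) = snd \<Psi> i"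
    using assms(3) unfolding flag_iso_def by blast
  let ?R = "verts (fst \<Phi>) - snd \<Phi> ` {..<2}" and ?R' = "verts (fst \<Psi>) - snd \<Psi> ` {..<2}"
  have b: "bij_betw h (verts (fst \<Phi>)) (verts (fst \<Psi>))"
    and adj: "\<And>x y. x \<in> verts (fst \<Phi>) \<Longrightarrow> y \<in> verts (fst \<Phi>) \<Longrightarrow> adj (fst \<Phi>) x y = adj (fst \<Psi>) (h x) (h y)"
    using h(1) unfolding isomorphism_def by auto
  have root: "snd \<Phi> i \<in> verts (fst \<Phi>)" "h (snd \<Phi> i) = snd \<Psi> i" if "i < 2" for i
    using assms(1,2) h(2) that unfolding proper_flag_def by auto
  have "h ` (snd \<Phi> ` {..<2}) = snd \<Psi> ` {..<2}" using root(2) by force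
  then have "bij_betw h (snd \<Phi> ` {..<2}) (snd \<Psi> ` {..<2})"
    using b root(1) by (auto simp: bij_betw_def intro: inj_on_subset)
  moreover have "snd \<Phi> ` {..<2} \<subseteq> verts (fst \<Phi>)" using root(1) by auto
  moreover have "snd \<Psi> ` {..<2} \<subseteq> verts (fst \<Psi>)"
    using bij_betw_apply[OF b root(1)] root(2) by force
  ultimately have R: "bij_betw h ?R ?R'" using b by (intro bij_betw_DiffI)
  have F: "pair_form (adj (fst \<Psi>)) (snd \<Psi> 0) (snd \<Psi> 1) (h x) (h y) = pair_form (adj (fst \<Phi>)) (snd \<Phi> 0) (snd \<Phi> 1) x y"
    if "x \<in> ?R" "y \<in> ?R" for x y
    using that root[of 0] root[of 1] adj unfolding pair_form_def by (simp flip: root(2))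
  have "(\<Sum>x\<in>?R'. \<Sum>y\<in>?R' - {x}. real_of_int (pair_form (adj (fst \<Psi>)) (snd \<Psi> 0) (snd \<Psi> 1) x y ! k)) =
      (\<Sum>x\<in>?R. \<Sum>y\<in>?R' - {h x}. real_of_int (pair_form (adj (fst \<Psi>)) (snd \<Psi> 0) (snd \<Psi> 1) (h x) y ! k))"
    by (rule sum.reindex_bij_betw[OF R, symmetric])
  also have "\<dots> = (\<Sum>x\<in>?R. \<Sum>y\<in>?R - {x}. real_of_int (pair_form (adj (fst \<Phi>)) (snd \<Phi> 0) (snd \<Phi> 1) x y ! k))"
  proof (rule sum.cong[OF refl])
    fix x assume x: "x \<in> ?R"
    have "bij_betw h (?R - {x}) (?R' - {h x})"
    proof (rule bij_betw_DiffI[OF R])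
      show "bij_betw h {x} {h x}" by (simp add: bij_betw_def)
      show "{x} \<subseteq> ?R" using x by blast
      show "{h x} \<subseteq> ?R'" using bij_betw_apply[OF R x] unfolding insert_subset by (intro conjI empty_subsetI)
    qed
    then have "(\<Sum>y\<in>?R' - {h x}. real_of_int (pair_form (adj (fst \<Psi>)) (snd \<Psi> 0) (snd \<Psi> 1) (h x) y ! k)) =
      (\<Sum>y\<in>?R - {x}. real_of_int (pair_form (adj (fst \<Psi>)) (snd \<Psi> 0) (snd \<Psi> 1) (h x) (h y) ! k))"
      by (rule sum.reindex_bij_betw[symmetric])
    also have "\<dots> = (\<Sum>y\<in>?R - {x}. real_of_int (pair_form (adj (fst \<Phi>)) (snd \<Phi> 0) (snd \<Phi> 1) x y ! k))"
      by (rule sum.cong[OF refl]) (use x in \<open>simp add: F\<close>)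
    finally show "(\<Sum>y\<in>?R' - {h x}. real_of_int (pair_form (adj (fst \<Psi>)) (snd \<Psi> 0) (snd \<Psi> 1) (h x) y ! k)) =
      (\<Sum>y\<in>?R - {x}. real_of_int (pair_form (adj (fst \<Phi>)) (snd \<Phi> 0) (snd \<Phi> 1) x y ! k))" .
  qed
  finally show ?thesis unfolding pair_flag_value_def by simp
qed

lemma cherry_flag_value_iso:
  assumes "{..<4} \<subseteq> verts \<sigma>" "proper_flag \<sigma> \<Phi>" "flag_iso \<sigma> \<Phi> \<Psi>"
  shows "cherry_flag_value k \<Phi> = cherry_flag_value k \<Psi>"
proof -
  obtain h where h: "isomorphism h (fst \<Phi>) (fst \<Psi>)" "\<And>i. i \<in> verts \<sigma> \<Longrightarrow> h (snd \<Phi> i) = snd \<Psi> i"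
    using assms(3) unfolding flag_iso_def by blast
  let ?R = "verts (fst \<Phi>) - snd \<Phi> ` {..<4}" and ?R' = "verts (fst \<Psi>) - snd \<Psi> ` {..<4}"
  have b: "bij_betw h (verts (fst \<Phi>)) (verts (fst \<Psi>))"
    and adj: "\<And>x y. x \<in> verts (fst \<Phi>) \<Longrightarrow> y \<in> verts (fst \<Phi>) \<Longrightarrow> adj (fst \<Phi>) x y = adj (fst \<Psi>) (h x) (h y)"
    using h(1) unfolding isomorphism_def by auto
  have root: "snd \<Phi> i \<in> verts (fst \<Phi>)" "h (snd \<Phi> i) = snd \<Psi> i" if "i < 4" for i
    using assms(1,2) h(2) that unfolding proper_flag_def by auto
  have "h ` (snd \<Phi> ` {..<4}) = snd \<Psi> ` {..<4}" using root(2) by force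
  then have "bij_betw h (snd \<Phi> ` {..<4}) (snd \<Psi> ` {..<4})"
    using b root(1) by (auto simp: bij_betw_def intro: inj_on_subset)
  moreover have "snd \<Phi> ` {..<4} \<subseteq> verts (fst \<Phi>)" using root(1) by auto
  moreover have "snd \<Psi> ` {..<4} \<subseteq> verts (fst \<Psi>)"
    using bij_betw_apply[OF b root(1)] root(2) by force
  ultimately have R: "bij_betw h ?R ?R'" using b by (intro bij_betw_DiffI)
  have F: "cherry_form (adj (fst \<Psi>)) (snd \<Psi> 0) (snd \<Psi> 1) (snd \<Psi> 2) (snd \<Psi> 3) (h x) =
      cherry_form (adj (fst \<Phi>)) (snd \<Phi> 0) (snd \<Phi> 1) (snd \<Phi> 2) (snd \<Phi> 3) x"
    if "x \<in> ?R" for x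
    using that root[of 0] root[of 1] root[of 2] root[of 3] adj unfolding cherry_form_def by (simp flip: root(2))
  have "(\<Sum>x\<in>?R'. real_of_int (cherry_form (adj (fst \<Psi>)) (snd \<Psi> 0) (snd \<Psi> 1) (snd \<Psi> 2) (snd \<Psi> 3) x ! k)) =
      (\<Sum>x\<in>?R. real_of_int (cherry_form (adj (fst \<Psi>)) (snd \<Psi> 0) (snd \<Psi> 1) (snd \<Psi> 2) (snd \<Psi> 3) (h x) ! k))"
    by (rule sum.reindex_bij_betw[OF R, symmetric])
  also have "\<dots> = (\<Sum>x\<in>?R. real_of_int (cherry_form (adj (fst \<Phi>)) (snd \<Phi> 0) (snd \<Phi> 1) (snd \<Phi> 2) (snd \<Phi> 3) x ! k))"
    by (rule sum.cong[OF refl]) (simp add: F)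
  finally show ?thesis unfolding cherry_flag_value_def by simp
qed

lemma pair_form_induced:
  "{i, j, x, y} \<subseteq> Y \<Longrightarrow> pair_form (adj (induced G Y)) i j x y = pair_form (adj G) i j x y"
  unfolding pair_form_def by (simp add: adj_induced)

lemma cherry_form_induced:
  "{i, j, k, l, x} \<subseteq> Y \<Longrightarrow> cherry_form (adj (induced G Y)) i j k l x = cherry_form (adj G) i j k l x"
  unfolding cherry_form_def by (simp add: adj_induced)

lemma pair_quad_form:
  assumes G: "simple_graph G" and f: "f \<in> {..<2} \<rightarrow>\<^sub>E verts G" "inj_on f {..<2}"
  defines "\<sigma> \<equiv> pulled_back_type 2 f G" and "W \<equiv> verts G - f ` {..<2}"
  shows "quad_form (flags \<sigma> 4) (F4_matrix \<sigma>) (\<lambda>\<Phi>. real (flag_count \<sigma> 4 G f \<Phi>)) =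
    (\<Sum>p\<in>(SIGMA x:W. W - {x}). \<Sum>q\<in>(SIGMA x:W. W - {x}).
      real_of_int (pair_term (adj G) (f 0) (f 1) (fst p) (snd p) (fst q) (snd q))) / 1679616"
proof -
  have fin: "finite W" using G by (simp add: simple_graph_def W_def)
  have e: "adj \<sigma> 0 1 = adj G (f 0) (f 1)" unfolding \<sigma>_def by (simp add: adj_pulled_back_type)
  let ?w = "pair_weights (adj G (f 0) (f 1))"
  let ?u = "\<lambda>p. pair_form (adj G) (f 0) (f 1) (fst p) (snd p)"
  let ?P = "SIGMA x:W. W - {x}"
  have S: "(\<Sum>\<Phi>\<in>flags \<sigma> 4. real (flag_count \<sigma> 4 G f \<Phi>) * pair_flag_value k \<Phi>) =
      (\<Sum>p\<in>?P. real_of_int (?u p ! k)) / 2" for k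
  proof -
    have "(\<Sum>\<Phi>\<in>flags \<sigma> 4. real (flag_count \<sigma> 4 G f \<Phi>) * pair_flag_value k \<Phi>) =
        (\<Sum>X\<in>{X. X \<subseteq> W \<and> card X = 2}. pair_flag_value k (induced G (X \<union> f ` {..<2}), f))"
      using sum_flags[OF G f, of 4 "pair_flag_value k"] pair_flag_value_iso[of "pulled_back_type 2 f G" _ _ k]
      unfolding \<sigma>_def W_def by simp
    also have "\<dots> = (\<Sum>X\<in>{X. X \<subseteq> W \<and> card X = 2}. \<Sum>x\<in>X. \<Sum>y\<in>X - {x}.
        real_of_int (pair_form (adj G) (f 0) (f 1) x y ! k) / 2)"
    proof (rule sum.cong[OF refl])
      fix X assume X: "X \<in> {X. X \<subseteq> W \<and> card X = 2}"
      then have d: "X \<union> f ` {..<2} - f ` {..<2} = X" unfolding W_def by auto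
      show "pair_flag_value k (induced G (X \<union> f ` {..<2}), f) =
          (\<Sum>x\<in>X. \<Sum>y\<in>X - {x}. real_of_int (pair_form (adj G) (f 0) (f 1) x y ! k) / 2)"
        unfolding pair_flag_value_def fst_conv snd_conv verts_induced d sum_divide_distrib
        by (intro sum.cong refl) (simp add: pair_form_induced)
    qed
    also have "\<dots> = (\<Sum>x\<in>W. \<Sum>y\<in>W - {x}. real_of_int (pair_form (adj G) (f 0) (f 1) x y ! k) / 2)"
      by (rule sum_pairs[OF fin])
    also have "\<dots> = (\<Sum>p\<in>?P. real_of_int (?u p ! k)) / 2"
      using fin by (subst sum.Sigma) (auto simp: case_prod_beta sum_divide_distrib)
    finally show ?thesis .
  qed
  have "F4_matrix \<sigma> = (\<lambda>\<Phi> \<Psi>. \<Sum>k<length ?w. real_of_int (?w ! k) / 419904 * pair_flag_value k \<Phi> * pair_flag_value k \<Psi>)"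
    unfolding F4_matrix_def e by (simp add: \<sigma>_def)
  then have "quad_form (flags \<sigma> 4) (F4_matrix \<sigma>) (\<lambda>\<Phi>. real (flag_count \<sigma> 4 G f \<Phi>)) =
      (\<Sum>k<length ?w. real_of_int (?w ! k) / 419904 * ((\<Sum>p\<in>?P. real_of_int (?u p ! k)) / 2)\<^sup>2)"
    by (simp only: quad_form_squares S)
  also have "\<dots> = (\<Sum>k<length ?w. real_of_int (?w ! k) * (\<Sum>p\<in>?P. 1 * real_of_int (?u p ! k))\<^sup>2) / 1679616"
    unfolding sum_divide_distrib[where A = "{..<length ?w}"] by (intro sum.cong refl) (simp add: power_divide)
  also have "\<dots> = (\<Sum>p\<in>?P. \<Sum>q\<in>?P. 1 * 1 * real_of_int (dot ?w (?u p) (?u q))) / 1679616"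
    by (subst sum_dot_squares) (simp_all add: length_pair_form)
  finally show ?thesis by (simp add: pair_term_def)
qed

lemma cherry_quad_form:
  assumes G: "simple_graph G" and f: "f \<in> {..<4} \<rightarrow>\<^sub>E verts G" "inj_on f {..<4}"
  defines "\<sigma> \<equiv> pulled_back_type 4 f G" and "W \<equiv> verts G - f ` {..<4}"
  shows "quad_form (flags \<sigma> 5) (F4_matrix \<sigma>) (\<lambda>\<Phi>. real (flag_count \<sigma> 5 G f \<Phi>)) =
    (\<Sum>x\<in>W. \<Sum>y\<in>W. 4 * real_of_int (cherry_term (adj G) (f 0) (f 1) (f 2) (f 3) x y)) / 1679616"
proof -
  have e: "cherry_type (adj \<sigma>) 0 1 2 3 = cherry_type (adj G) (f 0) (f 1) (f 2) (f 3)"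
    unfolding \<sigma>_def cherry_type_def by (simp add: adj_pulled_back_type)
  have ne: "verts \<sigma> \<noteq> {..<2}" unfolding \<sigma>_def by (simp add: lessThan_eq_iff)
  show ?thesis
  proof (cases "cherry_type (adj G) (f 0) (f 1) (f 2) (f 3)")
    case False
    then have "F4_matrix \<sigma> = (\<lambda>\<Phi> \<Psi>. 0)" unfolding F4_matrix_def e using ne by simp
    then show ?thesis using False by (simp add: quad_form_def cherry_term_def)
  next
    case True
    let ?w = "cherry_weights"
    let ?u = "cherry_form (adj G) (f 0) (f 1) (f 2) (f 3)"
    have S: "(\<Sum>\<Phi>\<in>flags \<sigma> 5. real (flag_count \<sigma> 5 G f \<Phi>) * cherry_flag_value k \<Phi>) =
        (\<Sum>x\<in>W. real_of_int (?u x ! k))" for k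
    proof -
      have "(\<Sum>\<Phi>\<in>flags \<sigma> 5. real (flag_count \<sigma> 5 G f \<Phi>) * cherry_flag_value k \<Phi>) =
          (\<Sum>X\<in>{X. X \<subseteq> W \<and> card X = 1}. cherry_flag_value k (induced G (X \<union> f ` {..<4}), f))"
        using sum_flags[OF G f, of 5 "cherry_flag_value k"] cherry_flag_value_iso[of "pulled_back_type 4 f G" _ _ k]
        unfolding \<sigma>_def W_def by (simp add: One_nat_def)
      also have "\<dots> = (\<Sum>X\<in>{X. X \<subseteq> W \<and> card X = 1}. \<Sum>x\<in>X. real_of_int (?u x ! k))"
      proof (rule sum.cong[OF refl])
        fix X assume X: "X \<in> {X. X \<subseteq> W \<and> card X = 1}"
        then have d: "X \<union> f ` {..<4} - f ` {..<4} = X" unfolding W_def by auto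
        show "cherry_flag_value k (induced G (X \<union> f ` {..<4}), f) = (\<Sum>x\<in>X. real_of_int (?u x ! k))"
          unfolding cherry_flag_value_def fst_conv snd_conv verts_induced d
          by (intro sum.cong refl) (simp add: cherry_form_induced)
      qed
      also have "\<dots> = (\<Sum>x\<in>W. real_of_int (?u x ! k))" by (rule sum_singletons)
      finally show ?thesis .
    qed
    have "F4_matrix \<sigma> = (\<lambda>\<Phi> \<Psi>. \<Sum>k<length ?w. real_of_int (?w ! k) / 419904 * cherry_flag_value k \<Phi> * cherry_flag_value k \<Psi>)"
      unfolding F4_matrix_def e using ne True by simp
    then have "quad_form (flags \<sigma> 5) (F4_matrix \<sigma>) (\<lambda>\<Phi>. real (flag_count \<sigma> 5 G f \<Phi>)) =
        (\<Sum>k<length ?w. real_of_int (?w ! k) / 419904 * (\<Sum>x\<in>W. real_of_int (?u x ! k))\<^sup>2)"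
      by (simp only: quad_form_squares S)
    also have "\<dots> = (\<Sum>k<length ?w. real_of_int (?w ! k) * (\<Sum>x\<in>W. 1 * real_of_int (?u x ! k))\<^sup>2) / 419904"
      unfolding sum_divide_distrib by (intro sum.cong refl) simp
    also have "\<dots> = (\<Sum>x\<in>W. \<Sum>y\<in>W. 1 * 1 * real_of_int (dot ?w (?u x) (?u y))) / 419904"
      by (subst sum_dot_squares) (simp_all add: length_cherry_form)
    finally show ?thesis using True by (simp add: cherry_term_def sum_distrib_left[symmetric])
  qed
qed

definition pair_domain :: "nat set \<Rightarrow> (nat \<Rightarrow> nat) set" where
  "pair_domain V = {\<phi> \<in> tuples V. \<phi> 0 \<noteq> \<phi> 1 \<and> \<phi> 2 \<notin> {\<phi> 0, \<phi> 1} \<and> \<phi> 3 \<notin> {\<phi> 0, \<phi> 1} \<and> \<phi> 2 \<noteq> \<phi> 3 \<and>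
     \<phi> 4 \<notin> {\<phi> 0, \<phi> 1} \<and> \<phi> 5 \<notin> {\<phi> 0, \<phi> 1} \<and> \<phi> 4 \<noteq> \<phi> 5}"

definition cherry_domain :: "nat set \<Rightarrow> (nat \<Rightarrow> nat) set" where
  "cherry_domain V = {\<phi> \<in> tuples V. inj_on \<phi> {..<4} \<and> \<phi> 4 \<notin> \<phi> ` {..<4} \<and> \<phi> 5 \<notin> \<phi> ` {..<4}}"

lemma inj_tuples_eq: "\<phi> \<in> inj_tuples V \<Longrightarrow> i < 6 \<Longrightarrow> j < 6 \<Longrightarrow> \<phi> i = \<phi> j \<longleftrightarrow> i = j"
  unfolding inj_tuples_def by (auto simp: inj_on_def)

lemma inj_tuples_domains: "inj_tuples V \<subseteq> pair_domain V" "inj_tuples V \<subseteq> cherry_domain V"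
proof -
  show "inj_tuples V \<subseteq> pair_domain V"
  proof
    fix \<phi> assume \<phi>: "\<phi> \<in> inj_tuples V"
    then have "\<phi> \<in> tuples V" by (simp add: inj_tuples_def)
    then show "\<phi> \<in> pair_domain V" unfolding pair_domain_def by (simp add: inj_tuples_eq[OF \<phi>])
  qed
  show "inj_tuples V \<subseteq> cherry_domain V"
  proof
    fix \<phi> assume \<phi>: "\<phi> \<in> inj_tuples V"
    then have "\<phi> \<in> tuples V" "inj_on \<phi> {..<6}" by (simp_all add: inj_tuples_def)
    moreover have "inj_on \<phi> {..<4}" by (rule inj_on_subset[OF calculation(2)]) auto
    moreover have "\<phi> 4 \<noteq> \<phi> i" "\<phi> 5 \<noteq> \<phi> i" if "i < 4" for i
      using inj_tuples_eq[OF \<phi>, of 4 i] inj_tuples_eq[OF \<phi>, of 5 i] that by simp_all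
    ultimately show "\<phi> \<in> cherry_domain V" unfolding cherry_domain_def by auto
  qed
qed

lemma tuple_ext:
  assumes "\<phi> \<in> extensional {..<6}"
  shows "(\<lambda>k\<in>{..<6}. [\<phi> 0, \<phi> 1, \<phi> 2, \<phi> 3, \<phi> 4, \<phi> 5] ! k) = \<phi>"
proof
  fix x
  show "(\<lambda>k\<in>{..<6}. [\<phi> 0, \<phi> 1, \<phi> 2, \<phi> 3, \<phi> 4, \<phi> 5] ! k) x = \<phi> x"
  proof (cases "x < 6")
    case True
    then consider "x = 0" | "x = 1" | "x = 2" | "x = 3" | "x = 4" | "x = 5" by linarith
    then show ?thesis by cases simp_all
  next
    case False
    then show ?thesis using assms by (simp add: extensional_def)
  qed
qed

lemma tuple_mem:
  assumes "set [a, b, c, d, e, f] \<subseteq> V"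
  shows "(\<lambda>k\<in>{..<6}. [a, b, c, d, e, f] ! k) \<in> tuples V"
proof -
  have "[a, b, c, d, e, f] ! k \<in> V" if "k < 6" for k
    by (rule subsetD[OF assms nth_mem]) (use that in simp)
  then show ?thesis by simp
qed

lemma lessThan2: "{..<2::nat} = {0, 1}" by auto

lemma lessThan4: "{..<4::nat} = {0, 1, 2, 3}" by auto

lemma sum_pair_domain:
  fixes t :: "nat \<Rightarrow> nat \<Rightarrow> nat \<Rightarrow> nat \<Rightarrow> nat \<Rightarrow> nat \<Rightarrow> real"
  assumes V: "finite V"
  shows "(\<Sum>f\<in>{f \<in> {..<2::nat} \<rightarrow>\<^sub>E V. inj_on f {..<2}}.
      \<Sum>p\<in>(SIGMA x:V - f ` {..<2}. V - f ` {..<2} - {x}). \<Sum>q\<in>(SIGMA x:V - f ` {..<2}. V - f ` {..<2} - {x}).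
        t (f 0) (f 1) (fst p) (snd p) (fst q) (snd q)) =
    (\<Sum>\<phi>\<in>pair_domain V. t (\<phi> 0) (\<phi> 1) (\<phi> 2) (\<phi> 3) (\<phi> 4) (\<phi> 5))"
proof -
  let ?I = "{f \<in> {..<2::nat} \<rightarrow>\<^sub>E V. inj_on f {..<2}}"
  let ?P = "\<lambda>f. SIGMA x:V - f ` {..<2}. V - f ` {..<2} - {x}"
  have fin: "finite ?I" by (rule finite_subset[of _ "{..<2} \<rightarrow>\<^sub>E V"]) (use V in \<open>auto intro: finite_PiE\<close>)
  have finP: "finite (?P f)" for f :: "nat \<Rightarrow> nat" using V by auto
  have "(\<Sum>f\<in>?I. \<Sum>p\<in>?P f. \<Sum>q\<in>?P f. t (f 0) (f 1) (fst p) (snd p) (fst q) (snd q)) =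
      (\<Sum>(f, p, q)\<in>(SIGMA f:?I. ?P f \<times> ?P f). t (f 0) (f 1) (fst p) (snd p) (fst q) (snd q))"
    using fin finP by (simp add: sum.Sigma sum.cartesian_product)
  also have "\<dots> = (\<Sum>\<phi>\<in>pair_domain V. t (\<phi> 0) (\<phi> 1) (\<phi> 2) (\<phi> 3) (\<phi> 4) (\<phi> 5))"
  proof (rule sum.reindex_bij_witness[where i = "\<lambda>\<phi>. (restrict \<phi> {..<2}, (\<phi> 2, \<phi> 3), (\<phi> 4, \<phi> 5))"
        and j = "\<lambda>(f, p, q). \<lambda>k\<in>{..<6}. [f 0, f 1, fst p, snd p, fst q, snd q] ! k"], goal_cases)
    case (1 z)
    obtain f c d e g where z: "z = (f, (c, d), (e, g))" by (metis prod.collapse)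
    have f: "f \<in> extensional {..<2}" using 1 unfolding z by (simp add: PiE_def)
    have "restrict (\<lambda>k\<in>{..<6}. [f 0, f 1, c, d, e, g] ! k) {..<2} = f"
    proof
      fix x show "restrict (\<lambda>k\<in>{..<6}. [f 0, f 1, c, d, e, g] ! k) {..<2} x = f x"
      proof (cases "x < 2")
        case True
        then consider "x = 0" | "x = 1" by linarith
        then show ?thesis by cases simp_all
      qed (use f in \<open>simp add: extensional_def\<close>)
    qed
    then show ?case unfolding z by simp
  next
    case (2 z)
    obtain f c d e g where z: "z = (f, (c, d), (e, g))" by (metis prod.collapse)
    have h: "f 0 \<in> V" "f 1 \<in> V" "f 0 \<noteq> f 1" "c \<in> V" "d \<in> V" "e \<in> V" "g \<in> V"
      "c \<notin> {f 0, f 1}" "d \<notin> {f 0, f 1}" "e \<notin> {f 0, f 1}" "g \<notin> {f 0, f 1}" "c \<noteq> d" "e \<noteq> g"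
      using 2 unfolding z lessThan2 by (auto simp: inj_on_def)
    have "(\<lambda>k\<in>{..<6}. [f 0, f 1, c, d, e, g] ! k) \<in> tuples V" by (rule tuple_mem) (use h in simp)
    then show ?case unfolding z pair_domain_def mem_Collect_eq prod.case fst_conv snd_conv
      by (rule conjI) (use h in simp)
  next
    case (3 \<phi>)
    then show ?case unfolding pair_domain_def by (simp add: tuple_ext PiE_def)
  next
    case (4 \<phi>)
    then have p: "\<phi> k \<in> V" if "k < 6" for k using that unfolding pair_domain_def by auto
    have ne: "\<phi> 0 \<noteq> \<phi> 1" "\<phi> 2 \<notin> {\<phi> 0, \<phi> 1}" "\<phi> 3 \<notin> {\<phi> 0, \<phi> 1}" "\<phi> 2 \<noteq> \<phi> 3"
      "\<phi> 4 \<notin> {\<phi> 0, \<phi> 1}" "\<phi> 5 \<notin> {\<phi> 0, \<phi> 1}" "\<phi> 4 \<noteq> \<phi> 5"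
      using 4 unfolding pair_domain_def by simp_all
    have im: "restrict \<phi> {..<2} ` {..<2} = {\<phi> 0, \<phi> 1}" unfolding lessThan2 by simp
    have A: "restrict \<phi> {..<2} \<in> {..<2} \<rightarrow>\<^sub>E V" unfolding restrict_PiE_iff by (intro ballI p) simp
    have B: "inj_on (restrict \<phi> {..<2}) {..<2}" unfolding lessThan2 using ne(1) by (simp add: inj_on_def)
    show ?case unfolding mem_Sigma_iff mem_Collect_eq im
      by (intro conjI A B) (use ne p[of 2] p[of 3] p[of 4] p[of 5] in simp_all)
  next
    case (5 z)
    obtain f c d e g where z: "z = (f, (c, d), (e, g))" by (metis prod.collapse)
    show ?case unfolding z by simp
  qed
  finally show ?thesis .
qed

lemma sum_cherry_domain:
  fixes t :: "nat \<Rightarrow> nat \<Rightarrow> nat \<Rightarrow> nat \<Rightarrow> nat \<Rightarrow> nat \<Rightarrow> real"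
  assumes V: "finite V"
  shows "(\<Sum>f\<in>{f \<in> {..<4::nat} \<rightarrow>\<^sub>E V. inj_on f {..<4}}. \<Sum>x\<in>V - f ` {..<4}. \<Sum>y\<in>V - f ` {..<4}.
      t (f 0) (f 1) (f 2) (f 3) x y) = (\<Sum>\<phi>\<in>cherry_domain V. t (\<phi> 0) (\<phi> 1) (\<phi> 2) (\<phi> 3) (\<phi> 4) (\<phi> 5))"
proof -
  let ?I = "{f \<in> {..<4::nat} \<rightarrow>\<^sub>E V. inj_on f {..<4}}"
  have fin: "finite ?I" by (rule finite_subset[of _ "{..<4} \<rightarrow>\<^sub>E V"]) (use V in \<open>auto intro: finite_PiE\<close>)
  have "(\<Sum>f\<in>?I. \<Sum>x\<in>V - f ` {..<4}. \<Sum>y\<in>V - f ` {..<4}. t (f 0) (f 1) (f 2) (f 3) x y) =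
      (\<Sum>(f, x, y)\<in>(SIGMA f:?I. (V - f ` {..<4}) \<times> (V - f ` {..<4})). t (f 0) (f 1) (f 2) (f 3) x y)"
    using fin V by (simp add: sum.Sigma sum.cartesian_product)
  also have "\<dots> = (\<Sum>\<phi>\<in>cherry_domain V. t (\<phi> 0) (\<phi> 1) (\<phi> 2) (\<phi> 3) (\<phi> 4) (\<phi> 5))"
  proof (rule sum.reindex_bij_witness[where i = "\<lambda>\<phi>. (restrict \<phi> {..<4}, \<phi> 4, \<phi> 5)"
        and j = "\<lambda>(f, x, y). \<lambda>k\<in>{..<6}. [f 0, f 1, f 2, f 3, x, y] ! k"], goal_cases)
    case (1 z)
    obtain f x y where z: "z = (f, x, y)" by (cases z)
    have f: "f \<in> extensional {..<4}" using 1 unfolding z by (simp add: PiE_def)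
    have "restrict (\<lambda>k\<in>{..<6}. [f 0, f 1, f 2, f 3, x, y] ! k) {..<4} = f"
    proof
      fix i show "restrict (\<lambda>k\<in>{..<6}. [f 0, f 1, f 2, f 3, x, y] ! k) {..<4} i = f i"
      proof (cases "i < 4")
        case True
        then consider "i = 0" | "i = 1" | "i = 2" | "i = 3" by linarith
        then show ?thesis by cases simp_all
      qed (use f in \<open>simp add: extensional_def\<close>)
    qed
    then show ?case unfolding z by simp
  next
    case (2 z)
    obtain f x y where z: "z = (f, x, y)" by (cases z)
    have h: "f 0 \<in> V" "f 1 \<in> V" "f 2 \<in> V" "f 3 \<in> V" "x \<in> V" "y \<in> V" "x \<notin> {f 0, f 1, f 2, f 3}" "y \<notin> {f 0, f 1, f 2, f 3}"
      "f 0 \<noteq> f 1" "f 0 \<noteq> f 2" "f 0 \<noteq> f 3" "f 1 \<noteq> f 2" "f 1 \<noteq> f 3" "f 2 \<noteq> f 3"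
      using 2 unfolding z lessThan4 by (auto simp: inj_on_def)
    have "(\<lambda>k\<in>{..<6}. [f 0, f 1, f 2, f 3, x, y] ! k) \<in> tuples V" by (rule tuple_mem) (use h in simp)
    then show ?case unfolding z cherry_domain_def mem_Collect_eq prod.case fst_conv snd_conv lessThan4
      by (rule conjI) (use h in simp)
  next
    case (3 \<phi>)
    then show ?case unfolding cherry_domain_def by (simp add: tuple_ext PiE_def)
  next
    case (4 \<phi>)
    then have p: "\<phi> k \<in> V" if "k < 6" for k using that unfolding cherry_domain_def by auto
    show ?case using 4 p[of 0] p[of 1] p[of 2] p[of 3] p[of 4] p[of 5]
      unfolding cherry_domain_def lessThan4 by (auto simp: inj_on_def)
  next
    case (5 z)
    obtain f x y where z: "z = (f, x, y)" by (cases z)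
    show ?case unfolding z by simp
  qed
  finally show ?thesis .
qed

lemma type_orders_6: "type_orders 6 = {2, 4}"
proof
  show "type_orders 6 \<subseteq> {2, 4}"
  proof
    fix q assume "q \<in> type_orders 6"
    then have "1 \<le> q" "q \<le> 4" "even q" unfolding type_orders_def by (auto simp: even_iff_mod_2_eq_zero)
    then show "q \<in> {2, 4}" by (cases "q = 1"; cases "q = 3") auto
  qed
qed (auto simp: type_orders_def)

lemma sos_part_F4:
  assumes G: "simple_graph G"
  shows "sos_part 6 F4_matrix G =
    ((\<Sum>\<phi>\<in>pair_domain (verts G). real_of_int (pair_term (adj G) (\<phi> 0) (\<phi> 1) (\<phi> 2) (\<phi> 3) (\<phi> 4) (\<phi> 5))) +
     (\<Sum>\<phi>\<in>cherry_domain (verts G). 4 * real_of_int (cherry_term (adj G) (\<phi> 0) (\<phi> 1) (\<phi> 2) (\<phi> 3) (\<phi> 4) (\<phi> 5)))) / 1679616"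
proof -
  have fin: "finite (verts G)" using G by (simp add: simple_graph_def)
  have "sos_part 6 F4_matrix G =
    (\<Sum>f\<in>{f \<in> {..<2::nat} \<rightarrow>\<^sub>E verts G. inj_on f {..<2}}. quad_form (flags (pulled_back_type 2 f G) 4)
        (F4_matrix (pulled_back_type 2 f G)) (\<lambda>\<Phi>. real (flag_count (pulled_back_type 2 f G) 4 G f \<Phi>))) +
    (\<Sum>f\<in>{f \<in> {..<4::nat} \<rightarrow>\<^sub>E verts G. inj_on f {..<4}}. quad_form (flags (pulled_back_type 4 f G) 5)
        (F4_matrix (pulled_back_type 4 f G)) (\<lambda>\<Phi>. real (flag_count (pulled_back_type 4 f G) 5 G f \<Phi>)))"
    unfolding sos_part_def type_orders_6 Let_def by simp
  also have "\<dots> =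
    (\<Sum>f\<in>{f \<in> {..<2::nat} \<rightarrow>\<^sub>E verts G. inj_on f {..<2}}.
      (\<Sum>p\<in>(SIGMA x:verts G - f ` {..<2}. verts G - f ` {..<2} - {x}). \<Sum>q\<in>(SIGMA x:verts G - f ` {..<2}. verts G - f ` {..<2} - {x}).
        real_of_int (pair_term (adj G) (f 0) (f 1) (fst p) (snd p) (fst q) (snd q))) / 1679616) +
    (\<Sum>f\<in>{f \<in> {..<4::nat} \<rightarrow>\<^sub>E verts G. inj_on f {..<4}}.
      (\<Sum>x\<in>verts G - f ` {..<4}. \<Sum>y\<in>verts G - f ` {..<4}.
        4 * real_of_int (cherry_term (adj G) (f 0) (f 1) (f 2) (f 3) x y)) / 1679616)"
    by (intro arg_cong2[where f = "(+)"] sum.cong refl) (simp_all only: mem_Collect_eq pair_quad_form[OF G] cherry_quad_form[OF G])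
  finally show ?thesis
    unfolding sum_divide_distrib[symmetric] 
      sum_pair_domain[OF fin, of "\<lambda>a b c d e f. real_of_int (pair_term (adj G) a b c d e f)"]
      sum_cherry_domain[OF fin, of "\<lambda>a b c d x y. 4 * real_of_int (cherry_term (adj G) a b c d x y)"] add_divide_distrib .
qed

lemma sum_squares_reindex:
  assumes e: "bij_betw e {..<6} X" and e': "bij_betw e' {..<6} X"
  shows "(\<Sum>\<pi>\<in>perms6. squares (pull \<pi> (pull e A))) = (\<Sum>\<pi>\<in>perms6. squares (pull \<pi> (pull e' A)))"
proof -
  let ?\<rho> = "\<lambda>i\<in>{..<6}. inv_into {..<6} e' (e i)"
  have eX: "e i \<in> X" if "i < 6" for i using bij_betw_apply[OF e] that by simp
  have inv: "inv_into {..<6} e' x < 6" "e' (inv_into {..<6} e' x) = x" if "x \<in> X" for x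
    using bij_betw_apply[OF bij_betw_inv_into[OF e'] that] bij_betw_inv_into_right[OF e' that] by auto
  have \<rho>: "?\<rho> \<in> perms6"
  proof (rule perms6I)
    fix i j :: nat assume ij: "i < 6" "j < 6" "inv_into {..<6} e' (e i) = inv_into {..<6} e' (e j)"
    then have "e i = e j" using inv(2) eX by metis
    then show "i = j" using e ij by (auto simp: bij_betw_def inj_on_def)
  qed (use inv eX in blast)
  have "(\<Sum>\<pi>\<in>perms6. squares (pull \<pi> (pull e' A))) = (\<Sum>\<pi>\<in>perms6. squares (pull \<pi> (pull ?\<rho> (pull e' A))))"
    by (rule sum_perms6_pull[OF \<rho> squares_cong, symmetric])
  also have "\<dots> = (\<Sum>\<pi>\<in>perms6. squares (pull \<pi> (pull e A)))"
    by (intro sum.cong refl squares_cong) (simp add: perms6_less inv eX)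
  finally show ?thesis by simp
qed

definition total_squares :: "pgraph \<Rightarrow> real" where
  "total_squares H = real_of_int (\<Sum>\<pi>\<in>perms6. squares (pull \<pi> (pull (enum6 (verts H)) (adj H))))"

lemma total_squares_iso:
  assumes "isomorphic H H'" "nverts H = 6" "nverts H' = 6"
  shows "total_squares H = total_squares H'"
proof -
  obtain f where f: "bij_betw f (verts H) (verts H')"
    "\<And>x y. x \<in> verts H \<Longrightarrow> y \<in> verts H \<Longrightarrow> adj H x y = adj H' (f x) (f y)"
    using assms(1) unfolding isomorphic_def isomorphism_def by blast
  have e: "bij_betw (enum6 (verts H)) {..<6} (verts H)" and e': "bij_betw (enum6 (verts H')) {..<6} (verts H')"
    using enum6 assms by auto
  have "(\<Sum>\<pi>\<in>perms6. squares (pull \<pi> (pull (enum6 (verts H)) (adj H)))) =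
      (\<Sum>\<pi>\<in>perms6. squares (pull \<pi> (pull (f \<circ> enum6 (verts H)) (adj H'))))"
    by (intro sum.cong refl squares_cong) (use bij_betw_apply[OF e] in \<open>simp add: f(2) perms6_less\<close>)
  also have "\<dots> = (\<Sum>\<pi>\<in>perms6. squares (pull \<pi> (pull (enum6 (verts H')) (adj H'))))"
    by (rule sum_squares_reindex[OF bij_betw_trans[OF e f(1)] e'])
  finally show ?thesis unfolding total_squares_def by simp
qed

lemma slack_F4:
  assumes H: "simple_graph H" "verts H = {..<6}"
  shows "40 / 243 - ind_density F4 H - F4_slack H = total_squares H / 1679616"
proof -
  have perms: "inj_tuples {..<6} = perms6" by (simp add: inj_tuples_def perms6_def)
  have "12 * real (ind_count F4 H) = real_of_int (stars (adj H))"
    unfolding ind_count_F4[OF H(1)] H(2) perms stars_def by simp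
  moreover have "total_squares H = real_of_int (\<Sum>\<pi>\<in>perms6. squares (pull \<pi> (adj H)))"
    unfolding total_squares_def
    using sum_squares_reindex[OF enum6, of "verts H" id "adj H"] H(2) by simp
  moreover have "ind_density F4 H = real (ind_count F4 H)"
    unfolding ind_density_def H(2) by (simp add: on_first_def)
  ultimately show ?thesis unfolding F4_slack_def slack_def by (simp add: field_simps)
qed

abbreviation BB :: pgraph where
  "BB \<equiv> on_first 3 {{1,2}}"

lemma difference_of_quotients_bound:
  fixes a :: real
  assumes L: "a - s = (x + y) / 1679616" and S: "t = (p + c) / 1679616"
    and P: "\<bar>p - x\<bar> \<le> d" and C: "\<bar>c - y\<bar> \<le> e" and R: "r = (d + e) / 1679616"
  shows "\<bar>a - (t + s)\<bar> \<le> r"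
proof -
  have eq: "a - (t + s) = ((x - p) + (y - c)) / 1679616"
    using L S by (simp add: diff_divide_distrib add_divide_distrib)
  have b: "\<bar>(x - p) + (y - c)\<bar> \<le> d + e" using P C by linarith
  have "\<bar>a - (t + s)\<bar> = \<bar>(x - p) + (y - c)\<bar> / 1679616" unfolding eq abs_divide by simp
  also have "\<dots> \<le> (d + e) / 1679616" using b by (rule divide_right_mono) simp
  finally show ?thesis unfolding R .
qed

text \<open>
  Both sides are sums over six-tuples of vertices. They agree on injective tuples by the choice of the slack; the squares also
  contain tuples in which the two extensions overlap, and these contribute to the error term only.
\<close>

theorem certificate_F4: "certificate F4 6 (40 / 243) F4_matrix F4_slack"
proof -
  obtain M1 where M1: "\<And>b i j x y z w. \<bar>pair_term b i j x y z w\<bar> \<le> M1" using pair_term_bounded by blast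
  obtain M2 where M2: "\<And>b i j k l x y. \<bar>cherry_term b i j k l x y\<bar> \<le> M2" using cherry_term_bounded by blast
  define K where "K = (36 * real_of_int M1 + 36 * (4 * real_of_int M2)) / 1679616"
  have "\<bar>(\<Sum>H\<in>graphs_upto_iso 6. (40 / 243 - ind_density F4 H) * real (ind_count H G)) -
      (sos_part 6 F4_matrix G + (\<Sum>H\<in>graphs_upto_iso 6. F4_slack H * real (ind_count H G)))\<bar> \<le> K * real (nverts G) ^ 5"
    if G: "simple_graph G" for G
  proof -
    let ?V = "verts G"
    have fin: "finite ?V" using G by (simp add: simple_graph_def)
    define p where "p \<phi> = real_of_int (pair_term (adj G) (\<phi> 0) (\<phi> 1) (\<phi> 2) (\<phi> 3) (\<phi> 4) (\<phi> 5))" for \<phi> :: "nat \<Rightarrow> nat"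
    define c where "c \<phi> = 4 * real_of_int (cherry_term (adj G) (\<phi> 0) (\<phi> 1) (\<phi> 2) (\<phi> 3) (\<phi> 4) (\<phi> 5))" for \<phi> :: "nat \<Rightarrow> nat"
    have "(\<Sum>H\<in>graphs_upto_iso 6. (40 / 243 - ind_density F4 H) * real (ind_count H G)) -
        (\<Sum>H\<in>graphs_upto_iso 6. F4_slack H * real (ind_count H G)) =
        (\<Sum>H\<in>graphs_upto_iso 6. total_squares H * real (ind_count H G)) / 1679616"
      unfolding sum_subtractf[symmetric] sum_divide_distrib
    proof (rule sum.cong[OF refl])
      fix H assume "H \<in> graphs_upto_iso 6"
      then have "simple_graph H" "verts H = {..<6}" using graphs_upto_iso_subset by auto
      then have "(40 / 243 - ind_density F4 H) - F4_slack H = total_squares H / 1679616" by (rule slack_F4)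
      then show "(40 / 243 - ind_density F4 H) * real (ind_count H G) - F4_slack H * real (ind_count H G) =
          total_squares H * real (ind_count H G) / 1679616"
        by (metis left_diff_distrib times_divide_eq_left)
    qed
    also have "(\<Sum>H\<in>graphs_upto_iso 6. total_squares H * real (ind_count H G)) =
        (\<Sum>X\<in>{X. X \<subseteq> ?V \<and> card X = 6}. total_squares (induced G X))"
      by (rule sum_graphs_upto_iso[OF G total_squares_iso])
    also have "\<dots> = (\<Sum>X\<in>{X. X \<subseteq> ?V \<and> card X = 6}. \<Sum>\<pi>\<in>perms6. real_of_int (squares (pull \<pi> (pull (enum6 X) (adj G)))))"
    proof (rule sum.cong[OF refl])
      fix X assume "X \<in> {X. X \<subseteq> ?V \<and> card X = 6}"
      then have e: "bij_betw (enum6 X) {..<6} X" using enum6 by blast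
      have "squares (pull \<pi> (pull (enum6 X) (adj (induced G X)))) = squares (pull \<pi> (pull (enum6 X) (adj G)))"
        if "\<pi> \<in> perms6" for \<pi>
        by (rule squares_cong) (use bij_betw_apply[OF e] that in \<open>simp add: adj_induced perms6_less\<close>)
      then show "total_squares (induced G X) = (\<Sum>\<pi>\<in>perms6. real_of_int (squares (pull \<pi> (pull (enum6 X) (adj G)))))"
        unfolding total_squares_def verts_induced of_int_sum by (intro sum.cong refl) simp
    qed
    also have "\<dots> = (\<Sum>\<phi>\<in>inj_tuples ?V. real_of_int (squares (pull \<phi> (adj G))))"
      by (rule sum_inj_tuples[OF fin, symmetric, where g = "\<lambda>b. real_of_int (squares b)"])
         (rule arg_cong[where f = real_of_int], rule squares_cong)
    also have "\<dots> = (\<Sum>\<phi>\<in>inj_tuples ?V. p \<phi>) + (\<Sum>\<phi>\<in>inj_tuples ?V. c \<phi>)"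
      unfolding sum.distrib[symmetric] p_def c_def
      by (intro sum.cong refl) (simp add: squares_def pair_term_def pair_form_def cherry_term_def cherry_type_def cherry_form_def)
    finally have L: "(\<Sum>H\<in>graphs_upto_iso 6. (40 / 243 - ind_density F4 H) * real (ind_count H G)) -
        (\<Sum>H\<in>graphs_upto_iso 6. F4_slack H * real (ind_count H G)) =
        ((\<Sum>\<phi>\<in>inj_tuples ?V. p \<phi>) + (\<Sum>\<phi>\<in>inj_tuples ?V. c \<phi>)) / 1679616" .
    have S: "sos_part 6 F4_matrix G = ((\<Sum>\<phi>\<in>pair_domain ?V. p \<phi>) + (\<Sum>\<phi>\<in>cherry_domain ?V. c \<phi>)) / 1679616"
      unfolding sos_part_F4[OF G] p_def c_def ..
    have P: "\<bar>(\<Sum>\<phi>\<in>pair_domain ?V. p \<phi>) - (\<Sum>\<phi>\<in>inj_tuples ?V. p \<phi>)\<bar> \<le> 36 * real_of_int M1 * real (card ?V) ^ 5"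
    proof (rule sum_between_tuples[OF fin inj_tuples_domains(1)])
      show "\<bar>p \<phi>\<bar> \<le> real_of_int M1" for \<phi> unfolding p_def using M1 by (metis of_int_abs of_int_le_iff)
    qed (auto simp: pair_domain_def)
    have C: "\<bar>(\<Sum>\<phi>\<in>cherry_domain ?V. c \<phi>) - (\<Sum>\<phi>\<in>inj_tuples ?V. c \<phi>)\<bar> \<le> 36 * (4 * real_of_int M2) * real (card ?V) ^ 5"
    proof (rule sum_between_tuples[OF fin inj_tuples_domains(2)])
      show "\<bar>c \<phi>\<bar> \<le> 4 * real_of_int M2" for \<phi>
        unfolding c_def abs_mult using M2[of "adj G" "\<phi> 0" "\<phi> 1" "\<phi> 2" "\<phi> 3" "\<phi> 4" "\<phi> 5"] by (simp flip: of_int_abs)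
    qed (auto simp: cherry_domain_def)
    have K: "K * real (card ?V) ^ 5 =
        (36 * real_of_int M1 * real (card ?V) ^ 5 + 36 * (4 * real_of_int M2) * real (card ?V) ^ 5) / 1679616"
      unfolding K_def by (simp add: field_simps)
    show ?thesis by (rule difference_of_quotients_bound[OF L S P C K])
  qed
  then have "\<exists>K n\<^sub>0. \<forall>G. simple_graph G \<and> n\<^sub>0 \<le> nverts G \<longrightarrow>
      \<bar>(\<Sum>H\<in>graphs_upto_iso 6. (40 / 243 - ind_density F4 H) * real (ind_count H G)) -
      (sos_part 6 F4_matrix G + (\<Sum>H\<in>graphs_upto_iso 6. F4_slack H * real (ind_count H G)))\<bar> \<le> K * real (nverts G) ^ (6 - 1)"
    by (intro exI[of _ K] exI[of _ 0]) simp
  moreover have "0 \<le> F4_slack H" if "H \<in> graphs_upto_iso 6" for H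
  proof -
    have "simple_graph H" using that graphs_upto_iso_subset by blast
    then have "0 \<le> slack (adj H)" by (intro slack_nonneg(1) adj_commute adj_irrefl)
    then show ?thesis by (simp add: F4_slack_def)
  qed
  ultimately show ?thesis
    unfolding certificate_def using F4_matrix_psd by (simp add: on_first_def)
qed

lemma F4_slack_zero:
  assumes "H \<in> graphs_upto_iso 6" "F4_slack H = 0"
  shows "homs H BB \<noteq> {}"
proof -
  have H: "simple_graph H" "verts H = {..<6}" using assms(1) graphs_upto_iso_subset by auto
  have "colourable (adj H)"
    using slack_nonneg(2)[of "adj H", OF adj_commute adj_irrefl[OF H(1)]] assms(2) by (auto simp: F4_slack_def)
  then obtain g where g: "\<And>i j. i < 6 \<Longrightarrow> j < 6 \<Longrightarrow> i \<noteq> j \<Longrightarrow> g i < 3 \<and> (adj H i j \<longleftrightarrow> {g i, g j} = {1, 2::nat})"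
    unfolding colourable_def by blast
  have g3: "g i < 3" if "i < 6" for i using g[of i "if i = 0 then 1 else 0"] that by (auto split: if_splits)
  have "restrict g {..<6} \<in> homs H BB"
    unfolding homs_def H(2) using g g3 by (auto simp: on_first_def adj_def)
  then show ?thesis by blast
qed

section \<open>Densities in blowups\<close>

definition part_adj :: "(nat \<Rightarrow> nat) \<Rightarrow> nat \<Rightarrow> nat \<Rightarrow> bool" where
  "part_adj f x y \<longleftrightarrow> {f x, f y} = {1, 2}"

lemma part_adj_iff: "part_adj f x y \<longleftrightarrow> f x = 1 \<and> f y = 2 \<or> f x = 2 \<and> f y = 1"
  unfolding part_adj_def by (auto simp: doubleton_eq_iff)

lemma sum_product6:
  fixes g :: "nat \<Rightarrow> real"
  shows "(\<Sum>a\<in>V. \<Sum>b\<in>V. \<Sum>c\<in>V. \<Sum>d\<in>V. \<Sum>e\<in>V. \<Sum>f\<in>V. g a * h b * h c * h d * k e * k f) =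
    sum g V * (sum h V) ^ 3 * (sum k V)\<^sup>2"
  by (simp add: sum_distrib_left[symmetric] sum_distrib_right[symmetric] power3_eq_cube power2_eq_square mult.assoc)

lemma star_part_adj:
  assumes "\<And>k. k < 6 \<Longrightarrow> f (\<phi> k) < 3"
  shows "star (pull \<phi> (part_adj f)) 0 1 2 3 4 5 \<longleftrightarrow>
    (f (\<phi> 0) = 1 \<and> f (\<phi> 1) = 2 \<and> f (\<phi> 2) = 2 \<and> f (\<phi> 3) = 2 \<or>
     f (\<phi> 0) = 2 \<and> f (\<phi> 1) = 1 \<and> f (\<phi> 2) = 1 \<and> f (\<phi> 3) = 1) \<and> f (\<phi> 4) = 0 \<and> f (\<phi> 5) = 0"
proof -
  have v: "f (\<phi> k) = 0 \<or> f (\<phi> k) = 1 \<or> f (\<phi> k) = 2" if "k < 6" for k using assms[OF that] by linarith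
  show ?thesis
    using v[of 4] v[of 5] unfolding star_def part_adj_iff by auto
qed

text \<open>
  A star in a blowup has its centre in one of the two adjacent parts, its leaves in the other one, and its isolated vertices in
  the part \<open>0\<close>.
\<close>

lemma star_mean_part_adj:
  fixes w :: "nat \<Rightarrow> real"
  assumes "\<And>x. x \<in> V \<Longrightarrow> f x < 3"
  defines "y \<equiv> \<lambda>i. \<Sum>x\<in>V. w x * of_bool (f x = i)"
  shows "star_mean V (part_adj f) w = (y 0)\<^sup>2 * y 1 * y 2 * ((y 1)\<^sup>2 + (y 2)\<^sup>2)"
proof -
  let ?u = "\<lambda>i x. w x * of_bool (f x = i)"
  have "star_mean V (part_adj f) w = (\<Sum>\<phi>\<in>tuples V.
      ?u 1 (\<phi> 0) * ?u 2 (\<phi> 1) * ?u 2 (\<phi> 2) * ?u 2 (\<phi> 3) * ?u 0 (\<phi> 4) * ?u 0 (\<phi> 5) +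
      ?u 2 (\<phi> 0) * ?u 1 (\<phi> 1) * ?u 1 (\<phi> 2) * ?u 1 (\<phi> 3) * ?u 0 (\<phi> 4) * ?u 0 (\<phi> 5))"
    unfolding star_mean_def
  proof (rule sum.cong[OF refl])
    fix \<phi> assume "\<phi> \<in> tuples V"
    then have "f (\<phi> k) < 3" if "k < 6" for k using assms(1) that by auto
    then show "weight w \<phi> * of_bool (star (pull \<phi> (part_adj f)) 0 1 2 3 4 5) =
      ?u 1 (\<phi> 0) * ?u 2 (\<phi> 1) * ?u 2 (\<phi> 2) * ?u 2 (\<phi> 3) * ?u 0 (\<phi> 4) * ?u 0 (\<phi> 5) +
      ?u 2 (\<phi> 0) * ?u 1 (\<phi> 1) * ?u 1 (\<phi> 2) * ?u 1 (\<phi> 3) * ?u 0 (\<phi> 4) * ?u 0 (\<phi> 5)"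
      unfolding weight_def prod_lessThan6 by (subst star_part_adj) (auto simp: of_bool_def)
  qed
  also have "\<dots> = y 1 * y 2 ^ 3 * (y 0)\<^sup>2 + y 2 * y 1 ^ 3 * (y 0)\<^sup>2"
    unfolding sum.distrib sum_tuples y_def
    by (simp only: restrict_apply lessThan_iff) (simp only: sum_product6[symmetric], simp)
  finally show ?thesis by (simp add: algebra_simps power3_eq_cube power2_eq_square)
qed

definition star_count :: "nat set \<Rightarrow> (nat \<Rightarrow> nat \<Rightarrow> bool) \<Rightarrow> real" where
  "star_count V A = (\<Sum>\<phi>\<in>tuples V. of_bool (star (pull \<phi> A) 0 1 2 3 4 5))"

lemma star_count_eq: "star_count V A = star_mean V A (\<lambda>_. 1)"
  unfolding star_count_def star_mean_def weight_def by simp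

lemma star_count_uniform:
  assumes "V \<noteq> {}" "finite V"
  shows "star_mean V A (\<lambda>_. 1 / real (card V)) = star_count V A / real (card V) ^ 6"
  unfolding star_count_def star_mean_def weight_def by (simp add: sum_divide_distrib power_one_over)

lemma star_count_bound:
  assumes G: "simple_graph G"
  shows "star_count (verts G) (adj G) \<le> 2 / 729 * real (nverts G) ^ 6"
proof (cases "verts G = {}")
  case True
  then have "tuples (verts G) = {}" by (simp add: PiE_eq_empty_iff) (rule exI[of _ 0], simp)
  then show ?thesis by (simp add: star_count_def)
next
  case False
  have fin: "finite (verts G)" using G by (simp add: simple_graph_def)
  then have n: "0 < real (nverts G)" using False by (simp add: card_gt_0_iff)
  have "0 \<le> bad_mean (verts G) (adj G) (\<lambda>_. 1 / real (nverts G))"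
    unfolding bad_mean_def by (intro sum_nonneg mult_nonneg_nonneg weight_nonneg[where V = "verts G"]) auto
  moreover have "100776960 * star_mean (verts G) (adj G) (\<lambda>_. 1 / real (nverts G)) +
      bad_mean (verts G) (adj G) (\<lambda>_. 1 / real (nverts G)) \<le> 276480"
    by (rule star_mean_bound[OF fin _ _ adj_commute adj_irrefl[OF G]]) (use n in auto)
  ultimately have "100776960 * (star_count (verts G) (adj G) / real (nverts G) ^ 6) \<le> 276480"
    unfolding star_count_uniform[OF False fin] by linarith
  then show ?thesis using n by (simp add: field_simps)
qed

lemma star_count_ind_count:
  assumes G: "simple_graph G"
  shows "\<bar>star_count (verts G) (adj G) - 12 * real (ind_count F4 G)\<bar> \<le> 36 * real (nverts G) ^ 5"
proof -
  have fin: "finite (verts G)" using G by (simp add: simple_graph_def)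
  have "\<bar>(\<Sum>\<phi>\<in>tuples (verts G). of_bool (star (pull \<phi> (adj G)) 0 1 2 3 4 5) :: real) -
      (\<Sum>\<phi>\<in>inj_tuples (verts G). of_bool (star (pull \<phi> (adj G)) 0 1 2 3 4 5))\<bar> \<le> 36 * 1 * real (nverts G) ^ 5"
    by (rule sum_between_tuples[OF fin]) (auto simp: inj_tuples_def)
  then show ?thesis unfolding star_count_def ind_count_F4[OF G] by simp
qed

lemma ind_count_le_star_count:
  assumes G: "simple_graph G"
  shows "12 * real (ind_count F4 G) \<le> star_count (verts G) (adj G)"
proof -
  have fin: "finite (verts G)" using G by (simp add: simple_graph_def)
  show ?thesis unfolding ind_count_F4[OF G] star_count_def
    by (rule sum_mono2) (use finite_tuples[OF fin] in \<open>auto simp: inj_tuples_def\<close>)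
qed

lemma choose6: "720 * real (n choose 6) = real n * (real n - 1) * (real n - 2) * (real n - 3) * (real n - 4) * (real n - 5)"
proof -
  have "real (n choose 6) = real n gchoose 6" by (rule binomial_gbinomial)
  also have "\<dots> = (\<Prod>i = 0..<6. real n - real i) / fact 6" by (rule gbinomial_prod_rev)
  also have "(\<Prod>i = 0..<6. real n - real i) = real n * (real n - 1) * (real n - 2) * (real n - 3) * (real n - 4) * (real n - 5)"
    by (simp add: eval_nat_numeral One_nat_def)
  finally show ?thesis by (simp add: fact_numeral)
qed

lemma nverts_F4 [simp]: "nverts F4 = 6"
  by (simp add: on_first_def)

lemma choose6_limit:
  assumes "(\<lambda>n. real (m n) / real n) \<longlonglongrightarrow> 1"
  shows "(\<lambda>n. real (m n choose 6) / real n ^ 6) \<longlonglongrightarrow> 1 / 720"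
proof -
  have l: "(\<lambda>n. real (m n) / real n - c / real n) \<longlonglongrightarrow> 1" for c
    using tendsto_diff[OF assms lim_const_over_n[of c]] by simp
  have "(\<lambda>n. (real (m n) / real n - 0 / real n) * (real (m n) / real n - 1 / real n) * (real (m n) / real n - 2 / real n) *
      (real (m n) / real n - 3 / real n) * (real (m n) / real n - 4 / real n) * (real (m n) / real n - 5 / real n) / 720)
      \<longlonglongrightarrow> 1 * 1 * 1 * 1 * 1 * 1 / 720"
    by (intro tendsto_intros l) simp
  moreover have "(real (m n) / real n - 0 / real n) * (real (m n) / real n - 1 / real n) * (real (m n) / real n - 2 / real n) *
      (real (m n) / real n - 3 / real n) * (real (m n) / real n - 4 / real n) * (real (m n) / real n - 5 / real n) / 720 =
      real (m n choose 6) / real n ^ 6" for n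
  proof -
    have sixth: "real n * real n * real n * real n * real n * real n = real n ^ 6"
      by (simp add: eval_nat_numeral One_nat_def mult.assoc)
    show ?thesis
      unfolding diff_divide_distrib[symmetric] times_divide_times_eq divide_divide_eq_left diff_zero
        choose6[of "m n", symmetric] sixth by simp
  qed
  ultimately show ?thesis by simp
qed

definition part_of :: "(nat \<Rightarrow> nat set) \<Rightarrow> nat \<Rightarrow> nat" where
  "part_of V x = (if x \<in> V 1 then 1 else if x \<in> V 2 then 2 else 0)"

lemma lessThan3: "{..<3::nat} = {0, 1, 2}" by auto

lemma verts_BB: "verts BB = {0, 1, 2}" and edges_BB: "edges BB = {{1, 2}}"
  unfolding on_first_def lessThan3 by simp_all

lemma blowup_BB:
  assumes "parts_for BB V"
  shows "simple_graph (blowup BB V)" "verts (blowup BB V) = V 0 \<union> V 1 \<union> V 2"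
    "x \<in> verts (blowup BB V) \<Longrightarrow> y \<in> verts (blowup BB V) \<Longrightarrow> adj (blowup BB V) x y = part_adj (part_of V) x y"
    "i < 3 \<Longrightarrow> {x \<in> verts (blowup BB V). part_of V x = i} = V i"
proof -
  have dis: "V 0 \<inter> V 1 = {}" "V 0 \<inter> V 2 = {}" "V 1 \<inter> V 2 = {}" and fin: "finite (V 0)" "finite (V 1)" "finite (V 2)"
    using assms unfolding parts_for_def verts_BB disjoint_family_on_def by auto
  show v: "verts (blowup BB V) = V 0 \<union> V 1 \<union> V 2"
    unfolding blowup_def verts_BB by auto
  show "simple_graph (blowup BB V)"
    unfolding simple_graph_def v using fin
    by (auto simp: blowup_def verts_BB edges_BB card_insert_if)
  have cell: "x \<in> V i \<longleftrightarrow> part_of V x = i" if "x \<in> V 0 \<union> V 1 \<union> V 2" "i \<in> {0, 1, 2}" for x i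
    using that dis unfolding part_of_def by auto
  show "{x \<in> verts (blowup BB V). part_of V x = i} = V i" if "i < 3"
  proof -
    have "i \<in> {0, 1, 2}" using that by auto
    then have "V i \<subseteq> V 0 \<union> V 1 \<union> V 2" by blast
    then show ?thesis unfolding v using cell[OF _ \<open>i \<in> {0, 1, 2}\<close>] by blast
  qed
  show "adj (blowup BB V) x y = part_adj (part_of V) x y"
    if "x \<in> verts (blowup BB V)" "y \<in> verts (blowup BB V)"
  proof
    assume "adj (blowup BB V) x y"
    then obtain u v i j where uv: "{x, y} = {u, v}" "i \<in> {0, 1, 2}" "j \<in> {0, 1, 2}" "u \<in> V i" "v \<in> V j" "{i, j} = {1, 2}"
      unfolding adj_def blowup_def verts_BB edges_BB by auto
    have "u \<in> V 0 \<union> V 1 \<union> V 2" "v \<in> V 0 \<union> V 1 \<union> V 2" using uv by auto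
    then have "part_of V u = i" "part_of V v = j" using cell uv by metis+
    moreover have "{part_of V x, part_of V y} = {part_of V u, part_of V v}"
      using arg_cong[OF uv(1), of "(`) (part_of V)"] by simp
    ultimately show "part_adj (part_of V) x y" using uv(6) by (simp add: part_adj_def)
  next
    assume "part_adj (part_of V) x y"
    then have p: "{part_of V x, part_of V y} = {1, 2}" by (simp add: part_adj_def)
    then have ne: "x \<noteq> y" by (auto simp: doubleton_eq_iff)
    have px: "part_of V x \<in> {0, 1, 2}" for x by (auto simp: part_of_def)
    have mem: "x \<in> V (part_of V x)" if "x \<in> verts (blowup BB V)" for x
      by (rule iffD2[OF cell[OF that[unfolded v] px] refl])
    show "adj (blowup BB V) x y"
      unfolding adj_def blowup_def snd_conv verts_BB edges_BB
      by (intro CollectI exI[of _ x] exI[of _ y] conjI refl ne bexI[of _ "part_of V x"] bexI[of _ "part_of V y"] px mem that)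
         (simp add: p)
  qed
qed

text \<open>
  The probability that six random vertices form a labelled star in the blowup with these part ratios.
\<close>

definition F4_poly :: "(nat \<Rightarrow> real) \<Rightarrow> real" where
  "F4_poly x = (x 0)\<^sup>2 * x 1 * x 2 * ((x 1)\<^sup>2 + (x 2)\<^sup>2)"

lemma star_count_cong:
  assumes "\<And>x y. x \<in> V \<Longrightarrow> y \<in> V \<Longrightarrow> A x y = A' x y"
  shows "star_count V A = star_count V A'"
  unfolding star_count_def
proof (rule sum.cong[OF refl])
  fix \<phi> assume \<phi>: "\<phi> \<in> tuples V"
  have "star (pull \<phi> A) 0 1 2 3 4 5 = star (pull \<phi> A') 0 1 2 3 4 5"
    by (rule star_cong) (use \<phi> assms in auto)
  then show "(of_bool (star (pull \<phi> A) 0 1 2 3 4 5) :: real) = of_bool (star (pull \<phi> A') 0 1 2 3 4 5)" by simp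
qed

lemma star_count_part_adj:
  assumes "finite V" "\<And>x. x \<in> V \<Longrightarrow> f x < 3"
  shows "star_count V (part_adj f) = F4_poly (\<lambda>i. real (card {x \<in> V. f x = i}))"
proof -
  have h: "(\<Sum>x\<in>V. 1 * of_bool (f x = i)) = real (card {x \<in> V. f x = i})" for i
    using sum_of_bool_card[OF assms(1), of "\<lambda>x. f x = i"] by simp
  have "star_mean V (part_adj f) (\<lambda>_. 1) = F4_poly (\<lambda>i. \<Sum>x\<in>V. 1 * of_bool (f x = i))"
    unfolding F4_poly_def by (rule star_mean_part_adj) (rule assms(2))
  then show ?thesis unfolding star_count_eq h .
qed

lemma null_comparison:
  fixes f g :: "nat \<Rightarrow> real"
  assumes "\<forall>\<^sub>F n in sequentially. norm (f n) \<le> g n" "g \<longlonglongrightarrow> 0"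
  shows "f \<longlonglongrightarrow> 0"
proof (rule tendsto_0_le[OF assms(2), of f 1])
  show "\<forall>\<^sub>F n in sequentially. norm (f n) \<le> norm (g n) * 1"
    using assms(1) by eventually_elim simp
qed

lemma blowup_density_limit:
  assumes V: "\<And>n. parts_for BB (V n)"
    and lim: "\<And>i. i < 3 \<Longrightarrow> (\<lambda>n. real (card (V n i)) / real n) \<longlonglongrightarrow> x i" and x: "x 0 + x 1 + x 2 = 1"
  shows "(\<lambda>n. ind_density F4 (blowup BB (V n))) \<longlonglongrightarrow> 60 * F4_poly x"
proof -
  let ?G = "\<lambda>n. blowup BB (V n)"
  define m where "m n = nverts (?G n)" for n
  have m: "real (m n) = real (card (V n 0)) + real (card (V n 1)) + real (card (V n 2))" for n
  proof -
    have "V n 0 \<inter> V n 1 = {}" "V n 0 \<inter> V n 2 = {}" "V n 1 \<inter> V n 2 = {}" "finite (V n 0)" "finite (V n 1)" "finite (V n 2)"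
      using V[of n] unfolding parts_for_def verts_BB disjoint_family_on_def by auto
    then show ?thesis unfolding m_def blowup_BB(2)[OF V] by (simp add: card_Un_disjoint Int_Un_distrib2)
  qed
  have l0: "(\<lambda>n. real (card (V n 0)) / real n) \<longlonglongrightarrow> x 0" and l1: "(\<lambda>n. real (card (V n 1)) / real n) \<longlonglongrightarrow> x 1"
    and l2: "(\<lambda>n. real (card (V n 2)) / real n) \<longlonglongrightarrow> x 2" using lim by simp_all
  have mlim: "(\<lambda>n. real (m n) / real n) \<longlonglongrightarrow> 1"
    using tendsto_add[OF tendsto_add[OF l0 l1] l2] x unfolding m add_divide_distrib by simp
  have choose: "(\<lambda>n. real (m n choose 6) / real n ^ 6) \<longlonglongrightarrow> 1 / 720" by (rule choose6_limit[OF mlim])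
  define s where "s n = star_count (verts (?G n)) (adj (?G n))" for n
  have s: "s n = F4_poly (\<lambda>i. real (card (V n i)))" for n
  proof -
    have "s n = star_count (verts (?G n)) (part_adj (part_of (V n)))"
      unfolding s_def by (rule star_count_cong) (rule blowup_BB(3)[OF V])
    also have "\<dots> = F4_poly (\<lambda>i. real (card {x \<in> verts (?G n). part_of (V n) x = i}))"
      by (rule star_count_part_adj) (use blowup_BB(1)[OF V[of n]] in \<open>auto simp: simple_graph_def part_of_def\<close>)
    also have "\<dots> = F4_poly (\<lambda>i. real (card (V n i)))"
      unfolding F4_poly_def by (simp add: blowup_BB(4)[OF V])
    finally show ?thesis .
  qed
  have "(\<lambda>n. s n / real n ^ 6) \<longlonglongrightarrow> F4_poly x"
  proof -
    have "(\<lambda>n. F4_poly (\<lambda>i. real (card (V n i)) / real n)) \<longlonglongrightarrow> F4_poly x"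
      unfolding F4_poly_def by (intro tendsto_intros l0 l1 l2)
    moreover have "F4_poly (\<lambda>i. real (card (V n i)) / real n) = s n / real n ^ 6" for n
      unfolding s F4_poly_def by (cases "n = 0") (simp_all add: field_simps eval_nat_numeral One_nat_def)
    ultimately show ?thesis by simp
  qed
  moreover have "(\<lambda>n. s n / real n ^ 6 - 12 * real (ind_count F4 (?G n)) / real n ^ 6) \<longlonglongrightarrow> 0"
  proof (rule null_comparison)
    show "\<forall>\<^sub>F n in sequentially. norm (s n / real n ^ 6 - 12 * real (ind_count F4 (?G n)) / real n ^ 6) \<le>
        36 * (real (m n) / real n) ^ 5 * (1 / real n)"
    proof (rule always_eventually, rule allI)
      fix n
      have "\<bar>s n - 12 * real (ind_count F4 (?G n))\<bar> \<le> 36 * real (m n) ^ 5"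
        unfolding s_def m_def by (rule star_count_ind_count[OF blowup_BB(1)[OF V]])
      then have "\<bar>s n - 12 * real (ind_count F4 (?G n))\<bar> / real n ^ 6 \<le> 36 * real (m n) ^ 5 / real n ^ 6"
        by (rule divide_right_mono) simp
      also have "\<dots> = 36 * (real (m n) / real n) ^ 5 * (1 / real n)"
        by (simp add: power_divide eval_nat_numeral One_nat_def)
      finally show "norm (s n / real n ^ 6 - 12 * real (ind_count F4 (?G n)) / real n ^ 6) \<le> 36 * (real (m n) / real n) ^ 5 * (1 / real n)"
        by (simp add: diff_divide_distrib[symmetric] abs_divide)
    qed
    have "(\<lambda>n. 36 * (real (m n) / real n) ^ 5 * (1 / real n)) \<longlonglongrightarrow> 36 * 1 ^ 5 * 0"
      by (intro tendsto_intros mlim lim_1_over_n)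
    then show "(\<lambda>n. 36 * (real (m n) / real n) ^ 5 * (1 / real n)) \<longlonglongrightarrow> 0" by simp
  qed
  ultimately have "(\<lambda>n. s n / real n ^ 6 - (s n / real n ^ 6 - 12 * real (ind_count F4 (?G n)) / real n ^ 6)) \<longlonglongrightarrow> F4_poly x - 0"
    by (rule tendsto_diff)
  then have count: "(\<lambda>n. 12 * real (ind_count F4 (?G n)) / real n ^ 6) \<longlonglongrightarrow> F4_poly x" by simp
  have "(\<lambda>n. (12 * real (ind_count F4 (?G n)) / real n ^ 6) / 12 / (real (m n choose 6) / real n ^ 6)) \<longlonglongrightarrow> F4_poly x / 12 / (1 / 720)"
    by (intro tendsto_intros count choose) simp_all
  moreover have "\<forall>\<^sub>F n in sequentially. (12 * real (ind_count F4 (?G n)) / real n ^ 6) / 12 / (real (m n choose 6) / real n ^ 6) =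
      ind_density F4 (?G n)"
    using eventually_gt_at_top[of 0] by eventually_elim (simp add: ind_density_def m_def)
  ultimately have "(\<lambda>n. ind_density F4 (?G n)) \<longlonglongrightarrow> F4_poly x / 12 / (1 / 720)"
    by (rule Lim_transform_eventually)
  then show ?thesis by simp
qed

text \<open>
  Blowups with prescribed limiting ratios, so that the definition of the limit density is not vacuous.
\<close>

definition interval_parts :: "(nat \<Rightarrow> real) \<Rightarrow> nat \<Rightarrow> nat \<Rightarrow> nat set" where
  "interval_parts x n i = (if i = 0 then {..<nat \<lfloor>x 0 * real n\<rfloor>}
     else if i = 1 then {nat \<lfloor>x 0 * real n\<rfloor>..<nat \<lfloor>(x 0 + x 1) * real n\<rfloor>}
     else {nat \<lfloor>(x 0 + x 1) * real n\<rfloor>..<n})"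

lemma floor_limit:
  assumes "0 \<le> c"
  shows "(\<lambda>n. real (nat \<lfloor>c * real n\<rfloor>) / real n) \<longlonglongrightarrow> c"
proof (rule tendsto_sandwich)
  show "\<forall>\<^sub>F n in sequentially. c - 1 / real n \<le> real (nat \<lfloor>c * real n\<rfloor>) / real n"
    using eventually_gt_at_top[of 0]
  proof eventually_elim
    case (elim n)
    have "c * real n - 1 \<le> real (nat \<lfloor>c * real n\<rfloor>)" by linarith
    then have "(c * real n - 1) / real n \<le> real (nat \<lfloor>c * real n\<rfloor>) / real n" by (rule divide_right_mono) simp
    then show ?case using elim by (simp add: diff_divide_distrib)
  qed
  show "\<forall>\<^sub>F n in sequentially. real (nat \<lfloor>c * real n\<rfloor>) / real n \<le> c"
    using eventually_gt_at_top[of 0]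
  proof eventually_elim
    case (elim n)
    have "0 \<le> c * real n" using assms by simp
    then have "real (nat \<lfloor>c * real n\<rfloor>) \<le> c * real n" by linarith
    then show ?case using elim by (simp add: field_simps)
  qed
  show "(\<lambda>n. c - 1 / real n) \<longlonglongrightarrow> c" using tendsto_diff[OF tendsto_const lim_1_over_n, of c] by simp
qed simp

lemma interval_parts:
  assumes x: "0 \<le> x 0" "0 \<le> x 1" "0 \<le> x 2" "x 0 + x 1 + x 2 = 1"
  shows "parts_for BB (interval_parts x n)"
    "i < 3 \<Longrightarrow> (\<lambda>n. real (card (interval_parts x n i)) / real n) \<longlonglongrightarrow> x i"
    "nverts (blowup BB (interval_parts x n)) = n"
proof -
  let ?a = "\<lambda>n. nat \<lfloor>x 0 * real n\<rfloor>" and ?b = "\<lambda>n. nat \<lfloor>(x 0 + x 1) * real n\<rfloor>"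
  have ab: "?a n \<le> ?b n" for n
    using x by (intro nat_mono floor_mono mult_right_mono) auto
  have bn: "?b n \<le> n" for n
  proof -
    have "(x 0 + x 1) * real n \<le> 1 * real n" using x by (intro mult_right_mono) auto
    then show ?thesis by linarith
  qed
  show P: "parts_for BB (interval_parts x n)" for n
    unfolding parts_for_def verts_BB disjoint_family_on_def interval_parts_def using ab[of n] bn[of n] by auto
  show "nverts (blowup BB (interval_parts x n)) = n"
  proof -
    have "verts (blowup BB (interval_parts x n)) = {..<n}"
      unfolding blowup_BB(2)[OF P] interval_parts_def using ab[of n] bn[of n] by auto
    then show ?thesis by simp
  qed
  show "(\<lambda>n. real (card (interval_parts x n i)) / real n) \<longlonglongrightarrow> x i" if "i < 3"
  proof -
    have la: "(\<lambda>n. real (?a n) / real n) \<longlonglongrightarrow> x 0" by (rule floor_limit) (use x in simp)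
    have lb: "(\<lambda>n. real (?b n) / real n) \<longlonglongrightarrow> x 0 + x 1" by (rule floor_limit) (use x in simp)
    have ln: "(\<lambda>n. real n / real n) \<longlonglongrightarrow> 1"
      by (rule tendsto_eventually) (use eventually_gt_at_top[of 0] in eventually_elim, simp)
    consider "i = 0" | "i = 1" | "i = 2" using \<open>i < 3\<close> by linarith
    then show ?thesis
    proof cases
      case 1
      then show ?thesis using la by (simp add: interval_parts_def)
    next
      case 2
      then show ?thesis using tendsto_diff[OF lb la] ab
        by (simp add: interval_parts_def of_nat_diff diff_divide_distrib)
    next
      case 3
      have "x 2 = 1 - (x 0 + x 1)" using x(4) by simp
      then show ?thesis using tendsto_diff[OF ln lb] bn 3
        by (simp add: interval_parts_def of_nat_diff diff_divide_distrib)
    qed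
  qed
qed

lemma prob_simplex3:
  assumes "x \<in> prob_simplex 3"
  shows "0 \<le> x 0" "0 \<le> x 1" "0 \<le> x 2" "x 0 + x 1 + x 2 = 1"
  using assms unfolding prob_simplex_def by (auto simp: eval_nat_numeral One_nat_def)

lemma blowup_density_F4:
  assumes x: "x \<in> prob_simplex 3"
  shows "blowup_density F4 BB x = 60 * F4_poly x"
  unfolding blowup_density_def
proof (rule the_equality)
  note x' = prob_simplex3[OF x]
  show "\<forall>V. (\<forall>n. parts_for BB (V n)) \<and> (\<forall>i\<in>verts BB. (\<lambda>n. real (card (V n i)) / real n) \<longlonglongrightarrow> x i) \<longrightarrow>
      (\<lambda>n. ind_density F4 (blowup BB (V n))) \<longlonglongrightarrow> 60 * F4_poly x"
  proof (intro allI impI)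
    fix V :: "nat \<Rightarrow> nat \<Rightarrow> nat set"
    assume V: "(\<forall>n. parts_for BB (V n)) \<and> (\<forall>i\<in>verts BB. (\<lambda>n. real (card (V n i)) / real n) \<longlonglongrightarrow> x i)"
    show "(\<lambda>n. ind_density F4 (blowup BB (V n))) \<longlonglongrightarrow> 60 * F4_poly x"
    proof (rule blowup_density_limit[OF _ _ x'(4)])
      show "parts_for BB (V n)" for n using V by blast
      show "(\<lambda>n. real (card (V n i)) / real n) \<longlonglongrightarrow> x i" if "i < 3" for i
      proof -
        have "i \<in> verts BB" using that by (simp add: on_first_def)
        then show ?thesis using V by blast
      qed
    qed
  qed
  fix L assume "\<forall>V. (\<forall>n. parts_for BB (V n)) \<and> (\<forall>i\<in>verts BB. (\<lambda>n. real (card (V n i)) / real n) \<longlonglongrightarrow> x i) \<longrightarrow>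
      (\<lambda>n. ind_density F4 (blowup BB (V n))) \<longlonglongrightarrow> L"
  moreover have "(\<forall>n. parts_for BB (interval_parts x n)) \<and> (\<forall>i\<in>verts BB. (\<lambda>n. real (card (interval_parts x n i)) / real n) \<longlonglongrightarrow> x i)"
    using interval_parts[OF x'] by (simp add: on_first_def)
  ultimately have "(\<lambda>n. ind_density F4 (blowup BB (interval_parts x n))) \<longlonglongrightarrow> L" by blast
  moreover have "(\<lambda>n. ind_density F4 (blowup BB (interval_parts x n))) \<longlonglongrightarrow> 60 * F4_poly x"
    by (rule blowup_density_limit[OF interval_parts(1,2)[OF x'] x'(4)])
  ultimately show "L = 60 * F4_poly x" by (rule LIMSEQ_unique)
qed

text \<open>
  With \<open>u = x 1\<close> and \<open>v = x 2\<close>, the identity \<open>8 u v (u\<^sup>2 + v\<^sup>2) = (u + v)\<^sup>4 - (u - v)\<^sup>4\<close> separates the balance of the two adjacent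
  parts from their total size. What is left is the square of \<open>a (1 - a)\<^sup>2\<close> with \<open>a = x 0\<close>, whose maximum \<open>4 / 27\<close> is attained at \<open>1 / 3\<close>
  only. The same inequality gives uniqueness of the maximiser and the quantitative balance needed for stability.
\<close>

lemma F4_poly_deficit:
  assumes "0 \<le> x 0" "0 \<le> x 1" "0 \<le> x 2" "x 0 + x 1 + x 2 = 1"
  shows "(x 0 - 1 / 3)\<^sup>2 * (4 / 3 - x 0) * (4 / 27) + (x 0)\<^sup>2 * (x 1 - x 2) ^ 4 \<le> 16 / 729 - 8 * F4_poly x"
proof -
  define a where "a = x 0"
  define q where "q = a * (1 - a)\<^sup>2"
  have s: "x 1 + x 2 = 1 - a" using assms(4) by (simp add: a_def)
  have a: "0 \<le> a" "a \<le> 1" using assms by (simp_all add: a_def)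
  have "(x 1 + x 2) ^ 4 = 8 * (x 1 * x 2 * ((x 1)\<^sup>2 + (x 2)\<^sup>2)) + (x 1 - x 2) ^ 4"
    by (simp add: eval_nat_numeral One_nat_def algebra_simps)
  then have e: "8 * (x 1 * x 2 * ((x 1)\<^sup>2 + (x 2)\<^sup>2)) = (1 - a) ^ 4 - (x 1 - x 2) ^ 4" unfolding s by linarith
  have "8 * F4_poly x = a\<^sup>2 * (8 * (x 1 * x 2 * ((x 1)\<^sup>2 + (x 2)\<^sup>2)))"
    unfolding F4_poly_def a_def by simp
  also have "\<dots> = q\<^sup>2 - a\<^sup>2 * (x 1 - x 2) ^ 4"
    unfolding e q_def by (simp add: power_mult_distrib right_diff_distrib flip: power_mult)
  finally have 1: "8 * F4_poly x = q\<^sup>2 - a\<^sup>2 * (x 1 - x 2) ^ 4" .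
  have d: "4 / 27 - q = (a - 1 / 3)\<^sup>2 * (4 / 3 - a)"
    unfolding q_def by (simp add: power2_eq_square algebra_simps)
  have "0 \<le> q" unfolding q_def using a by simp
  moreover have "0 \<le> 4 / 27 - q" unfolding d using a by (intro mult_nonneg_nonneg) auto
  ultimately have "(4 / 27 - q) * (4 / 27) \<le> (4 / 27 - q) * (4 / 27 + q)" by (intro mult_left_mono) auto
  also have "\<dots> = 16 / 729 - q\<^sup>2" by (simp add: algebra_simps power2_eq_square)
  finally show ?thesis using 1 d by (simp add: a_def)
qed

lemma F4_poly_third: "F4_poly (\<lambda>i\<in>{..<3}. 1 / 3) = 2 / 729"
  by (simp add: F4_poly_def power2_eq_square)

lemma third_prob_simplex: "(\<lambda>i\<in>{..<3}. 1 / 3) \<in> prob_simplex 3"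
  unfolding prob_simplex_def by (simp add: lessThan3)

lemma nverts_BB [simp]: "nverts BB = 3"
  by (simp add: on_first_def)

theorem unique_maximiser_F4: "unique_maximiser F4 BB (\<lambda>i\<in>{..<3}. 1 / 3)"
  unfolding unique_maximiser_def nverts_BB
proof (intro conjI ballI impI)
  show "(\<lambda>i\<in>{..<3}. 1 / 3) \<in> prob_simplex 3" by (rule third_prob_simplex)
  fix y :: "nat \<Rightarrow> real" assume y: "y \<in> prob_simplex 3"
  note y' = prob_simplex3[OF y] and D = F4_poly_deficit[OF prob_simplex3[OF y]]
  have n1: "0 \<le> (y 0 - 1 / 3)\<^sup>2 * (4 / 3 - y 0) * (4 / 27)" using y' by (intro mult_nonneg_nonneg) auto
  have n2: "0 \<le> (y 0)\<^sup>2 * (y 1 - y 2) ^ 4" by simp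
  show "blowup_density F4 BB y \<le> blowup_density F4 BB (\<lambda>i\<in>{..<3}. 1 / 3)"
    unfolding blowup_density_F4[OF y] blowup_density_F4[OF third_prob_simplex] F4_poly_third using D n1 n2 by linarith
  assume "blowup_density F4 BB y = blowup_density F4 BB (\<lambda>i\<in>{..<3}. 1 / 3)"
  then have "F4_poly y = 2 / 729"
    unfolding blowup_density_F4[OF y] blowup_density_F4[OF third_prob_simplex] F4_poly_third by simp
  then have z: "(y 0 - 1 / 3)\<^sup>2 * (4 / 3 - y 0) * (4 / 27) = 0" "(y 0)\<^sup>2 * (y 1 - y 2) ^ 4 = 0"
    using D n1 n2 by linarith+
  have "y 0 = 1 / 3" using z(1) y' by auto
  moreover have "y 1 = y 2" using z(2) calculation by simp
  ultimately have "y i = 1 / 3" if "i < 3" for i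
  proof -
    consider "i = 0" | "i = 1" | "i = 2" using \<open>i < 3\<close> by linarith
    then show ?thesis using \<open>y 0 = 1 / 3\<close> \<open>y 1 = y 2\<close> y'(4) by cases auto
  qed
  then show "\<exists>\<pi>. automorphism \<pi> BB \<and> (\<forall>i\<in>verts BB. y i = (\<lambda>i\<in>{..<3}. 1 / 3) (\<pi> i))"
    by (intro exI[of _ id]) (auto simp: isomorphism_def on_first_def)
qed

section \<open>Maximum densities\<close>

lemma finite_densities:
  "finite {ind_density F G | G. simple_graph G \<and> nverts G = n \<and> (\<forall>H\<in>\<H>. ind_count H G = 0)}"
proof (rule finite_subset)
  show "{ind_density F G | G. simple_graph G \<and> nverts G = n \<and> (\<forall>H\<in>\<H>. ind_count H G = 0)} \<subseteq>
      (\<lambda>k. real k / real (n choose nverts F)) ` {..2 ^ n}"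
  proof
    fix d assume "d \<in> {ind_density F G | G. simple_graph G \<and> nverts G = n \<and> (\<forall>H\<in>\<H>. ind_count H G = 0)}"
    then obtain G where G: "simple_graph G" "nverts G = n" "d = ind_density F G" by blast
    have fin: "finite (verts G)" using G(1) by (simp add: simple_graph_def)
    have "ind_count F G \<le> card (Pow (verts G))"
      unfolding ind_count_def using fin by (intro card_mono) auto
    also have "\<dots> = 2 ^ n" using fin G(2) by (simp add: card_Pow)
    finally show "d \<in> (\<lambda>k. real k / real (n choose nverts F)) ` {..2 ^ n}"
      unfolding G(3) ind_density_def G(2) by auto
  qed
qed simp

lemma max_density_ge:
  assumes "simple_graph G"
  shows "ind_density F G \<le> max_density F (nverts G)"
proof -
  have "ind_density F G \<in> {ind_density F H | H. simple_graph H \<and> nverts H = nverts G \<and> (\<forall>K\<in>{}. ind_count K H = 0)}"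
    using assms by blast
  then show ?thesis unfolding max_density_free_def by (intro Max_ge finite.insertI finite_densities insertI2)
qed

lemma max_density_free_le:
  assumes "0 \<le> c" "\<And>G. simple_graph G \<Longrightarrow> nverts G = n \<Longrightarrow> (\<And>H. H \<in> \<H> \<Longrightarrow> ind_count H G = 0) \<Longrightarrow> ind_density F G \<le> c"
  shows "max_density_free \<H> F n \<le> c"
  unfolding max_density_free_def using assms finite_densities[of F n \<H>] by (subst Max_le_iff) auto

lemma max_density_free_nonneg: "0 \<le> max_density_free \<H> F n"
  unfolding max_density_free_def using finite_densities[of F n \<H>] by (intro Max_ge) auto

theorem max_density_limit: "max_density F4 \<longlonglongrightarrow> 40 / 243"
proof (rule tendsto_sandwich)
  let ?x = "\<lambda>i\<in>{..<3::nat}. 1 / 3 :: real"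
  let ?G = "\<lambda>n. blowup BB (interval_parts ?x n)"
  note x = prob_simplex3[OF third_prob_simplex]
  show "\<forall>\<^sub>F n in sequentially. ind_density F4 (?G n) \<le> max_density F4 n"
  proof (rule always_eventually, rule allI)
    fix n show "ind_density F4 (?G n) \<le> max_density F4 n"
      using max_density_ge[OF blowup_BB(1)[OF interval_parts(1)[OF x, of n]], of F4] unfolding interval_parts(3)[OF x, of n] .
  qed
  show "(\<lambda>n. ind_density F4 (?G n)) \<longlonglongrightarrow> 40 / 243"
  proof -
    have "60 * F4_poly ?x = 40 / 243" unfolding F4_poly_third by simp
    moreover have "(\<lambda>n. ind_density F4 (?G n)) \<longlonglongrightarrow> 60 * F4_poly ?x"
      by (rule blowup_density_limit[OF interval_parts(1)[OF x] interval_parts(2)[OF x] x(4)])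
    ultimately show ?thesis by (simp only:)
  qed
  show "\<forall>\<^sub>F n in sequentially. max_density F4 n \<le> 1 / 4374 / (real (n choose 6) / real n ^ 6)"
    using eventually_ge_at_top[of 6]
  proof eventually_elim
    case (elim n)
    show ?case
    proof (rule max_density_free_le)
      fix G assume G: "simple_graph G" "nverts G = n"
      have c: "0 < real (n choose 6)" using elim by simp
      have "12 * real (ind_count F4 G) \<le> 2 / 729 * real n ^ 6"
        using ind_count_le_star_count[OF G(1)] star_count_bound[OF G(1)] G(2) by simp
      then have "real (ind_count F4 G) \<le> real n ^ 6 / 4374" by simp
      then have "real (ind_count F4 G) / real (n choose 6) \<le> real n ^ 6 / 4374 / real (n choose 6)"
        using c by (intro divide_right_mono) auto
      then show "ind_density F4 G \<le> 1 / 4374 / (real (n choose 6) / real n ^ 6)"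
        unfolding ind_density_def G(2) by simp
    qed simp
  qed
  have "(\<lambda>n. real n / real n) \<longlonglongrightarrow> 1"
    by (rule tendsto_eventually) (use eventually_gt_at_top[of 0] in eventually_elim, simp)
  then have "(\<lambda>n. 1 / 4374 / (real (n choose 6) / real n ^ 6)) \<longlonglongrightarrow> 1 / 4374 / (1 / 720)"
    by (intro tendsto_intros choose6_limit) simp_all
  then show "(\<lambda>n. 1 / 4374 / (real (n choose 6) / real n ^ 6)) \<longlonglongrightarrow> 40 / 243" by simp
qed

lemma lambda_F4: "lambda F4 = 40 / 243"
  unfolding lambda_free_def using max_density_limit by (rule limI)

lemma labelled_star:
  assumes G: "simple_graph G" and "ind_count F4 G \<noteq> 0"
  obtains \<phi> where "\<phi> \<in> inj_tuples (verts G)" "star (pull \<phi> (adj G)) 0 1 2 3 4 5"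
proof -
  have "(\<Sum>\<phi>\<in>inj_tuples (verts G). of_bool (star (pull \<phi> (adj G)) 0 1 2 3 4 5) :: real) \<noteq> 0"
    unfolding ind_count_F4[OF G, symmetric] using assms(2) by simp
  then obtain \<phi> where "\<phi> \<in> inj_tuples (verts G)" "(of_bool (star (pull \<phi> (adj G)) 0 1 2 3 4 5) :: real) \<noteq> 0"
    by (rule sum.not_neutral_contains_not_neutral)
  then show ?thesis using that by (auto split: if_splits)
qed

lemma ind_count_pos:
  assumes G: "simple_graph G" and H: "finite (verts H)" and h: "inj_on h (verts H)" "h ` verts H \<subseteq> verts G"
    and adj: "\<And>x y. x \<in> verts H \<Longrightarrow> y \<in> verts H \<Longrightarrow> adj H x y = adj G (h x) (h y)"
  shows "ind_count H G \<noteq> 0"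
proof -
  have "isomorphism h H (induced G (h ` verts H))"
    unfolding isomorphism_def using h adj by (auto simp: bij_betw_def adj_induced)
  then have "isomorphic (induced G (h ` verts H)) H" using isomorphic_sym unfolding isomorphic_def by blast
  then have "h ` verts H \<in> {X. X \<subseteq> verts G \<and> card X = nverts H \<and> isomorphic (induced G X) H}"
    using h by (simp add: card_image)
  moreover have "finite {X. X \<subseteq> verts G \<and> card X = nverts H \<and> isomorphic (induced G X) H}"
    using G by (simp add: simple_graph_def)
  ultimately show ?thesis unfolding ind_count_def by auto
qed

text \<open>
  If every graph with a star contains \<open>H\<close>, then excluding \<open>H\<close> excludes the star. This covers both the edge and the pattern,
  which are induced subgraphs of the star with isolated vertices.
\<close>

lemma lambda_free_zero:
  assumes "\<And>G. simple_graph G \<Longrightarrow> ind_count F4 G \<noteq> 0 \<Longrightarrow> ind_count H G \<noteq> 0"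
  shows "lambda_free {H} F4 = 0"
proof -
  have "max_density_free {H} F4 n = 0" for n
  proof (rule antisym)
    show "max_density_free {H} F4 n \<le> 0"
    proof (rule max_density_free_le)
      fix G assume "simple_graph G" "\<And>K. K \<in> {H} \<Longrightarrow> ind_count K G = 0"
      then have "ind_count F4 G = 0" using assms by blast
      then show "ind_density F4 G \<le> 0" by (simp add: ind_density_def)
    qed simp
  qed (rule max_density_free_nonneg)
  then have "max_density_free {H} F4 = (\<lambda>_. 0)" by (intro ext)
  then show ?thesis unfolding lambda_free_def by (simp add: limI)
qed

abbreviation edge_graph :: pgraph where
  "edge_graph \<equiv> on_first 2 {{0,1}}"

lemma lambda_free_edge: "lambda_free {edge_graph} F4 = 0"
proof (rule lambda_free_zero)
  fix G assume G: "simple_graph G" "ind_count F4 G \<noteq> 0"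
  obtain \<phi> where \<phi>: "\<phi> \<in> inj_tuples (verts G)" "star (pull \<phi> (adj G)) 0 1 2 3 4 5" using labelled_star[OF G] .
  show "ind_count edge_graph G \<noteq> 0"
  proof (rule ind_count_pos[OF G(1), of _ \<phi>])
    have v: "verts edge_graph = {0, 1}" by (simp add: on_first_def lessThan2)
    have m: "\<phi> k \<in> verts G" if "k < 6" for k using \<phi>(1) that unfolding inj_tuples_def by (simp add: PiE_iff)
    show "finite (verts edge_graph)" by (simp add: v)
    show "inj_on \<phi> (verts edge_graph)" unfolding v by (simp add: inj_on_def inj_tuples_eq[OF \<phi>(1)])
    show "\<phi> ` verts edge_graph \<subseteq> verts G" unfolding v by (simp add: m)
    show "adj edge_graph x y = adj G (\<phi> x) (\<phi> y)" if "x \<in> verts edge_graph" "y \<in> verts edge_graph" for x y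
      using that \<phi>(2) adj_irrefl[OF G(1)] adj_commute[of G "\<phi> 1" "\<phi> 0"] unfolding v star_def
      by (auto simp: adj_def on_first_def doubleton_eq_iff)
  qed
qed

lemma lambda_free_BB: "lambda_free {remove_loops BB} F4 = 0"
proof (rule lambda_free_zero)
  fix G assume G: "simple_graph G" "ind_count F4 G \<noteq> 0"
  obtain \<phi> where \<phi>: "\<phi> \<in> inj_tuples (verts G)" "star (pull \<phi> (adj G)) 0 1 2 3 4 5" using labelled_star[OF G] .
  have "card {1, 2 :: nat} = 2" by (simp add: card_insert_if)
  then have B: "remove_loops BB = BB" unfolding remove_loops_def on_first_def by auto
  have m: "\<phi> k \<in> verts G" if "k < 6" for k using \<phi>(1) that unfolding inj_tuples_def by (simp add: PiE_iff)
  define h where "h i = \<phi> (if i = 0 then 4 else if i = 1 then 0 else 1)" for i :: nat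
  show "ind_count (remove_loops BB) G \<noteq> 0"
    unfolding B
  proof (rule ind_count_pos[OF G(1), of _ h])
    show "finite (verts BB)" by (simp add: verts_BB)
    show "inj_on h (verts BB)" unfolding verts_BB h_def by (simp add: inj_on_def inj_tuples_eq[OF \<phi>(1)])
    show "h ` verts BB \<subseteq> verts G" unfolding verts_BB by (simp add: h_def m)
    have a: "adj G (\<phi> 1) (\<phi> 0)" "\<not> adj G (\<phi> 4) (\<phi> 0)" "\<not> adj G (\<phi> 4) (\<phi> 1)" "adj G (\<phi> 0) (\<phi> 1)"
      "\<not> adj G (\<phi> 0) (\<phi> 4)" "\<not> adj G (\<phi> 1) (\<phi> 4)"
      using \<phi>(2) adj_commute[of G] unfolding star_def by auto
    show "adj BB x y = adj G (h x) (h y)" if "x \<in> verts BB" "y \<in> verts BB" for x y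
    proof -
      have "adj BB x y \<longleftrightarrow> {x, y} = {1, 2}" by (simp add: adj_def edges_BB)
      then show ?thesis using that a adj_irrefl[OF G(1)] unfolding verts_BB h_def
        by (auto simp: doubleton_eq_iff)
    qed
  qed
qed

lemma tau_condition_F4: "tau_condition F4 BB 6 edge_graph"
proof -
  have v: "verts edge_graph = {0, 1}" by (simp add: on_first_def lessThan2)
  have e: "adj edge_graph x y \<longleftrightarrow> {x, y} = {0, 1}" for x y by (simp add: adj_def on_first_def)
  have b: "adj BB x y \<longleftrightarrow> {x, y} = {1, 2}" for x y by (simp add: adj_def edges_BB)
  have homs: "f \<in> homs edge_graph BB \<longleftrightarrow> f \<in> extensional {0, 1} \<and> {f 0, f 1} = {1, 2}" for f
    unfolding homs_def v e b verts_BB by (auto simp: PiE_def Pi_def doubleton_eq_iff)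
  define f0 where "f0 = (\<lambda>i\<in>{0, 1::nat}. i + 1)"
  have f0: "f0 \<in> homs edge_graph BB" "f0 0 = 1" "f0 1 = 2" unfolding homs f0_def by simp_all
  have aut: "\<exists>\<pi>. automorphism \<pi> BB \<and> (\<forall>v\<in>verts edge_graph. g v = \<pi> (f0 v))" if g: "g \<in> homs edge_graph BB" for g
  proof -
    have "g 0 = 1 \<and> g 1 = 2 \<or> g 0 = 2 \<and> g 1 = 1" using g unfolding homs by (auto simp: doubleton_eq_iff)
    then show ?thesis
    proof
      assume "g 0 = 1 \<and> g 1 = 2"
      then show ?thesis by (intro exI[of _ id]) (auto simp: isomorphism_def v f0)
    next
      assume g': "g 0 = 2 \<and> g 1 = 1"
      have "isomorphism (swap 1 2) BB BB"
        unfolding isomorphism_def b verts_BB bij_betw_def by (auto simp: swap_def inj_on_def doubleton_eq_iff)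
      then show ?thesis using g' by (intro exI[of _ "swap 1 2"]) (auto simp: v f0 swap_def)
    qed
  qed
  have nb: "nbhd BB x \<inter> f ` verts edge_graph \<noteq> nbhd BB y \<inter> f ` verts edge_graph"
    if f: "f \<in> homs edge_graph BB" and xy: "x \<in> verts BB" "y \<in> verts BB" "x \<noteq> y" for f x y
  proof -
    have im: "f ` verts edge_graph = {1, 2}" using f unfolding homs v by auto
    have N: "nbhd BB 0 = {}" "nbhd BB 1 = {2}" "nbhd BB 2 = {1}"
      unfolding nbhd_def b verts_BB by (auto simp: doubleton_eq_iff)
    show ?thesis using xy N unfolding im verts_BB by auto
  qed
  have s1: "simple_graph edge_graph" by (auto simp: simple_graph_def on_first_def)
  have s2: "nverts edge_graph + 2 \<le> 6" by (simp add: on_first_def)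
  have s3: "lambda_free {edge_graph} F4 < lambda F4" unfolding lambda_free_edge lambda_F4 by simp
  show ?thesis unfolding tau_condition_def
    by (intro conjI s1 s2 s3 bexI[OF _ f0(1)] ballI impI aut nb)
qed

theorem criterion_F4: "criterion_ii F4 BB 6 edge_graph"
proof -
  have "simple_graph F4" by (auto simp: simple_graph_def on_first_def)
  moreover have "pattern BB" by (auto simp: pattern_def on_first_def)
  moreover have "verts BB = {..<nverts BB}" by (simp add: on_first_def)
  moreover have "certified_at F4 BB 6 (\<lambda>i\<in>{..<3}. 1 / 3)"
    unfolding certified_at_def blowup_density_F4[OF third_prob_simplex] F4_poly_third
    using certificate_F4 F4_slack_zero by (intro exI[of _ F4_matrix] exI[of _ F4_slack]) simp
  then have "\<exists>a\<in>prob_simplex (nverts BB). (\<forall>i\<in>verts BB. 0 < a i) \<and> certified_at F4 BB 6 a"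
    using third_prob_simplex by (intro bexI[of _ "\<lambda>i\<in>{..<3}. 1 / 3"]) (auto simp: on_first_def)
  moreover have "\<forall>x\<in>verts BB. \<not> adj BB x x" by (auto simp: adj_def edges_BB doubleton_eq_iff)
  moreover have "lambda_free {remove_loops BB} F4 < lambda F4" unfolding lambda_free_BB lambda_F4 by simp
  ultimately show ?thesis unfolding criterion_ii_def using tau_condition_F4 by simp
qed

section \<open>Perfect stability\<close>

text \<open>
  The ordered pairs on which a graph differs from the blowup given by a partition.
\<close>

definition wrong :: "nat set \<Rightarrow> (nat \<Rightarrow> nat \<Rightarrow> bool) \<Rightarrow> (nat \<Rightarrow> nat) \<Rightarrow> (nat \<times> nat) set" where
  "wrong V A f = {(x, y) \<in> V \<times> V. x \<noteq> y \<and> A x y \<noteq> part_adj f x y}"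

lemma finite_wrong: "finite V \<Longrightarrow> finite (wrong V A f)"
  by (rule finite_subset[of _ "V \<times> V"]) (auto simp: wrong_def)

lemma card_wrong_le:
  assumes "finite V"
  shows "card (wrong V A f) \<le> (card V)\<^sup>2"
proof -
  have "card (wrong V A f) \<le> card (V \<times> V)" using assms by (intro card_mono) (auto simp: wrong_def)
  then show ?thesis by (simp add: card_cartesian_product power2_eq_square)
qed

lemma part_adj_commute: "part_adj f x y = part_adj f y x"
  by (auto simp: part_adj_iff)

lemma part_adj_irrefl: "\<not> part_adj f x x"
  by (auto simp: part_adj_iff)

definition part_graph :: "nat set \<Rightarrow> (nat \<Rightarrow> nat) \<Rightarrow> pgraph" where
  "part_graph V f = (V, {{x, y} | x y. x \<in> V \<and> y \<in> V \<and> part_adj f x y})"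

lemma verts_part_graph [simp]: "verts (part_graph V f) = V"
  by (simp add: part_graph_def)

lemma simple_part_graph: "finite V \<Longrightarrow> simple_graph (part_graph V f)"
  unfolding simple_graph_def part_graph_def using part_adj_irrefl by (auto simp: card_insert_if)

lemma adj_part_graph: "x \<in> V \<Longrightarrow> y \<in> V \<Longrightarrow> adj (part_graph V f) x y = part_adj f x y"
  unfolding adj_def part_graph_def using part_adj_commute[of f] by (auto simp: doubleton_eq_iff)

lemma part_graph_blowup:
  assumes "finite V" and f: "\<And>x. f x < 3"
  shows "part_graph V f \<in> blowups BB"
proof -
  let ?P = "\<lambda>i. {x \<in> V. f x = i}"
  have f3: "f x \<in> {0, 1, 2}" for x using f[of x] by auto
  have "parts_for BB ?P" using assms(1) unfolding parts_for_def disjoint_family_on_def by auto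
  moreover have "blowup BB ?P = part_graph V f"
  proof (rule prod_eqI)
    show "fst (blowup BB ?P) = fst (part_graph V f)"
      unfolding blowup_def part_graph_def verts_BB fst_conv using f3 by blast
    have "(x \<noteq> y \<and> (\<exists>i\<in>{0, 1, 2}. \<exists>j\<in>{0, 1, 2}. x \<in> ?P i \<and> y \<in> ?P j \<and> {i, j} \<in> {{1, 2}})) \<longleftrightarrow>
        (x \<in> V \<and> y \<in> V \<and> part_adj f x y)" for x y
    proof
      assume "x \<in> V \<and> y \<in> V \<and> part_adj f x y"
      moreover from this have "x \<noteq> y" using part_adj_irrefl[of f] by metis
      ultimately show "x \<noteq> y \<and> (\<exists>i\<in>{0, 1, 2}. \<exists>j\<in>{0, 1, 2}. x \<in> ?P i \<and> y \<in> ?P j \<and> {i, j} \<in> {{1, 2}})"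
        using f3[of x] f3[of y] unfolding part_adj_def
        by (intro conjI bexI[of _ "f x"] bexI[of _ "f y"]) simp_all
    next
      assume "x \<noteq> y \<and> (\<exists>i\<in>{0, 1, 2}. \<exists>j\<in>{0, 1, 2}. x \<in> ?P i \<and> y \<in> ?P j \<and> {i, j} \<in> {{1, 2}})"
      then obtain i j where "x \<in> ?P i" "y \<in> ?P j" "{i, j} \<in> {{1, 2}}" by (elim conjE bexE)
      then show "x \<in> V \<and> y \<in> V \<and> part_adj f x y" unfolding part_adj_def by simp
    qed
    then show "snd (blowup BB ?P) = snd (part_graph V f)"
      unfolding blowup_def part_graph_def verts_BB edges_BB snd_conv by presburger
  qed
  ultimately have "parts_for BB ?P \<and> part_graph V f = blowup BB ?P" by simp
  then show ?thesis unfolding blowups_def by (intro CollectI exI[of _ ?P]) simp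
qed

lemma edit_dist_le:
  assumes G: "simple_graph G" and f: "\<And>x. f x < 3"
  shows "edit_dist G BB \<le> card (wrong (verts G) (adj G) f)"
proof -
  let ?H = "part_graph (verts G) f"
  let ?D = "(edges G - edges ?H) \<union> (edges ?H - edges G)"
  have fin: "finite (verts G)" using G by (simp add: simple_graph_def)
  have H: "simple_graph ?H" by (rule simple_part_graph[OF fin])
  have ex: "\<exists>G'. simple_graph G' \<and> verts G' = verts G \<and> (\<exists>H\<in>blowups BB. isomorphic G' H) \<and>
      card ?D = card ((edges G - edges G') \<union> (edges G' - edges G))"
    using H part_graph_blowup[of "verts G" f, OF fin f] isomorphic_refl[of ?H] by (intro exI[of _ ?H]) auto
  have "edit_dist G BB \<le> card ?D" unfolding edit_dist_def by (rule Least_le) (rule ex)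
  also have "?D \<subseteq> (\<lambda>(x, y). {x, y}) ` wrong (verts G) (adj G) f"
  proof
    fix e assume e: "e \<in> ?D"
    then have "e \<subseteq> verts G" "card e = 2" using G H unfolding simple_graph_def by auto
    then obtain x y where xy: "e = {x, y}" "x \<noteq> y" "x \<in> verts G" "y \<in> verts G"
      unfolding card_2_iff by blast
    have "adj G x y \<noteq> adj ?H x y" using e xy(1) unfolding adj_def by blast
    then have "(x, y) \<in> wrong (verts G) (adj G) f" using xy by (simp add: wrong_def adj_part_graph)
    then show "e \<in> (\<lambda>(x, y). {x, y}) ` wrong (verts G) (adj G) f" using xy(1) by (intro image_eqI[of _ _ "(x, y)"]) simp
  qed
  then have "card ?D \<le> card ((\<lambda>(x, y). {x, y}) ` wrong (verts G) (adj G) f)"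
    by (intro card_mono finite_imageI finite_wrong fin)
  also have "\<dots> \<le> card (wrong (verts G) (adj G) f)" by (intro card_image_le finite_wrong fin)
  finally show ?thesis .
qed

text \<open>
  In a blowup of the pattern, any edge \<open>uv\<close> determines the parts: the neighbours of \<open>u\<close>, the neighbours of \<open>v\<close>, and the rest.
\<close>

definition parts_of_edge :: "(nat \<Rightarrow> nat \<Rightarrow> bool) \<Rightarrow> nat \<Rightarrow> nat \<Rightarrow> nat \<Rightarrow> nat" where
  "parts_of_edge A u v x = (if A x u \<and> \<not> A x v then 2 else if A x v \<and> \<not> A x u then 1 else 0)"

lemma parts_of_edge_less: "parts_of_edge A u v x < 3"
  by (simp add: parts_of_edge_def)

text \<open>
  A colouring of four vertices is forced by the edge between the first two, so it has to agree with the partition that the edge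
  determines; a wrong pair contradicts this.
\<close>

lemma wrong_not_colourable:
  assumes uv: "A (\<phi> 0) (\<phi> 1)" and xy: "(\<phi> 2, \<phi> 3) \<in> wrong V A (parts_of_edge A (\<phi> 0) (\<phi> 1))"
  shows "\<not> colourable (pull \<phi> A)"
proof
  let ?f = "parts_of_edge A (\<phi> 0) (\<phi> 1)"
  assume "colourable (pull \<phi> A)"
  then obtain g where g: "\<And>i j. i < 6 \<Longrightarrow> j < 6 \<Longrightarrow> i \<noteq> j \<Longrightarrow> g i < 3 \<and> (A (\<phi> i) (\<phi> j) \<longleftrightarrow> {g i, g j} = {1, 2::nat})"
    unfolding colourable_def by blast
  have g01: "g 0 = 1 \<and> g 1 = 2 \<or> g 0 = 2 \<and> g 1 = 1" using g[of 0 1] uv by (simp add: doubleton_eq_iff)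
  have a: "A (\<phi> k) (\<phi> 0) \<longleftrightarrow> {g k, g 0} = {1, 2}" "A (\<phi> k) (\<phi> 1) \<longleftrightarrow> {g k, g 1} = {1, 2}"
    "g k = 0 \<or> g k = 1 \<or> g k = 2" if "k = 2 \<or> k = 3" for k
    using g[of k 0] g[of k 1] that by (elim disjE; force)+
  have f: "g 0 = 1 \<Longrightarrow> ?f (\<phi> k) = g k" "g 0 = 2 \<Longrightarrow> ?f (\<phi> k) = (if g k = 0 then 0 else 3 - g k)"
    if "k = 2 \<or> k = 3" for k
    using a[OF that] g01 unfolding parts_of_edge_def by (auto simp: doubleton_eq_iff)
  have "part_adj ?f (\<phi> 2) (\<phi> 3) \<longleftrightarrow> {g 2, g 3} = {1, 2}"
    using g01 f[of 2] f[of 3] a(3)[of 2] a(3)[of 3] unfolding part_adj_iff by (auto simp: doubleton_eq_iff)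
  then show False using xy g[of 2 3] by (simp add: wrong_def)
qed

lemma sum_pairs_of_bool:
  fixes w :: "nat \<Rightarrow> real"
  assumes "finite V" "W \<subseteq> V \<times> V"
  shows "(\<Sum>x\<in>V. \<Sum>y\<in>V. w x * w y * of_bool ((x, y) \<in> W)) = (\<Sum>(x, y)\<in>W. w x * w y)"
proof -
  have "(\<Sum>x\<in>V. \<Sum>y\<in>V. w x * w y * of_bool ((x, y) \<in> W)) = (\<Sum>p\<in>V \<times> V. w (fst p) * w (snd p) * of_bool (p \<in> W))"
    unfolding sum.cartesian_product by (rule sum.cong) auto
  also have "\<dots> = (\<Sum>p\<in>W. w (fst p) * w (snd p) * of_bool (p \<in> W))"
    by (rule sum.mono_neutral_right) (use assms in auto)
  also have "\<dots> = (\<Sum>(x, y)\<in>W. w x * w y)" by (rule sum.cong) auto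
  finally show ?thesis .
qed

lemma sum_last_two:
  fixes w :: "nat \<Rightarrow> real"
  assumes "(\<Sum>x\<in>V. w x) = 1"
  shows "(\<Sum>e\<in>V. \<Sum>f\<in>V. c * w e * w f) = c"
  using assms by (simp add: sum_distrib_left[symmetric] sum_distrib_right[symmetric])

lemma wrong_mean_le_bad_mean:
  assumes V: "finite V" and w: "\<And>x. x \<in> V \<Longrightarrow> 0 \<le> w x" and one: "(\<Sum>x\<in>V. w x) = 1"
  shows "(\<Sum>u\<in>V. \<Sum>v\<in>V. w u * w v * of_bool (A u v) * (\<Sum>(x, y)\<in>wrong V A (parts_of_edge A u v). w x * w y))
    \<le> bad_mean V A w"
proof -
  let ?W = "\<lambda>u v. wrong V A (parts_of_edge A u v)"
  let ?h = "\<lambda>\<phi>. weight w \<phi> * (of_bool (A (\<phi> 0) (\<phi> 1)) * of_bool ((\<phi> 2, \<phi> 3) \<in> ?W (\<phi> 0) (\<phi> 1)))"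
  have "(\<Sum>\<phi>\<in>tuples V. ?h \<phi>) = (\<Sum>a\<in>V. \<Sum>b\<in>V. \<Sum>c\<in>V. \<Sum>d\<in>V. \<Sum>e\<in>V. \<Sum>f\<in>V.
      (w a * w b * of_bool (A a b) * (w c * w d * of_bool ((c, d) \<in> ?W a b))) * w e * w f)"
    unfolding sum_tuples weight_tuple by (intro sum.cong refl) simp
  also have "\<dots> = (\<Sum>a\<in>V. \<Sum>b\<in>V. \<Sum>c\<in>V. \<Sum>d\<in>V. w a * w b * of_bool (A a b) * (w c * w d * of_bool ((c, d) \<in> ?W a b)))"
    unfolding sum_last_two[OF one] ..
  also have "\<dots> = (\<Sum>a\<in>V. \<Sum>b\<in>V. w a * w b * of_bool (A a b) * (\<Sum>(x, y)\<in>?W a b. w x * w y))"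
  proof (intro sum.cong refl)
    fix a b
    have sub: "?W a b \<subseteq> V \<times> V" by (auto simp: wrong_def)
    show "(\<Sum>c\<in>V. \<Sum>d\<in>V. w a * w b * of_bool (A a b) * (w c * w d * of_bool ((c, d) \<in> ?W a b))) =
        w a * w b * of_bool (A a b) * (\<Sum>(x, y)\<in>?W a b. w x * w y)"
      unfolding sum_pairs_of_bool[OF V sub, symmetric] by (simp only: sum_distrib_left)
  qed
  finally have eq: "(\<Sum>\<phi>\<in>tuples V. ?h \<phi>) =
      (\<Sum>u\<in>V. \<Sum>v\<in>V. w u * w v * of_bool (A u v) * (\<Sum>(x, y)\<in>?W u v. w x * w y))" .
  have "(\<Sum>\<phi>\<in>tuples V. ?h \<phi>) \<le> bad_mean V A w"
    unfolding bad_mean_def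
  proof (intro sum_mono mult_left_mono weight_nonneg[where V = V] w)
    fix \<phi>
    show "of_bool (A (\<phi> 0) (\<phi> 1)) * of_bool ((\<phi> 2, \<phi> 3) \<in> ?W (\<phi> 0) (\<phi> 1)) \<le> (of_bool (\<not> colourable (pull \<phi> A)) :: real)"
      using wrong_not_colourable[of A \<phi> V] by auto
  qed
  then show ?thesis unfolding eq .
qed

lemma star_mean_le_edge_mean:
  assumes V: "finite V" and w: "\<And>x. x \<in> V \<Longrightarrow> 0 \<le> w x" and one: "(\<Sum>x\<in>V. w x) = 1"
  shows "star_mean V A w \<le> (\<Sum>u\<in>V. \<Sum>v\<in>V. w u * w v * of_bool (A u v))"
proof -
  have "star_mean V A w \<le> (\<Sum>\<phi>\<in>tuples V. weight w \<phi> * of_bool (A (\<phi> 0) (\<phi> 1)))"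
    unfolding star_mean_def
    by (intro sum_mono mult_left_mono weight_nonneg[where V = V] w) (simp_all add: star_def)
  also have "\<dots> = (\<Sum>a\<in>V. \<Sum>b\<in>V. \<Sum>c\<in>V. \<Sum>d\<in>V. \<Sum>e\<in>V. \<Sum>f\<in>V. (((w a * w b * of_bool (A a b)) * w c * w d) * w e * w f))"
    unfolding sum_tuples weight_tuple by (intro sum.cong refl) simp
  finally show ?thesis unfolding sum_last_two[OF one] .
qed

text \<open>
  If every partition has at least \<open>m\<close> wrong pairs, then so does the partition given by any edge. Together with an edge, such
  a pair spoils a six-tuple, which costs slack. Since stars contain edges, the mean of the edges is at least that of the stars.
\<close>

lemma star_mean_deficit:
  assumes V: "finite V" and w: "\<And>x. x \<in> V \<Longrightarrow> \<mu> \<le> w x" and \<mu>: "0 \<le> \<mu>" and one: "(\<Sum>x\<in>V. w x) = 1"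
    and sym: "\<And>x y. A x y = A y x" and irrefl: "\<And>x. \<not> A x x"
    and m: "\<forall>g. (\<forall>x. g x < 3) \<longrightarrow> m \<le> card (wrong V A g)"
  shows "100776960 * star_mean V A w + \<mu>\<^sup>2 * real m * star_mean V A w \<le> 276480"
proof -
  have w0: "0 \<le> w x" if "x \<in> V" for x using w[OF that] \<mu> by linarith
  have "\<mu>\<^sup>2 * real m * star_mean V A w \<le> \<mu>\<^sup>2 * real m * (\<Sum>u\<in>V. \<Sum>v\<in>V. w u * w v * of_bool (A u v))"
    by (intro mult_left_mono star_mean_le_edge_mean[OF V w0 one]) simp_all
  also have "\<dots> = (\<Sum>u\<in>V. \<Sum>v\<in>V. w u * w v * of_bool (A u v) * (\<mu>\<^sup>2 * real m))"
    by (simp only: sum_distrib_left mult_ac)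
  also have "\<dots> \<le> (\<Sum>u\<in>V. \<Sum>v\<in>V. w u * w v * of_bool (A u v) * (\<Sum>(x, y)\<in>wrong V A (parts_of_edge A u v). w x * w y))"
  proof (intro sum_mono mult_left_mono)
    fix u v assume uv: "u \<in> V" "v \<in> V"
    let ?W = "wrong V A (parts_of_edge A u v)"
    have "\<mu>\<^sup>2 * real m \<le> \<mu>\<^sup>2 * real (card ?W)" using m parts_of_edge_less by (intro mult_left_mono of_nat_mono) auto
    also have "\<dots> = (\<Sum>(x, y)\<in>?W. \<mu> * \<mu>)" by (simp add: power2_eq_square case_prod_unfold)
    also have "\<dots> \<le> (\<Sum>(x, y)\<in>?W. w x * w y)"
      unfolding case_prod_unfold using w w0 \<mu> by (intro sum_mono mult_mono) (auto simp: wrong_def)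
    finally show "\<mu>\<^sup>2 * real m \<le> (\<Sum>(x, y)\<in>?W. w x * w y)" .
    show "0 \<le> w u * w v * of_bool (A u v)" using w0 uv by simp
  qed
  also have "\<dots> \<le> bad_mean V A w" by (rule wrong_mean_le_bad_mean[OF V w0 one])
  finally have "\<mu>\<^sup>2 * real m * star_mean V A w \<le> bad_mean V A w" .
  moreover have "100776960 * star_mean V A w + bad_mean V A w \<le> 276480"
    by (rule star_mean_bound[OF V w0 one sym irrefl])
  ultimately show ?thesis by linarith
qed

definition hits :: "nat set \<Rightarrow> (nat \<times> nat) set \<Rightarrow> (nat \<Rightarrow> nat) set" where
  "hits V W = {\<phi> \<in> tuples V. \<exists>i<6. \<exists>j<6. (\<phi> i, \<phi> j) \<in> W}"

lemma finite_hits: "finite V \<Longrightarrow> finite (hits V W)"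
  unfolding hits_def using finite_tuples by simp

text \<open>
  Tuples that meet a given set of pairs in two fixed positions are determined by that pair and the remaining free coordinates.
\<close>

lemma card_determined:
  assumes V: "finite V" and W: "finite W" and S: "S \<subseteq> tuples V" "\<And>\<phi>. \<phi> \<in> S \<Longrightarrow> (\<phi> i, \<phi> j) \<in> W"
    and D: "D \<subseteq> {..<6}"
    and det: "\<And>\<phi> \<psi> k. \<phi> \<in> S \<Longrightarrow> \<psi> \<in> S \<Longrightarrow> \<phi> i = \<psi> i \<Longrightarrow> \<phi> j = \<psi> j \<Longrightarrow> (\<And>l. l \<in> D \<Longrightarrow> \<phi> l = \<psi> l) \<Longrightarrow> k < 6 \<Longrightarrow> \<phi> k = \<psi> k"
  shows "card S \<le> card W * card V ^ card D"
proof -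
  let ?h = "\<lambda>\<phi>. ((\<phi> i, \<phi> j), restrict \<phi> D)"
  have finD: "finite D" using D finite_subset by blast
  have "card S \<le> card (W \<times> (D \<rightarrow>\<^sub>E V))"
  proof (rule card_inj_on_le[of ?h])
    show "inj_on ?h S"
    proof (rule inj_onI)
      fix \<phi> \<psi> assume *: "\<phi> \<in> S" "\<psi> \<in> S" "?h \<phi> = ?h \<psi>"
      have r: "restrict \<phi> D = restrict \<psi> D" "\<phi> i = \<psi> i" "\<phi> j = \<psi> j" using *(3) by simp_all
      have e: "\<phi> l = \<psi> l" if "l \<in> D" for l using fun_cong[OF r(1), of l] that by simp
      have k: "\<phi> k = \<psi> k" if "k < 6" for k by (rule det[OF *(1,2) r(2,3) e that])
      have "\<phi> \<in> tuples V" "\<psi> \<in> tuples V" using * S(1) by blast+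
      then show "\<phi> = \<psi>" by (rule PiE_ext) (simp add: k)
    qed
    show "?h ` S \<subseteq> W \<times> (D \<rightarrow>\<^sub>E V)"
    proof (rule image_subsetI)
      fix \<phi> assume \<phi>: "\<phi> \<in> S"
      then have "\<phi> \<in> tuples V" using S(1) by blast
      then have "\<phi> k \<in> V" if "k \<in> D" for k using that D by (auto simp: PiE_iff)
      then show "?h \<phi> \<in> W \<times> (D \<rightarrow>\<^sub>E V)" using S(2)[OF \<phi>] by (simp add: restrict_PiE_iff)
    qed
    show "finite (W \<times> (D \<rightarrow>\<^sub>E V))" using W V finD by (intro finite_cartesian_product finite_PiE) auto
  qed
  then show ?thesis using finD by (simp add: card_cartesian_product card_PiE)
qed

lemma card_UN_bound:
  assumes "finite J" "X \<subseteq> (\<Union>p\<in>J. S p)" "\<And>p. p \<in> J \<Longrightarrow> finite (S p)" "\<And>p. p \<in> J \<Longrightarrow> card (S p) \<le> b" "card J \<le> k"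
  shows "card X \<le> k * b"
proof -
  have "card X \<le> card (\<Union>p\<in>J. S p)" using assms by (intro card_mono) auto
  also have "\<dots> \<le> (\<Sum>p\<in>J. card (S p))" by (rule card_UN_le[OF assms(1)])
  also have "\<dots> \<le> card J * b" using sum_bounded_above[of J "\<lambda>p. card (S p)" b] assms(4) by simp
  also have "\<dots> \<le> k * b" using assms(5) by (rule mult_right_mono) simp
  finally show ?thesis .
qed

lemma card_hits:
  assumes V: "finite V" and W: "finite W" "\<And>x. (x, x) \<notin> W"
  shows "card (hits V W) \<le> 36 * (card W * card V ^ 4)"
proof (rule card_UN_bound)
  let ?J = "{p \<in> {..<6} \<times> {..<6::nat}. fst p \<noteq> snd p}"
  let ?S = "\<lambda>p. {\<phi> \<in> tuples V. (\<phi> (fst p), \<phi> (snd p)) \<in> W}"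
  show "finite ?J" by simp
  show "card ?J \<le> 36" using card_mono[of "{..<6} \<times> {..<6::nat}" ?J] by simp
  show "hits V W \<subseteq> (\<Union>p\<in>?J. ?S p)"
  proof
    fix \<phi> assume "\<phi> \<in> hits V W"
    then obtain i j where "\<phi> \<in> tuples V" "i < 6" "j < 6" "(\<phi> i, \<phi> j) \<in> W" unfolding hits_def by blast
    moreover from this have "i \<noteq> j" using W(2) by metis
    ultimately show "\<phi> \<in> (\<Union>p\<in>?J. ?S p)" by (intro UN_I[of "(i, j)"]) simp_all
  qed
  fix p assume p: "p \<in> ?J"
  show "finite (?S p)" using finite_tuples[OF V] by simp
  have "card (?S p) \<le> card W * card V ^ card ({..<6} - {fst p, snd p})"
    by (rule card_determined[OF V W(1), of _ "fst p" "snd p"]) (simp, simp, simp, blast)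
  also have "card ({..<6} - {fst p, snd p}) = 4" using p by (subst card_Diff_subset) auto
  finally show "card (?S p) \<le> card W * card V ^ 4" .
qed

lemma card_noninjective_hits:
  assumes V: "finite V" and W: "finite W" "\<And>x. (x, x) \<notin> W"
  shows "card (hits V W - inj_tuples V) \<le> 1296 * (card W * card V ^ 3)"
proof (rule card_UN_bound)
  let ?J = "{p \<in> ({..<6} \<times> {..<6}) \<times> ({..<6} \<times> {..<6::nat}). fst (fst p) \<noteq> snd (fst p) \<and> fst (snd p) \<noteq> snd (snd p) \<and>
    snd (snd p) \<noteq> fst (fst p) \<and> snd (snd p) \<noteq> snd (fst p)}"
  let ?S = "\<lambda>p. {\<phi> \<in> tuples V. (\<phi> (fst (fst p)), \<phi> (snd (fst p))) \<in> W \<and> \<phi> (fst (snd p)) = \<phi> (snd (snd p))}"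
  show "finite ?J" by simp
  show "card ?J \<le> 1296" using card_mono[of "({..<6} \<times> {..<6}) \<times> ({..<6} \<times> {..<6::nat})" ?J] by simp
  show "hits V W - inj_tuples V \<subseteq> (\<Union>p\<in>?J. ?S p)"
  proof
    fix \<phi> assume \<phi>: "\<phi> \<in> hits V W - inj_tuples V"
    then obtain i j where ij: "\<phi> \<in> tuples V" "i < 6" "j < 6" "(\<phi> i, \<phi> j) \<in> W" unfolding hits_def by blast
    have ne: "\<phi> i \<noteq> \<phi> j" using ij W(2) by metis
    obtain k l where kl: "k < 6" "l < 6" "\<phi> k = \<phi> l" "k \<noteq> l"
      using \<phi> ij(1) unfolding inj_tuples_def inj_on_def by auto
    show "\<phi> \<in> (\<Union>p\<in>?J. ?S p)"
    proof (cases "l = i \<or> l = j")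
      case True
      then have "k \<noteq> i" "k \<noteq> j" using kl ne by metis+
      then show ?thesis using ij kl ne by (intro UN_I[of "((i, j), (l, k))"]) auto
    next
      case False
      then show ?thesis using ij kl ne by (intro UN_I[of "((i, j), (k, l))"]) auto
    qed
  qed
  fix p assume p: "p \<in> ?J"
  show "finite (?S p)" using finite_tuples[OF V] by simp
  let ?D = "{..<6} - {fst (fst p), snd (fst p), snd (snd p)}"
  have "card (?S p) \<le> card W * card V ^ card ?D"
  proof (rule card_determined[OF V W(1), of _ "fst (fst p)" "snd (fst p)"])
    fix \<phi> \<psi> k assume *: "\<phi> \<in> ?S p" "\<psi> \<in> ?S p" "\<phi> (fst (fst p)) = \<psi> (fst (fst p))"
      "\<phi> (snd (fst p)) = \<psi> (snd (fst p))" "\<And>l. l \<in> ?D \<Longrightarrow> \<phi> l = \<psi> l" "k < (6::nat)"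
    have other: "\<phi> l = \<psi> l" if "l \<noteq> snd (snd p)" "l < 6" for l
      using *(3,4) *(5)[of l] that by (cases "l = fst (fst p) \<or> l = snd (fst p)") auto
    show "\<phi> k = \<psi> k"
    proof (cases "k = snd (snd p)")
      case True
      have "\<phi> (fst (snd p)) = \<psi> (fst (snd p))" using p by (intro other) auto
      then show ?thesis using *(1,2) True by simp
    next
      case False
      then show ?thesis using other *(6) by blast
    qed
  qed auto
  also have "card ?D = 3" using p by (subst card_Diff_subset) (auto simp: card_insert_if)
  finally show "card (?S p) \<le> card W * card V ^ 3" .
qed

definition gain :: "(nat \<Rightarrow> nat \<Rightarrow> bool) \<Rightarrow> (nat \<Rightarrow> nat) \<Rightarrow> (nat \<Rightarrow> nat) \<Rightarrow> real" where
  "gain A f \<phi> = of_bool (star (pull \<phi> (part_adj f)) 0 1 2 3 4 5) - of_bool (star (pull \<phi> A) 0 1 2 3 4 5)"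

lemma gain_bound: "\<bar>gain A f \<phi>\<bar> \<le> 1"
  by (simp add: gain_def)

lemma gain_unhit:
  assumes "\<And>x. \<not> A x x" "\<phi> \<in> tuples V" "\<phi> \<notin> hits V (wrong V A f)"
  shows "gain A f \<phi> = 0"
proof -
  have "A (\<phi> i) (\<phi> j) = part_adj f (\<phi> i) (\<phi> j)" if "i < 6" "j < 6" for i j
  proof (cases "\<phi> i = \<phi> j")
    case True
    then show ?thesis using assms(1) part_adj_irrefl by simp
  next
    case False
    have "(\<phi> i, \<phi> j) \<notin> wrong V A f" using assms(2,3) that unfolding hits_def by blast
    then show ?thesis using False that assms(2) by (auto simp: wrong_def PiE_iff)
  qed
  then have "star (pull \<phi> (part_adj f)) 0 1 2 3 4 5 = star (pull \<phi> A) 0 1 2 3 4 5" by (intro star_cong) simp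
  then show ?thesis by (simp add: gain_def)
qed

lemma sum_gain:
  assumes V: "finite V" and irrefl: "\<And>x. \<not> A x x"
  shows "star_mean V (part_adj f) w - star_mean V A w = (\<Sum>\<phi>\<in>hits V (wrong V A f). weight w \<phi> * gain A f \<phi>)"
proof -
  have "star_mean V (part_adj f) w - star_mean V A w = (\<Sum>\<phi>\<in>tuples V. weight w \<phi> * gain A f \<phi>)"
    unfolding star_mean_def gain_def sum_subtractf[symmetric] right_diff_distrib ..
  also have "\<dots> = (\<Sum>\<phi>\<in>hits V (wrong V A f). weight w \<phi> * gain A f \<phi>)"
  proof (rule sum.mono_neutral_right)
    show "finite (tuples V)" by (rule finite_tuples[OF V])
    show "hits V (wrong V A f) \<subseteq> tuples V" by (auto simp: hits_def)
    show "\<forall>\<phi>\<in>tuples V - hits V (wrong V A f). weight w \<phi> * gain A f \<phi> = 0"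
      using gain_unhit[of A _ V f, OF irrefl] by simp
  qed
  finally show ?thesis .
qed

lemma sum_gain_injective:
  assumes G: "simple_graph G"
  shows "12 * real (ind_count F4 (part_graph (verts G) f)) - 12 * real (ind_count F4 G) =
    (\<Sum>\<phi>\<in>hits (verts G) (wrong (verts G) (adj G) f) \<inter> inj_tuples (verts G). gain (adj G) f \<phi>)"
proof -
  let ?V = "verts G" and ?H = "hits (verts G) (wrong (verts G) (adj G) f)"
  have fin: "finite ?V" using G by (simp add: simple_graph_def)
  have sub: "inj_tuples ?V \<subseteq> tuples ?V" by (auto simp: inj_tuples_def)
  have eq: "star (pull \<phi> (adj (part_graph ?V f))) 0 1 2 3 4 5 = star (pull \<phi> (part_adj f)) 0 1 2 3 4 5"
    if "\<phi> \<in> inj_tuples ?V" for \<phi>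
  proof (rule star_cong)
    fix i j :: nat assume "i < 6" "j < 6"
    then have "\<phi> i \<in> ?V" "\<phi> j \<in> ?V" using that sub by (auto simp: PiE_iff)
    then show "adj (part_graph ?V f) (\<phi> i) (\<phi> j) = part_adj f (\<phi> i) (\<phi> j)" by (rule adj_part_graph)
  qed
  have "12 * real (ind_count F4 (part_graph ?V f)) - 12 * real (ind_count F4 G) = (\<Sum>\<phi>\<in>inj_tuples ?V. gain (adj G) f \<phi>)"
    unfolding ind_count_F4[OF G] ind_count_F4[OF simple_part_graph[OF fin]] verts_part_graph gain_def sum_subtractf[symmetric]
    by (intro sum.cong refl) (simp add: eq)
  also have "\<dots> = (\<Sum>\<phi>\<in>?H \<inter> inj_tuples ?V. gain (adj G) f \<phi>)"
  proof (rule sum.mono_neutral_right)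
    show "finite (inj_tuples ?V)" by (rule finite_inj_tuples[OF fin])
    show "?H \<inter> inj_tuples ?V \<subseteq> inj_tuples ?V" by blast
    show "\<forall>\<phi>\<in>inj_tuples ?V - ?H \<inter> inj_tuples ?V. gain (adj G) f \<phi> = 0"
      using gain_unhit[of "adj G" _ ?V f, OF adj_irrefl[OF G]] sub by blast
  qed
  finally show ?thesis .
qed

lemma sum_gain_bound:
  assumes V: "finite V" and c: "\<And>\<phi>. \<phi> \<in> hits V (wrong V A f) \<Longrightarrow> \<bar>c \<phi>\<bar> \<le> b" "0 \<le> b"
  shows "\<bar>\<Sum>\<phi>\<in>hits V (wrong V A f). c \<phi> * gain A f \<phi>\<bar> \<le> 36 * b * real (card (wrong V A f)) * real (card V) ^ 4"
proof -
  let ?H = "hits V (wrong V A f)"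
  have "\<bar>\<Sum>\<phi>\<in>?H. c \<phi> * gain A f \<phi>\<bar> \<le> (\<Sum>\<phi>\<in>?H. \<bar>c \<phi> * gain A f \<phi>\<bar>)" by (rule sum_abs)
  also have "\<dots> \<le> (\<Sum>\<phi>\<in>?H. b)"
  proof (rule sum_mono)
    fix \<phi> assume "\<phi> \<in> ?H"
    then have "\<bar>c \<phi>\<bar> * \<bar>gain A f \<phi>\<bar> \<le> b * 1" using c gain_bound by (intro mult_mono) auto
    then show "\<bar>c \<phi> * gain A f \<phi>\<bar> \<le> b" by (simp add: abs_mult)
  qed
  also have "\<dots> = real (card ?H) * b" by simp
  also have "\<dots> \<le> real (36 * (card (wrong V A f) * card V ^ 4)) * b"
    by (intro mult_right_mono of_nat_mono card_hits V finite_wrong c(2)) (simp add: wrong_def)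
  also have "\<dots> = 36 * b * real (card (wrong V A f)) * real (card V) ^ 4" by simp
  finally show ?thesis .
qed

text \<open>
  Near-extremal part ratios are near \<open>1 / 3\<close>, with explicit dependence.
\<close>

lemma near_balanced:
  assumes x: "0 \<le> x 0" "0 \<le> x 1" "0 \<le> x 2" "x 0 + x 1 + x 2 = 1"
    and \<epsilon>: "0 < \<epsilon>" "\<epsilon> \<le> 1 / 12" and F: "2 / 729 - \<epsilon> ^ 4 / 162 \<le> F4_poly x" and i: "i < 3"
  shows "\<bar>x i - 1 / 3\<bar> \<le> \<epsilon>"
proof -
  have D: "(x 0 - 1 / 3)\<^sup>2 * (4 / 3 - x 0) * (4 / 27) + (x 0)\<^sup>2 * (x 1 - x 2) ^ 4 \<le> 8 * (\<epsilon> ^ 4 / 162)"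
    using F4_poly_deficit[of x] x F by linarith
  have p: "0 \<le> (x 0)\<^sup>2 * (x 1 - x 2) ^ 4" by simp
  have n0: "0 \<le> (x 0 - 1 / 3)\<^sup>2 * (4 / 3 - x 0)" using x by (intro mult_nonneg_nonneg) auto
  have "(x 0 - 1 / 3)\<^sup>2 * (1 / 3) \<le> (x 0 - 1 / 3)\<^sup>2 * (4 / 3 - x 0)" using x by (intro mult_left_mono) auto
  then have "(x 0 - 1 / 3)\<^sup>2 \<le> \<epsilon> ^ 4" using D p by linarith
  moreover have "\<epsilon> ^ 4 \<le> \<epsilon> ^ 2" using \<epsilon> by (intro power_decreasing) auto
  ultimately have "(x 0 - 1 / 3)\<^sup>2 \<le> \<epsilon>\<^sup>2" by linarith
  then have x0: "\<bar>x 0 - 1 / 3\<bar> \<le> \<epsilon>" using \<epsilon> by (simp add: abs_le_square_iff[symmetric])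
  have "(1 / 4)\<^sup>2 \<le> (x 0)\<^sup>2" using x0 \<epsilon> by (intro power_mono) auto
  then have "(1 / 4)\<^sup>2 * (x 1 - x 2) ^ 4 \<le> (x 0)\<^sup>2 * (x 1 - x 2) ^ 4" by (rule mult_right_mono) simp
  moreover have "(1 / 4 :: real)\<^sup>2 = 1 / 16" by (simp add: power2_eq_square)
  ultimately have "1 / 16 * (x 1 - x 2) ^ 4 \<le> (x 0)\<^sup>2 * (x 1 - x 2) ^ 4" by (simp only:)
  moreover have "0 \<le> \<epsilon> ^ 4" using \<epsilon> by simp
  ultimately have "(x 1 - x 2) ^ 4 \<le> \<epsilon> ^ 4" using D n0 by linarith
  then have "\<bar>x 1 - x 2\<bar> ^ 4 \<le> \<epsilon> ^ 4" by simp
  then have "\<bar>x 1 - x 2\<bar> \<le> \<epsilon>" using \<epsilon> power_mono_iff[of "\<bar>x 1 - x 2\<bar>" \<epsilon> 4] by simp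
  then have "\<bar>x 1 - 1 / 3\<bar> \<le> \<epsilon>" "\<bar>x 2 - 1 / 3\<bar> \<le> \<epsilon>" using x0 x(4) by linarith+
  moreover have "i = 0 \<or> i = 1 \<or> i = 2" using i by linarith
  ultimately show ?thesis using x0 by auto
qed

lemma product_near_one:
  fixes a :: "nat \<Rightarrow> real"
  assumes a: "\<And>i. i < 6 \<Longrightarrow> \<bar>a i - 1\<bar> \<le> \<delta>" and \<delta>: "0 \<le> \<delta>" "\<delta> \<le> 1 / 24"
  shows "\<bar>(\<Prod>i<6. a i) - 1\<bar> \<le> 12 * \<delta>"
proof -
  have "1 - \<delta> \<le> a i" "a i \<le> 1 + \<delta>" if "i < 6" for i using a[OF that] by linarith+
  then have "(\<Prod>i<6::nat. 1 - \<delta>) \<le> (\<Prod>i<6. a i)" "(\<Prod>i<6. a i) \<le> (\<Prod>i<6::nat. 1 + \<delta>)"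
    using \<delta> by (intro prod_mono; force)+
  then have P: "(1 - \<delta>) ^ 6 \<le> (\<Prod>i<6. a i)" "(\<Prod>i<6. a i) \<le> (1 + \<delta>) ^ 6" by simp_all
  have low: "1 - 6 * \<delta> \<le> (1 - \<delta>) ^ 6" using Bernoulli_inequality[of "- \<delta>" 6] \<delta> by simp
  have d2: "\<delta> * \<delta> \<le> 1 / 24 * \<delta>" using \<delta> by (intro mult_right_mono) auto
  have d3: "\<delta> * (\<delta> * \<delta>) \<le> 1 / 24 * (1 / 24 * \<delta>)" using \<delta> d2 by (intro mult_mono) auto
  have "(1 + \<delta>) ^ 3 = 1 + 3 * \<delta> + 3 * (\<delta> * \<delta>) + \<delta> * (\<delta> * \<delta>)" by (simp add: power3_eq_cube algebra_simps)
  also have "\<dots> \<le> 1 + 4 * \<delta>" using d2 d3 \<delta> by linarith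
  finally have "((1 + \<delta>) ^ 3)\<^sup>2 \<le> (1 + 4 * \<delta>)\<^sup>2" using \<delta> by (intro power_mono) auto
  also have "\<dots> = 1 + 8 * \<delta> + 16 * (\<delta> * \<delta>)" by (simp add: power2_eq_square algebra_simps)
  also have "\<dots> \<le> 1 + 12 * \<delta>" using d2 \<delta> by linarith
  finally have "(1 + \<delta>) ^ 6 \<le> 1 + 12 * \<delta>" by (simp flip: power_mult)
  then show ?thesis using P low \<delta> by linarith
qed

text \<open>
  Give each vertex the weight \<open>1 / (3 v)\<close>, where \<open>v\<close> is the size of its part. Then the blowup is exactly extremal, however the parts
  deviate from balance, and \<open>star_mean_deficit\<close> shows that the weighted star mean of the graph falls short by an amount linear in the
  number of wrong pairs. Tuples without a wrong pair contribute equally to both means, and on the other tuples the weights are within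
  a small relative error of uniform ones, so the deficit survives in the unweighted count. The constant \<open>K\<close> is \<open>729\<close> times
  \<open>100776960\<close>.
\<close>

lemma star_count_gain:
  assumes G: "simple_graph G" and f: "\<And>x. f x < 3"
    and min: "\<forall>g. (\<forall>x. g x < 3) \<longrightarrow> card (wrong (verts G) (adj G) f) \<le> card (wrong (verts G) (adj G) g)"
    and n: "0 < nverts G" and K: "K = 73466403840" and \<epsilon>: "0 < \<epsilon>" "6912 * K * \<epsilon> \<le> 1"
    and bal: "\<And>i. i < 3 \<Longrightarrow> \<bar>real (card {x \<in> verts G. f x = i}) / real (nverts G) - 1 / 3\<bar> \<le> \<epsilon>"
    and few: "72 * 729 * real (card (wrong (verts G) (adj G) f)) \<le> (real (nverts G))\<^sup>2"
  shows "real (card (wrong (verts G) (adj G) f)) * real (nverts G) ^ 4 / (2 * K) \<le>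
    star_count (verts G) (part_adj f) - star_count (verts G) (adj G)"
proof -
  let ?V = "verts G" and ?A = "adj G"
  define n' where "n' = real (nverts G)"
  define m where "m = real (card (wrong ?V ?A f))"
  define v where "v i = real (card {x \<in> ?V. f x = i})" for i
  define w where "w x = 1 / (3 * v (f x))" for x
  define H where "H = hits ?V (wrong ?V ?A f)"
  have fin: "finite ?V" using G by (simp add: simple_graph_def)
  have n0: "0 < n'" using n by (simp add: n'_def)
  have m0: "0 \<le> m" by (simp add: m_def)
  have \<epsilon>': "\<epsilon> \<le> 1 / 1000" using \<epsilon> unfolding K by simp
  have bal': "1 / 3 - \<epsilon> \<le> v i / n'" "v i / n' \<le> 1 / 3 + \<epsilon>" if "i < 3" for i
    using bal[OF that] unfolding v_def n'_def by linarith+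
  have v0: "0 < v i" if "i < 3" for i
  proof -
    have "0 < v i / n'" using bal'(1)[OF that] \<epsilon>' by linarith
    then show ?thesis using n0 by (simp add: zero_less_divide_iff)
  qed
  have near: "\<bar>n' * w x - 1\<bar> \<le> 4 * \<epsilon>" for x
  proof -
    define t where "t = v (f x) / n'"
    have t: "1 / 3 - \<epsilon> \<le> t" "t \<le> 1 / 3 + \<epsilon>" unfolding t_def by (rule bal'[OF f])+
    then have t0: "0 < t" using \<epsilon>' by linarith
    have e: "n' * w x = 1 / (3 * t)" using n0 v0[OF f[of x]] unfolding w_def t_def by (simp add: field_simps)
    have ee: "\<epsilon> * \<epsilon> \<le> 1 / 1000 * \<epsilon>" using \<epsilon> \<epsilon>' by (intro mult_right_mono) auto
    have "(1 - 4 * \<epsilon>) * (3 * t) \<le> (1 - 4 * \<epsilon>) * (3 * (1 / 3 + \<epsilon>))" using t \<epsilon>' by (intro mult_left_mono) auto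
    also have "\<dots> = 1 - \<epsilon> - 12 * (\<epsilon> * \<epsilon>)" by (simp add: algebra_simps)
    also have "\<dots> \<le> 1" using \<epsilon>(1) mult_pos_pos[OF \<epsilon>(1) \<epsilon>(1)] by linarith
    finally have 1: "1 - 4 * \<epsilon> \<le> 1 / (3 * t)" using t0 by (simp add: pos_le_divide_eq)
    have "1 \<le> 1 + \<epsilon> - 12 * (\<epsilon> * \<epsilon>)" using ee \<epsilon>(1) by linarith
    also have "\<dots> = (1 + 4 * \<epsilon>) * (3 * (1 / 3 - \<epsilon>))" by (simp add: algebra_simps)
    also have "\<dots> \<le> (1 + 4 * \<epsilon>) * (3 * t)" using t \<epsilon>(1) by (intro mult_left_mono) auto
    finally have 2: "1 / (3 * t) \<le> 1 + 4 * \<epsilon>" using t0 by (simp add: pos_divide_le_eq)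
    show ?thesis unfolding e using 1 2 by linarith
  qed
  have third: "(\<Sum>x\<in>?V. w x * of_bool (f x = i)) = 1 / 3" if "i < 3" for i
  proof -
    have "(\<Sum>x\<in>?V. w x * of_bool (f x = i)) = (\<Sum>x\<in>?V. of_bool (f x = i) * (1 / (3 * v i)))"
      by (rule sum.cong) (auto simp: w_def)
    also have "\<dots> = v i * (1 / (3 * v i))"
      unfolding sum_distrib_right[symmetric] sum_of_bool_card[OF fin] v_def ..
    finally show ?thesis using v0[OF that] by simp
  qed
  have one: "(\<Sum>x\<in>?V. w x) = 1"
  proof -
    have "w x = w x * of_bool (f x = 0) + w x * of_bool (f x = 1) + w x * of_bool (f x = 2)" for x
    proof -
      have "f x = 0 \<or> f x = 1 \<or> f x = 2" using f[of x] by linarith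
      then show ?thesis by auto
    qed
    then have "(\<Sum>x\<in>?V. w x) = (\<Sum>x\<in>?V. w x * of_bool (f x = 0) + w x * of_bool (f x = 1) + w x * of_bool (f x = 2))"
      by (intro sum.cong refl)
    then show ?thesis using third[of 0] third[of 1] third[of 2] by (simp add: sum.distrib)
  qed
  have Sf: "star_mean ?V (part_adj f) w = 2 / 729"
  proof -
    have t: "(\<Sum>x\<in>?V. w x * of_bool (f x = 0)) = 1 / 3" "(\<Sum>x\<in>?V. w x * of_bool (f x = 1)) = 1 / 3"
      "(\<Sum>x\<in>?V. w x * of_bool (f x = 2)) = 1 / 3" by (rule third, simp)+
    show ?thesis unfolding star_mean_part_adj[of ?V f w, OF f] t by (simp add: power2_eq_square)
  qed
  have wt: "n' ^ 6 * weight w \<phi> = (\<Prod>i<6. n' * w (\<phi> i))" for \<phi>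
    unfolding weight_def prod.distrib by simp
  have wt_near: "\<bar>n' ^ 6 * weight w \<phi> - 1\<bar> \<le> 48 * \<epsilon>" for \<phi>
    using product_near_one[of "\<lambda>i. n' * w (\<phi> i)" "4 * \<epsilon>"] near \<epsilon>(1) \<epsilon>' unfolding wt by simp
  define D where "D = star_mean ?V (part_adj f) w - star_mean ?V ?A w"
  define E where "E = star_count ?V (part_adj f) - star_count ?V ?A"
  have D: "n' ^ 6 * D = (\<Sum>\<phi>\<in>H. (n' ^ 6 * weight w \<phi>) * gain ?A f \<phi>)"
    unfolding D_def H_def sum_gain[OF fin adj_irrefl[OF G]] by (simp add: sum_distrib_left mult.assoc)
  have E: "E = (\<Sum>\<phi>\<in>H. 1 * gain ?A f \<phi>)"
    unfolding E_def H_def star_count_eq sum_gain[OF fin adj_irrefl[OF G]] by (simp add: weight_def)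
  have "\<bar>\<Sum>\<phi>\<in>H. (n' ^ 6 * weight w \<phi>) * gain ?A f \<phi>\<bar> \<le> 36 * 2 * m * n' ^ 4"
    unfolding H_def m_def n'_def
  proof (rule sum_gain_bound[OF fin])
    fix \<phi> show "\<bar>real (nverts G) ^ 6 * weight w \<phi>\<bar> \<le> 2" using wt_near[of \<phi>] \<epsilon>' unfolding n'_def by linarith
  qed simp
  then have "\<bar>n' ^ 6 * D\<bar> \<le> 36 * 2 * m * n' ^ 4" unfolding D .
  also have "\<dots> = (72 * m) * n' ^ 4" by simp
  also have "\<dots> \<le> (n'\<^sup>2 / 729) * n' ^ 4" using few by (intro mult_right_mono) (simp_all add: m_def n'_def)
  also have "\<dots> = n' ^ 6 * (1 / 729)" by (simp flip: power_add)
  finally have "\<bar>D\<bar> \<le> 1 / 729" using n0 by (simp add: abs_mult)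
  then have S: "1 / 729 \<le> star_mean ?V ?A w" unfolding D_def Sf by linarith
  define \<mu> where "\<mu> = (1 - 4 * \<epsilon>) / n'"
  have \<mu>: "0 \<le> \<mu>" "\<mu> \<le> w x" for x
  proof -
    show "0 \<le> \<mu>" unfolding \<mu>_def using \<epsilon>' n0 by simp
    have "1 - 4 * \<epsilon> \<le> n' * w x" using near[of x] by linarith
    then show "\<mu> \<le> w x" unfolding \<mu>_def using n0 by (simp add: pos_divide_le_eq mult.commute)
  qed
  have "100776960 * star_mean ?V ?A w + \<mu>\<^sup>2 * m * star_mean ?V ?A w \<le> 276480"
    unfolding m_def by (rule star_mean_deficit[OF fin \<mu>(2) \<mu>(1) one adj_commute adj_irrefl[OF G] min])
  moreover have "\<mu>\<^sup>2 * m * (1 / 729) \<le> \<mu>\<^sup>2 * m * star_mean ?V ?A w" using S m0 by (intro mult_left_mono) auto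
  ultimately have "\<mu>\<^sup>2 * m * (1 / 729) \<le> 276480 - 100776960 * star_mean ?V ?A w" by linarith
  then have "729 * (\<mu>\<^sup>2 * m * (1 / 729)) \<le> 729 * (276480 - 100776960 * star_mean ?V ?A w)" by (rule mult_left_mono) simp
  then have "\<mu>\<^sup>2 * m \<le> K * D" unfolding K D_def Sf by (simp add: algebra_simps)
  then have "n' ^ 6 * (\<mu>\<^sup>2 * m) \<le> n' ^ 6 * (K * D)" using n0 by (intro mult_left_mono) auto
  moreover have "n' ^ 6 * (\<mu>\<^sup>2 * m) = (1 - 4 * \<epsilon>)\<^sup>2 * (m * n' ^ 4)"
    unfolding \<mu>_def using n0 by (simp add: power_divide field_simps flip: power_add)
  moreover have "3 / 4 * (m * n' ^ 4) \<le> (1 - 4 * \<epsilon>)\<^sup>2 * (m * n' ^ 4)"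
  proof (intro mult_right_mono)
    have "(9 / 10)\<^sup>2 \<le> (1 - 4 * \<epsilon>)\<^sup>2" using \<epsilon>' by (intro power_mono) auto
    then show "3 / 4 \<le> (1 - 4 * \<epsilon>)\<^sup>2" by (simp add: power2_eq_square)
  qed (use m0 n0 in simp)
  ultimately have D_low: "3 / 4 * (m * n' ^ 4) \<le> K * (n' ^ 6 * D)" by (simp only: mult_ac)
  have diff: "E - n' ^ 6 * D = (\<Sum>\<phi>\<in>H. (1 - n' ^ 6 * weight w \<phi>) * gain ?A f \<phi>)"
    unfolding E D sum_subtractf[symmetric] left_diff_distrib ..
  have "\<bar>\<Sum>\<phi>\<in>H. (1 - n' ^ 6 * weight w \<phi>) * gain ?A f \<phi>\<bar> \<le> 36 * (48 * \<epsilon>) * m * n' ^ 4"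
    unfolding H_def m_def n'_def
  proof (rule sum_gain_bound[OF fin])
    fix \<phi> show "\<bar>1 - real (nverts G) ^ 6 * weight w \<phi>\<bar> \<le> 48 * \<epsilon>"
      using wt_near[of \<phi>] unfolding n'_def by linarith
  qed (use \<epsilon>(1) in simp)
  then have "\<bar>E - n' ^ 6 * D\<bar> \<le> 36 * (48 * \<epsilon>) * m * n' ^ 4" unfolding diff .
  then have "K * (n' ^ 6 * D) - K * E \<le> K * (36 * (48 * \<epsilon>) * m * n' ^ 4)"
    unfolding right_diff_distrib[symmetric] by (intro mult_left_mono) (auto simp: K)
  also have "\<dots> = (6912 * K * \<epsilon>) * (1 / 4 * (m * n' ^ 4))" by simp
  also have "\<dots> \<le> 1 * (1 / 4 * (m * n' ^ 4))" by (rule mult_right_mono[OF \<epsilon>(2)]) (use m0 n0 in simp)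
  finally have "1 / 2 * (m * n' ^ 4) \<le> K * E" using D_low by linarith
  then have "m * n' ^ 4 / (2 * K) \<le> E" unfolding K by simp
  then show ?thesis unfolding m_def n'_def E_def .
qed

text \<open>
  Uniform weights give a rough form of stability first: few wrong pairs, hence a blowup with almost as many stars, hence nearly
  balanced parts. This provides the hypotheses of \<open>star_count_gain\<close>.
\<close>

lemma star_count_near_extremal:
  assumes G: "simple_graph G" and f: "\<And>x. f x < 3"
    and min: "\<forall>g. (\<forall>x. g x < 3) \<longrightarrow> card (wrong (verts G) (adj G) f) \<le> card (wrong (verts G) (adj G) g)"
    and n: "0 < nverts G" and K: "K = 73466403840" and \<epsilon>: "0 < \<epsilon>" "6912 * K * \<epsilon> \<le> 1"
    and \<eta>: "0 < \<eta>" "\<eta> * (1 + 36 * K) = \<epsilon> ^ 4 / 162"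
    and S: "(2 / 729 - \<eta>) * real (nverts G) ^ 6 \<le> star_count (verts G) (adj G)"
  shows "real (card (wrong (verts G) (adj G) f)) * real (nverts G) ^ 4 / (2 * K) \<le>
    star_count (verts G) (part_adj f) - star_count (verts G) (adj G)"
proof (rule star_count_gain[OF G f min n K \<epsilon>])
  let ?V = "verts G" and ?A = "adj G"
  define n' where "n' = real (nverts G)"
  define m where "m = real (card (wrong ?V ?A f))"
  define s where "s = star_mean ?V ?A (\<lambda>_. 1 / n')"
  have fin: "finite ?V" using G by (simp add: simple_graph_def)
  have ne: "?V \<noteq> {}" using n by auto
  have n0: "0 < n'" using n by (simp add: n'_def)
  have m0: "0 \<le> m" by (simp add: m_def)
  have \<epsilon>': "\<epsilon> \<le> 1 / 1000" using \<epsilon> unfolding K by simp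
  have e4: "\<epsilon> ^ 4 \<le> (1 / 1000) ^ 4" using \<epsilon> \<epsilon>' by (intro power_mono) auto
  have \<eta>K: "36 * K * \<eta> \<le> \<epsilon> ^ 4 / 162" using \<eta> by (simp add: algebra_simps)
  have Keta: "36 * K * \<eta> \<le> 1 / 10 ^ 14" using \<eta>K e4 by (simp add: power_divide)
  have \<eta>1: "\<eta> \<le> 1 / 729" using Keta unfolding K by simp
  have s: "s = star_count ?V ?A / n' ^ 6" unfolding s_def n'_def by (rule star_count_uniform[OF ne fin])
  have s_low: "2 / 729 - \<eta> \<le> s" unfolding s using S n0 by (simp add: pos_le_divide_eq n'_def)
  have "100776960 * s + (1 / n')\<^sup>2 * m * s \<le> 276480"
    unfolding s_def m_def
    by (rule star_mean_deficit[OF fin _ _ _ adj_commute adj_irrefl[OF G] min]) (use n0 in \<open>auto simp: n'_def\<close>)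
  moreover have "(1 / n')\<^sup>2 * m * (1 / 729) \<le> (1 / n')\<^sup>2 * m * s" using s_low \<eta>1 m0 by (intro mult_left_mono) auto
  ultimately have h1: "(1 / n')\<^sup>2 * m * (1 / 729) \<le> 276480 - 100776960 * s" by linarith
  have h2: "276480 - 100776960 * s \<le> 100776960 * \<eta>"
    using mult_left_mono[OF s_low, of 100776960] by (simp add: algebra_simps)
  have "729 * ((1 / n')\<^sup>2 * m * (1 / 729)) \<le> 729 * (100776960 * \<eta>)"
    by (intro mult_left_mono order_trans[OF h1 h2]) simp
  then have "(1 / n')\<^sup>2 * m \<le> K * \<eta>" unfolding K by simp
  then have m_le: "m \<le> K * \<eta> * n'\<^sup>2" using n0 by (simp add: power_divide pos_divide_le_eq)
  show "72 * 729 * real (card (wrong ?V ?A f)) \<le> (real (nverts G))\<^sup>2"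
  proof -
    have "72 * 729 * m \<le> (72 * 729 * (K * \<eta>)) * n'\<^sup>2" using m_le by simp
    also have "\<dots> \<le> 1 * n'\<^sup>2" using Keta by (intro mult_right_mono) auto
    finally show ?thesis by (simp add: m_def n'_def)
  qed
  define x where "x i = real (card {x \<in> ?V. f x = i}) / n'" for i
  have Fx: "F4_poly x = star_count ?V (part_adj f) / n' ^ 6"
    unfolding star_count_part_adj[of ?V f, OF fin f] F4_poly_def x_def using n0
    by (simp add: field_simps eval_nat_numeral One_nat_def)
  have "\<bar>star_count ?V (part_adj f) - star_count ?V ?A\<bar> \<le> 36 * 1 * m * n' ^ 4"
  proof -
    have "star_count ?V (part_adj f) - star_count ?V ?A = (\<Sum>\<phi>\<in>hits ?V (wrong ?V ?A f). 1 * gain ?A f \<phi>)"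
      unfolding star_count_eq sum_gain[OF fin adj_irrefl[OF G]] by (simp add: weight_def)
    then show ?thesis unfolding m_def n'_def by (simp only:) (rule sum_gain_bound[OF fin], simp_all)
  qed
  also have "36 * 1 * m * n' ^ 4 \<le> 36 * (K * \<eta> * n'\<^sup>2) * n' ^ 4" using m_le n0 by (intro mult_right_mono) auto
  also have "\<dots> = 36 * K * \<eta> * n' ^ 6" by (simp flip: power_add)
  finally have "star_count ?V ?A - 36 * K * \<eta> * n' ^ 6 \<le> star_count ?V (part_adj f)" by linarith
  then have "(star_count ?V ?A - 36 * K * \<eta> * n' ^ 6) / n' ^ 6 \<le> F4_poly x"
    unfolding Fx using n0 by (intro divide_right_mono) auto
  then have "s - 36 * K * \<eta> \<le> F4_poly x" unfolding s using n0 by (simp add: diff_divide_distrib)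
  moreover have "\<eta> + 36 * K * \<eta> = \<epsilon> ^ 4 / 162" using \<eta>(2) by (simp add: algebra_simps)
  ultimately have Flow: "2 / 729 - \<epsilon> ^ 4 / 162 \<le> F4_poly x" using s_low by linarith
  have sum1: "x 0 + x 1 + x 2 = 1"
  proof -
    have "(of_bool (f y = 0) + of_bool (f y = 1) + of_bool (f y = 2) :: real) = 1" for y
    proof -
      have "f y = 0 \<or> f y = 1 \<or> f y = 2" using f[of y] by linarith
      then show ?thesis by auto
    qed
    then have "(\<Sum>y\<in>?V. of_bool (f y = 0) + of_bool (f y = 1) + of_bool (f y = 2) :: real) = (\<Sum>y\<in>?V. 1)"
      by (intro sum.cong refl)
    then have "real (card {y \<in> ?V. f y = 0}) + real (card {y \<in> ?V. f y = 1}) + real (card {y \<in> ?V. f y = 2}) = n'"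
      unfolding sum.distrib sum_of_bool_card[OF fin] n'_def by simp
    then show ?thesis unfolding x_def add_divide_distrib[symmetric] using n0 by simp
  qed
  have x0: "0 \<le> x i" for i unfolding x_def using n0 by simp
  have e12: "\<epsilon> \<le> 1 / 12" using \<epsilon>' by simp
  show "\<bar>real (card {x \<in> ?V. f x = i}) / real (nverts G) - 1 / 3\<bar> \<le> \<epsilon>" if "i < 3" for i
    using near_balanced[of x, OF x0 x0 x0 sum1 \<epsilon>(1) e12 Flow that] unfolding x_def n'_def .
qed

text \<open>
  Passing from all tuples to injective ones costs only a factor \<open>1 / n\<close> relative to the tuples that contain a wrong pair, which
  is absorbed for large \<open>n\<close>.
\<close>

lemma density_gain:
  assumes G: "simple_graph G" and f: "\<And>x. f x < 3" and n: "5184 * K \<le> real (nverts G)" "6 \<le> nverts G" and K: "0 < K"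
    and D: "real (card (wrong (verts G) (adj G) f)) * real (nverts G) ^ 4 / (2 * K) \<le>
      star_count (verts G) (part_adj f) - star_count (verts G) (adj G)"
  shows "real (card (wrong (verts G) (adj G) f)) \<le>
    K * (ind_density F4 (part_graph (verts G) f) - ind_density F4 G) * (real (nverts G))\<^sup>2"
proof -
  let ?V = "verts G" and ?A = "adj G" and ?P = "part_graph (verts G) f"
  define n' where "n' = real (nverts G)"
  define m where "m = real (card (wrong ?V ?A f))"
  define H where "H = hits ?V (wrong ?V ?A f)"
  define d where "d = 12 * real (ind_count F4 ?P) - 12 * real (ind_count F4 G)"
  have fin: "finite ?V" using G by (simp add: simple_graph_def)
  have finH: "finite H" unfolding H_def by (rule finite_hits[OF fin])
  have n0: "0 < n'" using n by (simp add: n'_def)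
  have m0: "0 \<le> m" by (simp add: m_def)
  have "star_count ?V (part_adj f) - star_count ?V ?A = (\<Sum>\<phi>\<in>H. gain ?A f \<phi>)"
    unfolding H_def star_count_eq sum_gain[OF fin adj_irrefl[OF G]] by (simp add: weight_def)
  also have "\<dots> = d + (\<Sum>\<phi>\<in>H - inj_tuples ?V. gain ?A f \<phi>)"
    unfolding d_def sum_gain_injective[OF G] H_def[symmetric] using sum.Int_Diff[OF finH] by blast
  also have "(\<Sum>\<phi>\<in>H - inj_tuples ?V. gain ?A f \<phi>) \<le> real (card (H - inj_tuples ?V)) * 1"
    by (rule sum_bounded_above) (use gain_bound[of ?A f] in \<open>simp add: abs_le_iff\<close>)
  also have "real (card (H - inj_tuples ?V)) * 1 \<le> real (1296 * (card (wrong ?V ?A f) * card ?V ^ 3))"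
    unfolding H_def mult_1_right by (intro of_nat_mono card_noninjective_hits fin finite_wrong) (simp add: wrong_def)
  also have "\<dots> = 1296 * m * n' ^ 3" by (simp add: m_def n'_def)
  finally have "m * n' ^ 4 / (2 * K) \<le> d + 1296 * m * n' ^ 3" using D by (simp add: m_def n'_def)
  then have d1: "m * n' ^ 4 \<le> 2 * K * d + 2 * K * (1296 * m * n' ^ 3)" using K by (simp add: pos_divide_le_eq algebra_simps)
  have "2 * K * (1296 * m * n' ^ 3) = (5184 * K) * (m * n' ^ 3 / 2)" by simp
  also have "\<dots> \<le> n' * (m * n' ^ 3 / 2)" using n(1) m0 n0 by (intro mult_right_mono) (simp_all add: n'_def)
  also have "\<dots> = m * n' ^ 4 / 2" by (simp add: eval_nat_numeral One_nat_def)
  finally have d2: "m * n' ^ 4 \<le> 4 * K * d" using d1 by linarith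
  define c where "c = real (nverts G choose 6)"
  have c0: "0 < c" unfolding c_def using n(2) by simp
  have c720: "720 * c \<le> n' ^ 6"
  proof -
    have "720 * c = n' * (n' - 1) * (n' - 2) * (n' - 3) * (n' - 4) * (n' - 5)"
      unfolding c_def n'_def by (rule choose6)
    also have "\<dots> \<le> n' * n' * n' * n' * n' * n'"
      using n(2) by (intro mult_mono mult_nonneg_nonneg) (auto simp: n'_def)
    finally show ?thesis by (simp add: eval_nat_numeral One_nat_def mult.assoc)
  qed
  have d0: "0 \<le> d"
  proof -
    have "0 \<le> 4 * K * d" using d2 m0 n0 by (intro order_trans[OF _ d2]) simp
    then show ?thesis using K by (simp add: zero_le_mult_iff)
  qed
  define \<Delta> where "\<Delta> = ind_density F4 ?P - ind_density F4 G"
  have \<Delta>: "\<Delta> = d / (12 * c)"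
    unfolding \<Delta>_def ind_density_def d_def verts_part_graph nverts_F4 c_def by (simp add: diff_divide_distrib)
  have \<Delta>0: "0 \<le> \<Delta>" unfolding \<Delta> using d0 c0 by simp
  have "m * n' ^ 4 \<le> 4 * K * (12 * c * \<Delta>)" using d2 c0 unfolding \<Delta> by simp
  also have "\<dots> \<le> K * \<Delta> * (720 * c)" using K \<Delta>0 c0 by simp
  also have "\<dots> \<le> K * \<Delta> * n' ^ 6" using c720 K \<Delta>0 by (intro mult_left_mono) auto
  also have "\<dots> = (K * \<Delta> * n'\<^sup>2) * n' ^ 4" by (simp flip: power_add)
  finally have "m \<le> K * \<Delta> * n'\<^sup>2" using n0 by simp
  then show ?thesis unfolding m_def n'_def \<Delta>_def .
qed

text \<open>
  Graphs far from extremal satisfy the bound trivially, as at most \<open>n\<^sup>2\<close> pairs can be changed. Otherwise the partition with the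
  fewest wrong pairs gives a blowup whose density exceeds that of the graph by a multiple of the number of wrong pairs.
\<close>

theorem perfectly_stable_F4: "perfectly_stable F4 BB"
proof -
  define K :: real where "K = 73466403840"
  define \<epsilon> where "\<epsilon> = 1 / (6912 * K)"
  define \<eta> where "\<eta> = \<epsilon> ^ 4 / 162 / (1 + 36 * K)"
  have K0: "0 < K" by (simp add: K_def)
  have \<epsilon>: "0 < \<epsilon>" "6912 * K * \<epsilon> \<le> 1" using K0 by (simp_all add: \<epsilon>_def)
  have pos: "0 < 1 + 36 * K" using K0 by linarith
  then have ne: "1 + 36 * K \<noteq> 0" by (rule less_imp_neq[THEN not_sym])
  have "0 < \<eta>" using pos \<epsilon>(1) by (simp add: \<eta>_def)
  moreover have "\<eta> * (1 + 36 * K) = \<epsilon> ^ 4 / 162" by (rule iffD1[OF nonzero_eq_divide_eq[OF ne] \<eta>_def])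
  ultimately have \<eta>: "0 < \<eta>" "\<eta> * (1 + 36 * K) = \<epsilon> ^ 4 / 162" by simp_all
  have \<eta>1: "\<eta> \<le> 1 / 729"
  proof -
    have "\<epsilon> ^ 4 \<le> 1" using \<epsilon> by (intro power_le_one) (auto simp: \<epsilon>_def K_def)
    then have "\<eta> * (1 + 36 * K) \<le> 1 / 162" using \<eta>(2) by simp
    then show ?thesis using \<eta>(1) unfolding K_def by simp
  qed
  have "(\<lambda>n. real n / real n) \<longlonglongrightarrow> 1"
    by (rule tendsto_eventually) (use eventually_gt_at_top[of 0] in eventually_elim, simp)
  then have "(\<lambda>n. real (n choose 6) / real n ^ 6) \<longlonglongrightarrow> 1 / 720" by (rule choose6_limit)
  then have "\<forall>\<^sub>F n in sequentially. (1 - \<eta>) / 720 < real (n choose 6) / real n ^ 6"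
    by (rule order_tendstoD) (use \<eta>(1) in simp)
  moreover have "\<forall>\<^sub>F n in sequentially. 40 / 243 - \<eta> < max_density F4 n"
    by (rule order_tendstoD[OF max_density_limit]) (use \<eta>(1) in simp)
  ultimately have "\<forall>\<^sub>F n in sequentially. (1 - \<eta>) / 720 < real (n choose 6) / real n ^ 6 \<and> 40 / 243 - \<eta> < max_density F4 n"
    by (rule eventually_conj)
  then obtain N where N: "\<And>n. N \<le> n \<Longrightarrow> (1 - \<eta>) / 720 < real (n choose 6) / real n ^ 6"
    "\<And>n. N \<le> n \<Longrightarrow> 40 / 243 - \<eta> < max_density F4 n"
    unfolding eventually_sequentially by blast
  define C where "C = real N + 5184 * K + 6 + 1 / \<eta>"
  have C: "real N \<le> C" "5184 * K \<le> C" "6 \<le> C" "1 / \<eta> \<le> C" "K \<le> C" "0 < C"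
    using K0 \<eta>(1) unfolding C_def by (simp_all add: add_nonneg_nonneg add_pos_nonneg)
  show ?thesis unfolding perfectly_stable_def
  proof (intro exI[of _ C] conjI C(6) allI impI, elim conjE)
    fix G assume G: "simple_graph G" and n: "C \<le> real (nverts G)"
    have nN: "N \<le> nverts G" and n6: "6 \<le> nverts G" and nK: "5184 * K \<le> real (nverts G)"
      using n C by linarith+
    have n0: "0 < nverts G" using n6 by simp
    have fin: "finite (verts G)" using G by (simp add: simple_graph_def)
    let ?m = "\<lambda>f. card (wrong (verts G) (adj G) f)"
    define gap where "gap = max_density F4 (nverts G) - ind_density F4 G"
    have gap0: "0 \<le> gap" unfolding gap_def using max_density_ge[OF G, of F4] by simp
    obtain f where f: "\<forall>x. f x < 3" and min: "\<forall>g. (\<forall>x. g x < 3) \<longrightarrow> ?m f \<le> ?m g"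
      using ex_has_least_nat[of "\<lambda>f. \<forall>x. f x < 3" "\<lambda>_. 0" ?m] by auto
    have f3: "f x < 3" for x using f by blast
    have edit: "real (edit_dist G BB) \<le> real (?m f)" using edit_dist_le[of G f, OF G f3] by simp
    have "real (?m f) \<le> C * gap * real (nverts G) ^ 2"
    proof (cases "\<eta> \<le> gap")
      case True
      have "real (?m f) \<le> real ((nverts G)\<^sup>2)" using card_wrong_le[OF fin] by (rule of_nat_mono)
      also have "\<dots> = 1 * real (nverts G) ^ 2" by simp
      also have "1 \<le> (1 / \<eta>) * gap" using True \<eta>(1) by (simp add: pos_le_divide_eq)
      also have "\<dots> \<le> C * gap" by (rule mult_right_mono[OF C(4) gap0])
      finally show ?thesis by (simp add: mult_right_mono)
    next
      case False
      define c where "c = real (nverts G choose 6)"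
      have c0: "0 < c" unfolding c_def using n6 by simp
      have dens: "40 / 243 - 2 * \<eta> \<le> ind_density F4 G" using False N(2)[OF nN] unfolding gap_def by linarith
      have "(1 - \<eta>) / 720 \<le> c / real (nverts G) ^ 6" using N(1)[OF nN] by (simp add: c_def)
      then have c_low: "(1 - \<eta>) / 720 * real (nverts G) ^ 6 \<le> c" using n0 by (simp add: pos_le_divide_eq)
      have "2 / 729 - \<eta> \<le> (1 - \<eta>) / 60 * (40 / 243 - 2 * \<eta>)"
      proof -
        have "(1 - \<eta>) / 60 * (40 / 243 - 2 * \<eta>) - (2 / 729 - \<eta>) = \<eta> * (1 - 2 / 729 - 1 / 30) + \<eta> * \<eta> / 30"
          by (simp add: field_simps)
        moreover have "0 \<le> \<eta> * (1 - 2 / 729 - 1 / 30) + \<eta> * \<eta> / 30" using \<eta>(1) by simp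
        ultimately have "0 \<le> (1 - \<eta>) / 60 * (40 / 243 - 2 * \<eta>) - (2 / 729 - \<eta>)" by (simp only:)
        then show ?thesis by (rule diff_ge_0_iff_ge[THEN iffD1])
      qed
      then have "(2 / 729 - \<eta>) * real (nverts G) ^ 6 \<le> ((1 - \<eta>) / 60 * (40 / 243 - 2 * \<eta>)) * real (nverts G) ^ 6"
        by (rule mult_right_mono) simp
      also have "\<dots> = 12 * (40 / 243 - 2 * \<eta>) * ((1 - \<eta>) / 720 * real (nverts G) ^ 6)" by simp
      also have "\<dots> \<le> 12 * (40 / 243 - 2 * \<eta>) * c" using \<eta>1 by (intro mult_left_mono[OF c_low]) simp
      also have "\<dots> \<le> 12 * ind_density F4 G * c" using dens c0 by (intro mult_right_mono mult_left_mono) auto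
      also have "\<dots> = 12 * real (ind_count F4 G)"
        using c0 unfolding ind_density_def nverts_F4 c_def by simp
      also have "\<dots> \<le> star_count (verts G) (adj G)" by (rule ind_count_le_star_count[OF G])
      finally have "(2 / 729 - \<eta>) * real (nverts G) ^ 6 \<le> star_count (verts G) (adj G)" .
      note near = star_count_near_extremal[OF G f3 min n0 K_def \<epsilon> \<eta> this]
      have "real (?m f) \<le> K * (ind_density F4 (part_graph (verts G) f) - ind_density F4 G) * (real (nverts G))\<^sup>2"
        by (rule density_gain[OF G f3 nK n6 K0 near])
      also have "\<dots> \<le> C * gap * (real (nverts G))\<^sup>2"
      proof (intro mult_right_mono)
        have "ind_density F4 (part_graph (verts G) f) - ind_density F4 G \<le> gap"
          unfolding gap_def using max_density_ge[OF simple_part_graph[OF fin], of F4 f] by simp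
        then have "K * (ind_density F4 (part_graph (verts G) f) - ind_density F4 G) \<le> K * gap"
          using K0 by (intro mult_left_mono) auto
        also have "\<dots> \<le> C * gap" by (rule mult_right_mono[OF C(5) gap0])
        finally show "K * (ind_density F4 (part_graph (verts G) f) - ind_density F4 G) \<le> C * gap" .
      qed simp
      finally show ?thesis .
    qed
    then show "real (edit_dist G BB) \<le> C * (max_density F4 (nverts G) - ind_density F4 G) * real (nverts G) ^ 2"
      using edit unfolding gap_def by linarith
  qed
qed

section \<open>Conclusion\<close>

theorem theorem3p2:
  fixes F\<^sub>4 B \<tau> :: pgraph
  assumes "F\<^sub>4 = on_first 6 {{0,1}, {0,2}, {0,4}}"
    and "B = on_first 3 {{1,2}}"
    and "\<tau> = on_first 2 {{0,1}}"
  shows "lambda F\<^sub>4 = 40 / 243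
    \<and> criterion_ii F\<^sub>4 B 6 \<tau>
    \<and> perfectly_stable F\<^sub>4 B
    \<and> unique_maximiser F\<^sub>4 B (\<lambda>i\<in>{..<3}. 1/3)"
  unfolding assms using lambda_F4 criterion_F4 perfectly_stable_F4 unique_maximiser_F4 by blast

end
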